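(* Let $f_1,f_2,f_3,f_4$ be strongly hyperbolic functions with $f_1(1)=f_3(1)=1$, and let $\mathcal{M}_f=\mathcal{M}(f_1,f_2;f_3,f_4)$. Then the automorphism group of $\mathcal{M}_f$ has dimension (i) $6$ if and only if $f_i(x)=1/x$ for $i=1,2,3,4$; (ii) $4$ if and only if $f_1(x)=x^{-r_1}$, $f_2(x)=s_1^{-1}x^{-r_1}$, $f_3(x)=x^{-r_2}$, $f_4(x)=s_2^{-1}x^{-r_2}$ for some $r_1,s_1,r_2,s_2\in\mathbb{R}^+$ with $(r_1,s_1,r_2,s_2)\neq(1,1,1,1)$; (iii) $3$ in all other cases.
   Context: Identify $\mathbb{S}^1$ with $\mathbb{R}\cup\{\infty\}$, $\mathcal{P}=\mathbb{S}^1\times\mathbb{S}^1$, $\mathbb{R}^+=(0,\infty)$. A function $f:\mathbb{R}^+\to\mathbb{R}^+$ is strongly hyperbolic if: (1) $\lim_{x\to0+}f(x)=+\infty$, $\lim_{x\to+\infty}f(x)=0$; (2) $f$ strictly convex; (3) $\lim_{x\to+\infty}f(x+b)/f(x)=1$ for each $b\in\mathbb{R}$; (4) $f$ differentiable; (5) $\ln|f'|$ strictly convex. For strongly hyperbolic $f_1,f_2$, $a>0$, $b,c\in\mathbb{R}$: $f_{a,b,c}(x)=af_1(x+b)+c$ for $x>-b$, $f_{a,b,c}(x)=-af_2(-x-b)+c$ for $x<-b$; $\overline{f_{a,b,c}}=\{(x,f_{a,b,c}(x)):x\ne-b\}\cup\{(-b,\infty),(\infty,c)\}$; $\overline{l_{s,t}}=\{(x,sx+t):x\in\mathbb{R}\}\cup\{(\infty,\infty)\}$;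 $\mathcal{C}^-(f_1,f_2)=\{\overline{f_{a,b,c}}:a>0,b,c\in\mathbb{R}\}\cup\{\overline{l_{s,t}}:s<0\}$; $\mathcal{C}^+(f_1,f_2)=\varphi(\mathcal{C}^-(f_1,f_2))$ with $\varphi(x,y)=(-x,y)$, $-\infty=\infty$. The plane $\mathcal{M}(f_1,f_2;f_3,f_4)$ has point set $\mathcal{P}$ and circle set $\mathcal{C}^-(f_1,f_2)\cup\mathcal{C}^+(f_3,f_4)$ (it is a flat Minkowski plane). An automorphism is a bijection of $\mathcal{P}$ mapping circles onto circles and inducing a bijection of the circle set; the automorphism group is a Lie group (compact-open topology), and its dimension is meant. *)

theory Defs
  imports "HOL-Analysis.Analysis"
begin

definition strictly_convex_on :: "real set \<Rightarrow> (real \<Rightarrow> real) \<Rightarrow> bool" where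
  "strictly_convex_on S f \<longleftrightarrow>
     (\<forall>x\<in>S. \<forall>y\<in>S. \<forall>t. x \<noteq> y \<and> 0 < t \<and> t < 1 \<longrightarrow>
        f (t * x + (1 - t) * y) < t * f x + (1 - t) * f y)"

text \<open>A function R+ -> R+ is represented by a function real => real whose values
  outside (0,inf) are irrelevant.\<close>
definition strongly_hyperbolic :: "(real \<Rightarrow> real) \<Rightarrow> bool" where
  "strongly_hyperbolic f \<longleftrightarrow>
     (\<forall>x>0. f x > 0) \<and>
     filterlim f at_top (at_right 0) \<and>
     (f \<longlongrightarrow> 0) at_top \<and>
     strictly_convex_on {0<..} f \<and>
     (\<forall>b::real. ((\<lambda>x. f (x + b) / f x) \<longlongrightarrow> 1) at_top) \<and>
     (\<forall>x>0. f differentiable (at x)) \<and>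
     strictly_convex_on {0<..} (\<lambda>x. ln \<bar>deriv f x\<bar>)"

section \<open>Points: S^1 = R \<union> {\<infinity>} as real option (None = \<infinity>)\<close>

type_synonym s1 = "real option"
type_synonym pt = "s1 \<times> s1"

text \<open>Topology of S^1: pulled back along the stereographic bijection onto the unit circle.\<close>
fun s1_emb :: "s1 \<Rightarrow> real \<times> real" where
  "s1_emb None = (0, 1)"
| "s1_emb (Some x) = (2 * x / (1 + x\<^sup>2), (x\<^sup>2 - 1) / (x\<^sup>2 + 1))"

definition s1_top :: "s1 topology" where
  "s1_top = pullback_topology UNIV s1_emb euclidean"

definition P_top :: "pt topology" where
  "P_top = prod_topology s1_top s1_top"

fun s1_neg :: "s1 \<Rightarrow> s1" where
  "s1_neg None = None"
| "s1_neg (Some x) = Some (- x)"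

definition phi :: "pt \<Rightarrow> pt" where
  "phi p = (s1_neg (fst p), snd p)"

definition f_abc :: "(real \<Rightarrow> real) \<Rightarrow> (real \<Rightarrow> real) \<Rightarrow> real \<Rightarrow> real \<Rightarrow> real \<Rightarrow> real \<Rightarrow> real" where
  "f_abc f1 f2 a b c x = (if x > - b then a * f1 (x + b) + c else - a * f2 (- x - b) + c)"

definition f_abc_circle :: "(real \<Rightarrow> real) \<Rightarrow> (real \<Rightarrow> real) \<Rightarrow> real \<Rightarrow> real \<Rightarrow> real \<Rightarrow> pt set" where
  "f_abc_circle f1 f2 a b c =
     {(Some x, Some (f_abc f1 f2 a b c x)) | x. x \<noteq> - b} \<union> {(Some (- b), None), (None, Some c)}"

definition line_circle :: "real \<Rightarrow> real \<Rightarrow> pt set" where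
  "line_circle s t = {(Some x, Some (s * x + t)) | x. True} \<union> {(None, None)}"

definition C_minus :: "(real \<Rightarrow> real) \<Rightarrow> (real \<Rightarrow> real) \<Rightarrow> pt set set" where
  "C_minus f1 f2 = {f_abc_circle f1 f2 a b c | a b c. a > 0} \<union> {line_circle s t | s t. s < 0}"

definition C_plus :: "(real \<Rightarrow> real) \<Rightarrow> (real \<Rightarrow> real) \<Rightarrow> pt set set" where
  "C_plus f1 f2 = (\<lambda>C. phi ` C) ` C_minus f1 f2"

definition M_circles :: "(real \<Rightarrow> real) \<Rightarrow> (real \<Rightarrow> real) \<Rightarrow> (real \<Rightarrow> real) \<Rightarrow> (real \<Rightarrow> real) \<Rightarrow> pt set set" where
  "M_circles f1 f2 f3 f4 = C_minus f1 f2 \<union> C_plus f3 f4"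

definition automorphisms :: "pt set set \<Rightarrow> (pt \<Rightarrow> pt) set" where
  "automorphisms Circ = {g. bij g \<and> bij_betw (\<lambda>C. g ` C) Circ Circ}"

definition compact_open_top :: "'a topology \<Rightarrow> 'b topology \<Rightarrow> ('a \<Rightarrow> 'b) topology" where
  "compact_open_top X Y =
     topology_generated_by {{f. f ` K \<subseteq> U} | K U. compactin X K \<and> openin Y U}"

definition aut_top :: "pt set set \<Rightarrow> (pt \<Rightarrow> pt) topology" where
  "aut_top Circ = subtopology (compact_open_top P_top P_top) (automorphisms Circ)"

text \<open>Dimension of a (locally Euclidean) topological group: some nonempty open subset is
  homeomorphic to an open subset of R^n. For a Lie group this n is unique
  (invariance of domain) and is its dimension.\<close>
definition has_dimension :: "'a topology \<Rightarrow> nat \<Rightarrow> bool" where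
  "has_dimension T n \<longleftrightarrow>
     (\<exists>U V. openin T U \<and> U \<noteq> {} \<and> openin (Euclidean_space n) V \<and>
        subtopology T U homeomorphic_space subtopology (Euclidean_space n) V)"

end

(*
The circles through (infinity, infinity) are the ordinary lines of nonzero slope, so the derived
plane there is the real affine plane and, R having no proper field automorphism, every automorphism
fixing this point is affine in each coordinate, possibly followed by the exchange of the factors.

If an automorphism moves (infinity, infinity), conjugating a translation by it gives an automorphism
that acts on one coordinate only and still moves infinity.  On the second coordinate, after
normalization, such a map is itself one of the hyperbola branches E; comparing images of lines shows
that the f_i are power functions, and since E o E and E o (x - 1) o E o (x + 1) o E fix infinity they
are affine, which forces f_i = 1/x.  On the first coordinate, let X exchange 0 and infinity.  Then
d_b = X o (x - X(b)) o X o (x + b) o X fixes infinity, hence is affine; its slope is a continuous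
nonconstant function of b, which yields automorphisms (x, y) -> (p x, y) for p arbitrarily close to 1.
These force power functions again, and the previous argument applies.

Hence, outside the classical case, all automorphisms fix (infinity, infinity), and the scalings
(x, y) -> (p x, y) accumulate at the identity only for power functions.  Near the identity the
group therefore consists of pairs of fractional linear maps, of maps (p x + q, r y + s), or of maps
(x + q, r y + s).  Dimensions are unique by invariance of domain, because left translations of the
automorphism group are homeomorphisms.
*)
theory Submission
  imports Defs "HOL-Homology.Invariance_of_Domain"
begin

unbundle no m_inv_syntax

section \<open>Topology of the circle and of automorphism groups\<close>

text \<open>Automorphisms are bare bijections, so algebra has to precede topology. Distinct points
  lie on no common circle exactly when they share a coordinate; hence an automorphism is a pair (a,
  b) of bijections of the circle, up to exchange of the factors, and a pair sends a circle, read as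
  the graph of h, to the graph of b o h o a^-1. Only after a and b are known to be fractional linear
  are automorphisms continuous.

  The two coordinates need different arguments because the maps (x, y) -> (x + b, r y + s) with r >
  0 are automorphisms of every plane, whereas scalings of x need not be. Composing a line y = s x
  with a map of the second coordinate rescales x inside a branch, a genuine condition on the f_i;
  composing it with a map of the first coordinate only rescales the values, which tells nothing. The
  words d_b replace the missing information. Their slope cannot be constant: as b tends to 0 from
  the right, a constant slope would make X take equal values at 1 and 2.\<close>

lemma topspace_s1_top [simp]: "topspace s1_top = UNIV"
  by (simp add: s1_top_def topspace_pullback_topology)

lemma topspace_P_top [simp]: "topspace P_top = UNIV"
  by (simp add: P_top_def)

lemma continuous_map_s1_emb: "continuous_map s1_top euclidean s1_emb"
  unfolding s1_top_def
  using continuous_map_pullback[of euclidean euclidean id UNIV s1_emb] by simp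

lemma continuous_map_into_s1:
  assumes "continuous_map T euclidean (\<lambda>t. s1_emb (f t))"
  shows "continuous_map T s1_top f"
  unfolding s1_top_def
  by (rule continuous_map_pullback') (use assms in \<open>auto simp: o_def\<close>)

text \<open>The point of the circle with homogeneous coordinates \<open>[u : v]\<close>.\<close>

definition hpt :: "real \<Rightarrow> real \<Rightarrow> s1" where
  "hpt u v = (if v = 0 then None else Some (u / v))"

definition mob :: "real \<Rightarrow> real \<Rightarrow> real \<Rightarrow> real \<Rightarrow> s1 \<Rightarrow> s1" where
  "mob a b c d z = (case z of None \<Rightarrow> hpt a c | Some x \<Rightarrow> hpt (a * x + b) (c * x + d))"

lemma s1_emb_hpt:
  assumes "u \<noteq> 0 \<or> v \<noteq> 0"
  shows "s1_emb (hpt u v) = (2 * u * v / (u\<^sup>2 + v\<^sup>2), (u\<^sup>2 - v\<^sup>2) / (u\<^sup>2 + v\<^sup>2))"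
proof (cases "v = 0")
  case True
  with assms show ?thesis by (simp add: hpt_def)
next
  case False
  have p: "u\<^sup>2 + v\<^sup>2 > 0" using False by (simp add: sum_power2_gt_zero_iff)
  have q: "1 + (u/v)\<^sup>2 = (u\<^sup>2 + v\<^sup>2) / v\<^sup>2" "(u/v)\<^sup>2 + 1 = (u\<^sup>2 + v\<^sup>2) / v\<^sup>2" "(u/v)\<^sup>2 - 1 = (u\<^sup>2 - v\<^sup>2) / v\<^sup>2"
    using False by (simp_all add: power_divide field_simps)
  show ?thesis using False p by (simp add: hpt_def q) (simp add: power2_eq_square)
qed

lemma mob_hpt:
  assumes "u \<noteq> 0 \<or> v \<noteq> 0" "a * d - b * c \<noteq> 0"
  shows "mob a b c d (hpt u v) = hpt (a * u + b * v) (c * u + d * v)"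
    and "a * u + b * v \<noteq> 0 \<or> c * u + d * v \<noteq> 0"
proof -
  have "(a * d - b * c) * u = d * (a * u + b * v) - b * (c * u + d * v)"
       "(a * d - b * c) * v = a * (c * u + d * v) - c * (a * u + b * v)" by (simp_all add: algebra_simps)
  then show "a * u + b * v \<noteq> 0 \<or> c * u + d * v \<noteq> 0"
    using assms by (metis diff_zero mult_eq_0_iff)
  show "mob a b c d (hpt u v) = hpt (a * u + b * v) (c * u + d * v)"
  proof (cases "v = 0")
    case True
    with assms show ?thesis by (simp add: mob_def hpt_def)
  next
    case False
    have "a * (u / v) + b = (a * u + b * v) / v" "c * (u / v) + d = (c * u + d * v) / v"
      using False by (simp_all add: field_simps)
    with False show ?thesis by (simp add: mob_def hpt_def)
  qed
qed

lemma hpt_cases: obtains u v where "z = hpt u v" "u \<noteq> 0 \<or> v \<noteq> 0"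
proof (cases z)
  case None then show ?thesis using that[of 1 0] by (simp add: hpt_def)
next
  case (Some x) then show ?thesis using that[of x 1] by (simp add: hpt_def)
qed

text \<open>The stereographic image of \<open>[u : v]\<close> is \<open>(2uv, u\<^sup>2 - v\<^sup>2) / (u\<^sup>2 + v\<^sup>2)\<close>, so that quadratic forms in
  \<open>u, v\<close> are affine in it. A fractional linear map thus becomes a rational map with the following
  denominator, jointly continuous in the coefficients and the point.\<close>

definition mob_den :: "real \<Rightarrow> real \<Rightarrow> real \<Rightarrow> real \<Rightarrow> real \<times> real \<Rightarrow> real" where
  "mob_den a b c d w = (a\<^sup>2 + c\<^sup>2) * (1 + snd w) / 2 + (a * b + c * d) * fst w + (b\<^sup>2 + d\<^sup>2) * (1 - snd w) / 2"

text \<open>If [U : V] is the image of [u : v], the denominator equals (U^2 + V^2) / (u^2 + v^2),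
  which is nonzero because the matrix is invertible; the two numerators are 2UV and U^2 - V^2 over
  the same u^2 + v^2.\<close>

lemma s1_emb_mob:
  assumes "a * d - b * c \<noteq> 0"
  shows "mob_den a b c d (s1_emb z) \<noteq> 0"
    and "s1_emb (mob a b c d z) =
     ((a * c * (1 + snd (s1_emb z)) + (a * d + b * c) * fst (s1_emb z) + b * d * (1 - snd (s1_emb z))) / mob_den a b c d (s1_emb z),
      ((a\<^sup>2 - c\<^sup>2) * (1 + snd (s1_emb z))/2 + (a * b - c * d) * fst (s1_emb z) + (b\<^sup>2 - d\<^sup>2) * (1 - snd (s1_emb z))/2) / mob_den a b c d (s1_emb z))"
proof -
  obtain u v where z: "z = hpt u v" and uv: "u \<noteq> 0 \<or> v \<noteq> 0" by (rule hpt_cases)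
  define n where "n = u\<^sup>2 + v\<^sup>2"
  have n: "n > 0" using uv by (simp add: n_def sum_power2_gt_zero_iff)
  define U V where "U = a * u + b * v" and "V = c * u + d * v"
  have UV: "U \<noteq> 0 \<or> V \<noteq> 0" using mob_hpt(2)[OF uv assms] by (simp add: U_def V_def)
  have N: "U\<^sup>2 + V\<^sup>2 > 0" using UV by (simp add: sum_power2_gt_zero_iff)
  have e: "s1_emb z = (2 * u * v / n, (u\<^sup>2 - v\<^sup>2) / n)" using s1_emb_hpt[OF uv] z n_def by simp
  have p: "1 + (u\<^sup>2 - v\<^sup>2) / n = 2 * u\<^sup>2 / n" "1 - (u\<^sup>2 - v\<^sup>2) / n = 2 * v\<^sup>2 / n"
    using n by (simp_all add: divide_simps) (simp_all add: n_def)
  have d: "mob_den a b c d (s1_emb z) = (U\<^sup>2 + V\<^sup>2) / n"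
  proof -
    have "U\<^sup>2 + V\<^sup>2 = (a\<^sup>2 + c\<^sup>2) * u\<^sup>2 + (a * b + c * d) * (2 * u * v) + (b\<^sup>2 + d\<^sup>2) * v\<^sup>2"
      unfolding U_def V_def by (simp add: power2_eq_square algebra_simps)
    then show ?thesis unfolding mob_den_def e fst_conv snd_conv p by (simp add: add_divide_distrib)
  qed
  show "mob_den a b c d (s1_emb z) \<noteq> 0" using N n unfolding d by (metis divide_eq_0_iff less_irrefl)
  have nn: "X / n / (Y / n) = X / Y" for X Y :: real using n by simp
  have m: "s1_emb (mob a b c d z) = (2 * U * V / (U\<^sup>2 + V\<^sup>2), (U\<^sup>2 - V\<^sup>2) / (U\<^sup>2 + V\<^sup>2))"
    using mob_hpt(1)[OF uv assms] s1_emb_hpt[OF UV] by (simp add: z U_def V_def)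
  have x: "a * c * (2 * u\<^sup>2 / n) + (a * d + b * c) * (2 * u * v / n) + b * d * (2 * v\<^sup>2 / n) = 2 * U * V / n"
  proof -
    have "2 * U * V = a * c * (2 * u\<^sup>2) + (a * d + b * c) * (2 * u * v) + b * d * (2 * v\<^sup>2)"
      unfolding U_def V_def by (simp add: power2_eq_square algebra_simps)
    then show ?thesis by (simp only: times_divide_eq_right times_divide_eq_left add_divide_distrib[symmetric])
  qed
  have y: "(a\<^sup>2 - c\<^sup>2) * (2 * u\<^sup>2 / n)/2 + (a * b - c * d) * (2 * u * v / n) + (b\<^sup>2 - d\<^sup>2) * (2 * v\<^sup>2 / n)/2 = (U\<^sup>2 - V\<^sup>2) / n"
  proof -
    have "U\<^sup>2 - V\<^sup>2 = (a\<^sup>2 - c\<^sup>2) * u\<^sup>2 + (a * b - c * d) * (2 * u * v) + (b\<^sup>2 - d\<^sup>2) * v\<^sup>2"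
      unfolding U_def V_def by (simp add: power2_eq_square algebra_simps)
    then show ?thesis by (simp add: add_divide_distrib)
  qed
  show "s1_emb (mob a b c d z) =
     ((a * c * (1 + snd (s1_emb z)) + (a * d + b * c) * fst (s1_emb z) + b * d * (1 - snd (s1_emb z))) / mob_den a b c d (s1_emb z),
      ((a\<^sup>2 - c\<^sup>2) * (1 + snd (s1_emb z))/2 + (a * b - c * d) * fst (s1_emb z) + (b\<^sup>2 - d\<^sup>2) * (1 - snd (s1_emb z))/2) / mob_den a b c d (s1_emb z))"
    unfolding m d unfolding e fst_conv snd_conv p x y by (simp only: nn)
qed

lemma continuous_map_mob:
  assumes "continuous_map T euclideanreal a" "continuous_map T euclideanreal b"
    "continuous_map T euclideanreal c" "continuous_map T euclideanreal d"
    "\<And>t. t \<in> topspace T \<Longrightarrow> a t * d t - b t * c t \<noteq> 0"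
    "continuous_map T s1_top f"
  shows "continuous_map T s1_top (\<lambda>t. mob (a t) (b t) (c t) (d t) (f t))"
proof (rule continuous_map_into_s1)
  have e: "continuous_map T euclidean (\<lambda>t. s1_emb (f t))"
    using continuous_map_compose[OF assms(6) continuous_map_s1_emb] by (simp add: o_def)
  then have e': "continuous_map T (prod_topology euclideanreal euclideanreal) (\<lambda>t. s1_emb (f t))"
    by (simp add: euclidean_product_topology prod_topology_euclidean)
  have X: "continuous_map T euclideanreal (\<lambda>t. fst (s1_emb (f t)))"
    and Y: "continuous_map T euclideanreal (\<lambda>t. snd (s1_emb (f t)))"
    using e' unfolding continuous_map_pairwise by (simp_all add: o_def)
  let ?g = "\<lambda>t. ((a t * c t * (1 + snd (s1_emb (f t))) + (a t * d t + b t * c t) * fst (s1_emb (f t)) + b t * d t * (1 - snd (s1_emb (f t)))) / mob_den (a t) (b t) (c t) (d t) (s1_emb (f t)),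
      (((a t)\<^sup>2 - (c t)\<^sup>2) * (1 + snd (s1_emb (f t)))/2 + (a t * b t - c t * d t) * fst (s1_emb (f t)) + ((b t)\<^sup>2 - (d t)\<^sup>2) * (1 - snd (s1_emb (f t)))/2) / mob_den (a t) (b t) (c t) (d t) (s1_emb (f t)))"
  have D: "continuous_map T euclideanreal (\<lambda>t. mob_den (a t) (b t) (c t) (d t) (s1_emb (f t)))"
    unfolding mob_den_def
    by (intro continuous_map_real_divide assms(1-4) continuous_map_add continuous_map_diff
        continuous_map_real_mult continuous_map_real_pow X Y; simp)
  have "continuous_map T (prod_topology euclideanreal euclideanreal) ?g"
    unfolding continuous_map_pairwise o_def fst_conv snd_conv
    
    by (intro conjI continuous_map_real_divide D s1_emb_mob(1) assms continuous_map_add continuous_map_diff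
        continuous_map_real_mult continuous_map_real_pow X Y; simp)
  then have "continuous_map T euclidean ?g" by (simp add: prod_topology_euclidean)
  then show "continuous_map T euclidean (\<lambda>t. s1_emb (mob (a t) (b t) (c t) (d t) (f t)))"
    by (rule continuous_map_eq) (use s1_emb_mob(2) assms(5) in auto)
qed

section \<open>The compact-open topology\<close>

lemma topspace_compact_open [simp]: "topspace (compact_open_top X Y) = UNIV"
proof -
  have "UNIV \<in> {{f. f ` K \<subseteq> U} | K U. compactin X K \<and> openin Y U}"
    by (rule CollectI, rule exI[of _ "{}"], rule exI[of _ "{}"]) auto
  then show ?thesis unfolding compact_open_top_def topology_generated_by_topspace by blast
qed

text \<open>Currying: by the tube lemma, compactness of K yields a neighbourhood A of t such that F
  s maps K into U for every s in A. This is how parametrized families become continuous maps into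
  the automorphism group.\<close>

lemma continuous_map_compact_open:
  assumes "continuous_map (prod_topology T X) Y (\<lambda>(t, x). F t x)"
  shows "continuous_map T (compact_open_top X Y) F"
  unfolding compact_open_top_def
proof (rule continuous_on_generated_topo)
  fix W assume "W \<in> {{f. f ` K \<subseteq> U} | K U. compactin X K \<and> openin Y U}"
  then obtain K U where W: "W = {f. f ` K \<subseteq> U}" and K: "compactin X K" and U: "openin Y U" by blast
  define O' where "O' = {z \<in> topspace (prod_topology T X). (\<lambda>(t, x). F t x) z \<in> U}"
  have O: "openin (prod_topology T X) O'"
    unfolding O'_def by (rule openin_continuous_map_preimage[OF assms U])
  have KX: "K \<subseteq> topspace X" using K by (rule compactin_subset_topspace)
  show "openin T (F -` W \<inter> topspace T)"
  proof (subst openin_subopen, clarify)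
    fix t assume t: "F t \<in> W" "t \<in> topspace T"
    have "{t} \<times> K \<subseteq> O'" using t KX unfolding W O'_def by auto
    then obtain A B where AB: "openin T A" "openin X B" "t \<in> A" "K \<subseteq> B" "A \<times> B \<subseteq> O'"
      using tube_lemma_right[OF O K t(2)] by blast
    have "A \<subseteq> F -` W \<inter> topspace T"
    proof
      fix s assume s: "s \<in> A"
      have "F s k \<in> U" if "k \<in> K" for k
      proof -
        have "(s, k) \<in> O'" using AB(4,5) s that by blast
        then show ?thesis by (simp add: O'_def)
      qed
      then show "s \<in> F -` W \<inter> topspace T" using s openin_subset[OF AB(1)] unfolding W by auto
    qed
    with AB show "\<exists>A. openin T A \<and> t \<in> A \<and> A \<subseteq> F -` W \<inter> topspace T" by blast
  qed
next
  show "F ` topspace T \<subseteq> \<Union> {{f. f ` K \<subseteq> U} | K U. compactin X K \<and> openin Y U}"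
    using topspace_compact_open[of X Y] unfolding compact_open_top_def topology_generated_by_topspace
    by (metis top_greatest)
qed

text \<open>Singletons are compact, so requiring f x to lie in an open set is a subbasic condition
  on f.\<close>

lemma continuous_map_eval:
  assumes "x \<in> topspace X" "topspace Y = UNIV"
  shows "continuous_map (compact_open_top X Y) Y (\<lambda>f. f x)"
unfolding continuous_map_def
proof -
  have "openin (compact_open_top X Y) {f. f x \<in> U}" if "openin Y U" for U
    unfolding compact_open_top_def
    by (rule topology_generated_by_Basis, rule CollectI, rule exI[of _ "{x}"], rule exI[of _ U])
       (use that assms in auto)
  then show "(\<lambda>f. f x) \<in> topspace (compact_open_top X Y) \<rightarrow> topspace Y \<and>
    (\<forall>U. openin Y U \<longrightarrow> openin (compact_open_top X Y) {f \<in> topspace (compact_open_top X Y). f x \<in> U})"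
    by (simp add: assms)
qed

lemma continuous_map_comp_left:
  assumes "continuous_map Y Z h" "topspace Y = UNIV"
  shows "continuous_map (compact_open_top X Y) (compact_open_top X Z) (\<lambda>f. h \<circ> f)"
proof -
  have "openin (compact_open_top X Y) ((\<lambda>f. h \<circ> f) -` W)"
    if W: "W \<in> {{f. f ` K \<subseteq> U} | K U. compactin X K \<and> openin Z U}" for W
  proof -
    obtain K U where KU: "W = {f. f ` K \<subseteq> U}" "compactin X K" "openin Z U" using W by blast
    have "openin Y {y \<in> topspace Y. h y \<in> U}" by (rule openin_continuous_map_preimage[OF assms(1) KU(3)])
    then have o: "openin Y (h -` U)" using assms(2) by (simp add: vimage_def)
    have "(\<lambda>f. h \<circ> f) -` W = {f. f ` K \<subseteq> h -` U}" unfolding KU(1) by auto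
    then show ?thesis unfolding compact_open_top_def
      by (intro topology_generated_by_Basis CollectI exI conjI) (use o KU(2) in auto)
  qed
  then show ?thesis
    using continuous_on_generated_topo[of "{{f. f ` K \<subseteq> U} | K U. compactin X K \<and> openin Z U}" "compact_open_top X Y" "\<lambda>f. h \<circ> f"]
      topspace_compact_open[of X Z]
    unfolding compact_open_top_def[of X Z] topology_generated_by_topspace
    by auto
qed

section \<open>Invariance of dimension\<close>

text \<open>If n < m, the smaller space sits inside the larger one as a coordinate subspace.
  Invariance of domain would make the image of V open in the larger space, yet an open set cannot
  stay inside the subspace.\<close>

lemma homeomorphic_open_Euclidean_le:
  assumes "openin (Euclidean_space m) V" "V \<noteq> {}" "openin (Euclidean_space n) W"
    and "subtopology (Euclidean_space m) V homeomorphic_space subtopology (Euclidean_space n) W"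
  shows "m \<le> n"
proof (rule ccontr)
  assume "\<not> m \<le> n"
  then have nm: "n < m" by simp
  obtain f g where fg: "homeomorphic_maps (subtopology (Euclidean_space m) V) (subtopology (Euclidean_space n) W) f g"
    using assms(4) unfolding homeomorphic_space_def by blast
  have VT: "topspace (subtopology (Euclidean_space m) V) = V"
    using openin_subset[OF assms(1)] by auto
  have cf: "continuous_map (subtopology (Euclidean_space m) V) (Euclidean_space n) f"
    using fg unfolding homeomorphic_maps_def continuous_map_in_subtopology by blast
  have inj: "inj_on f V"
    using fg unfolding homeomorphic_maps_def VT by (metis inj_on_inverseI)
  have fV: "f ` V \<subseteq> topspace (Euclidean_space n)"
    using continuous_map_image_subset_topspace[OF cf] VT by auto
  have "Euclidean_space n = subtopology (Euclidean_space m) (topspace (Euclidean_space n))"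
    using nm by (metis Euclidean_space_def inf.absorb_iff2 subset_Euclidean_space subtopology_subtopology
        topspace_Euclidean_space less_imp_le)
  then have "continuous_map (subtopology (Euclidean_space m) V) (Euclidean_space m) f"
    using cf by (metis continuous_map_in_subtopology)
  then have op: "openin (Euclidean_space m) (f ` V)"
    by (rule invariance_of_domain_Euclidean_space[OF assms(1) _ inj])
  obtain x where x: "x \<in> f ` V" using assms(2) by blast
  \<comment> \<open>\<open>h\<close> moves x along the axis with index n, the lowest coordinate that
    vanishes on the whole smaller space.\<close>
  define h where "h = (\<lambda>(t::real) i. if i < m then x i + (if i = n then t else 0) else 0)"
  have ch: "continuous_map euclideanreal (Euclidean_space m) h"
    unfolding h_def
  proof (subst continuous_map_componentwise_Euclidean_space, intro allI impI)
    fix i show "continuous_map euclideanreal euclideanreal (\<lambda>t. x i + (if i = n then t else 0))"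
      by (cases "i = n") (auto intro!: continuous_intros)
  qed
  have x0: "x i = 0" if "i \<ge> n" for i using x fV that by (auto simp: topspace_Euclidean_space)
  then have h0: "h 0 = x" unfolding h_def using nm by force
  have "open {t. h t \<in> f ` V}"
    using openin_continuous_map_preimage[OF ch op] by simp
  then obtain e where e: "e > 0" "\<And>t. \<bar>t\<bar> < e \<Longrightarrow> h t \<in> f ` V"
    using x h0 unfolding open_dist dist_real_def by (metis diff_zero mem_Collect_eq)
  have "h (e/2) \<in> topspace (Euclidean_space n)" using e(1) e(2)[of "e/2"] fV by auto
  then have "h (e/2) n = 0" by (simp add: topspace_Euclidean_space)
  then show False using e(1) nm x0[of n] by (simp add: h_def)
qed

text \<open>Two charts may live around different points; homogeneity carries one point to the other,
  after which both charts are restricted to a common piece.\<close>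

lemma has_dimension_unique:
  assumes hom: "\<And>x y. x \<in> topspace T \<Longrightarrow> y \<in> topspace T \<Longrightarrow> \<exists>p q. homeomorphic_maps T T p q \<and> p x = y"
    and "has_dimension T m" "has_dimension T n"
  shows "m = n"
proof -
  have le: "m \<le> n" if m: "has_dimension T m" and n: "has_dimension T n" for m n
  proof -
    obtain U V where U: "openin T U" "U \<noteq> {}" "openin (Euclidean_space m) V"
      "subtopology T U homeomorphic_space subtopology (Euclidean_space m) V"
      using m unfolding has_dimension_def by blast
    obtain U' V' where U': "openin T U'" "U' \<noteq> {}" "openin (Euclidean_space n) V'"
      "subtopology T U' homeomorphic_space subtopology (Euclidean_space n) V'"
      using n unfolding has_dimension_def by blast
    have sub: "\<exists>V1. openin (Euclidean_space k) V1 \<and> V1 \<noteq> {} \<and> subtopology T W homeomorphic_space subtopology (Euclidean_space k) V1"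
      if that0: "openin T W" "W \<subseteq> U1" "W \<noteq> {}" "openin T U1" "openin (Euclidean_space k) V1"
        "subtopology T U1 homeomorphic_space subtopology (Euclidean_space k) V1" for W U1 V1 k
    proof -
      obtain f where f: "homeomorphic_map (subtopology T U1) (subtopology (Euclidean_space k) V1) f"
        using that0(6) unfolding homeomorphic_space by blast
      have W: "openin (subtopology T U1) W" using that0 by (simp add: openin_open_subtopology)
      then have "openin (subtopology (Euclidean_space k) V1) (f ` W)"
        using homeomorphic_imp_open_map[OF f] unfolding open_map_def by blast
      then have o: "openin (Euclidean_space k) (f ` W)" "f ` W \<subseteq> V1"
        using that0(5) by (simp_all add: openin_open_subtopology)
      have "homeomorphic_map (subtopology (subtopology T U1) W) (subtopology (subtopology (Euclidean_space k) V1) (f ` W)) f"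
        by (rule homeomorphic_map_subtopologies[OF f])
          (use openin_subset[OF W] openin_subset[OF o(1)] o(2) in auto)
      moreover have "subtopology (subtopology T U1) W = subtopology T W"
        "subtopology (subtopology (Euclidean_space k) V1) (f ` W) = subtopology (Euclidean_space k) (f ` W)"
        using that0(2) o(2) by (simp_all add: subtopology_subtopology inf.absorb2)
      ultimately show ?thesis
        using o(1) that0(3) homeomorphic_map_imp_homeomorphic_space by fastforce
    qed
    obtain x y where xy: "x \<in> U" "y \<in> U'" using U U' by blast
    then have "x \<in> topspace T" "y \<in> topspace T" using openin_subset U(1) U'(1) by blast+
    then obtain p q where pq: "homeomorphic_maps T T p q" "p x = y" using hom by blast
    have pm: "homeomorphic_map T T p" using pq(1) homeomorphic_map_maps by blast
    \<comment> \<open>\<open>W\<close> is the part of the first chart domain that p carries into the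
      second one; it contains x.\<close>
    define W where "W = U \<inter> {z \<in> topspace T. p z \<in> U'}"
    have W: "openin T W" unfolding W_def
      using homeomorphic_imp_continuous_map[OF pm] U(1) U'(1)
      by (intro openin_Int openin_continuous_map_preimage) auto
    have pW: "openin T (p ` W)" using homeomorphic_imp_open_map[OF pm] W unfolding open_map_def by blast
    have xW: "x \<in> W" using xy pq(2) \<open>x \<in> topspace T\<close> unfolding W_def by simp
    have WU: "W \<subseteq> U" and pWU: "p ` W \<subseteq> U'" unfolding W_def by auto
    have "homeomorphic_map (subtopology T W) (subtopology T (p ` W)) p"
      by (rule homeomorphic_map_subtopologies[OF pm]) (use openin_subset[OF W] openin_subset[OF pW] in auto)
    then have h: "subtopology T W homeomorphic_space subtopology T (p ` W)"
      by (rule homeomorphic_map_imp_homeomorphic_space)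
    obtain V1 where V1: "openin (Euclidean_space m) V1" "V1 \<noteq> {}"
      "subtopology T W homeomorphic_space subtopology (Euclidean_space m) V1"
      using sub[OF W WU _ U(1,3,4)] xW by (metis empty_iff)
    obtain V2 where V2: "openin (Euclidean_space n) V2"
      "subtopology T (p ` W) homeomorphic_space subtopology (Euclidean_space n) V2"
      using sub[OF pW pWU _ U'(1,3,4)] xW by (metis empty_iff imageI)
    have "subtopology (Euclidean_space m) V1 homeomorphic_space subtopology (Euclidean_space n) V2"
      using homeomorphic_space_trans[OF homeomorphic_space_trans[OF _ h] V2(2)] V1(3) homeomorphic_space_sym by metis
    then show ?thesis by (rule homeomorphic_open_Euclidean_le[OF V1(1,2) V2(1)])
  qed
  show ?thesis using le assms(2,3) by (meson order.antisym)
qed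

text \<open>A chart in the form used below: \<open>par\<close> parametrizes U, and \<open>rd\<close>
  reads off the n coordinates. Coordinates from n on are set to 0 because
  \<open>Euclidean_space n\<close> consists of sequences vanishing there.\<close>

lemma has_dimensionI:
  assumes "openin T U" "openin (Euclidean_space n) V" "v0 \<in> V"
    and par: "continuous_map (subtopology (Euclidean_space n) V) T par" "\<And>v. v \<in> V \<Longrightarrow> par v \<in> U"
    and rd: "\<And>i. i < n \<Longrightarrow> continuous_map (subtopology T U) euclideanreal (\<lambda>g. rd g i)"
    and inv: "\<And>v i. v \<in> V \<Longrightarrow> i < n \<Longrightarrow> rd (par v) i = v i"
      "\<And>g. g \<in> U \<Longrightarrow> (\<lambda>i. if i < n then rd g i else 0) \<in> V \<and> par (\<lambda>i. if i < n then rd g i else 0) = g"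
  shows "has_dimension T n"
proof -
  let ?r = "\<lambda>g i. if i < n then rd g i else 0"
  have V: "v i = 0" if "v \<in> V" "i \<ge> n" for v i
    using openin_subset[OF assms(2)] that by (auto simp: topspace_Euclidean_space)
  have rp: "?r (par v) = v" if "v \<in> V" for v
    using inv(1)[OF that] V[OF that] by force
  have c: "continuous_map (subtopology T U) (Euclidean_space n) ?r"
    by (subst continuous_map_componentwise_Euclidean_space) (use rd in auto)
  have "homeomorphic_maps (subtopology T U) (subtopology (Euclidean_space n) V) ?r par"
    unfolding homeomorphic_maps_def continuous_map_in_subtopology
    using c par inv(2) rp by auto
  then have "subtopology T U homeomorphic_space subtopology (Euclidean_space n) V"
    unfolding homeomorphic_space_def by blast
  moreover have "U \<noteq> {}" using assms(3) par(2) by blast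
  ultimately show ?thesis using assms(1,2) unfolding has_dimension_def by blast
qed

lemma openin_Some_interval: "openin s1_top (Some ` {l<..<r})"
proof -
  \<comment> \<open>Stereographic projection recovers x as \<open>fst w / (1 - snd w)\<close>; the
    bounds are multiplied out so that \<open>?W\<close> is visibly open, and
    \<open>snd w < 1\<close> removes the point at infinity.\<close>
  let ?W = "{w::real \<times> real. snd w < 1 \<and> l * (1 - snd w) < fst w \<and> fst w < r * (1 - snd w)}"
  have "open ?W"
    by (intro open_Collect_conj open_Collect_less continuous_intros)
  moreover have "Some ` {l<..<r} = s1_emb -` ?W \<inter> UNIV"
  proof -
    have "z \<in> Some ` {l<..<r} \<longleftrightarrow> s1_emb z \<in> ?W" for z
    proof (cases z)
      case None then show ?thesis by auto
    next
      case (Some x)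
      have p: "x\<^sup>2 + 1 > 0" "1 + x\<^sup>2 > 0" by (simp_all add: add_pos_nonneg add_nonneg_pos)
      have "1 - (x\<^sup>2 - 1) / (x\<^sup>2 + 1) = 2 / (1 + x\<^sup>2)" using p by (simp add: divide_simps)
      moreover have "(x\<^sup>2 - 1) / (x\<^sup>2 + 1) < 1" using p by (simp add: divide_simps)
      ultimately have "s1_emb z \<in> ?W \<longleftrightarrow> l * (2 / (1 + x\<^sup>2)) < 2 * x / (1 + x\<^sup>2) \<and> 2 * x / (1 + x\<^sup>2) < r * (2 / (1 + x\<^sup>2))"
        using Some by simp
      also have "\<dots> \<longleftrightarrow> l < x \<and> x < r" using p(2) by (simp add: divide_less_cancel)
      finally show ?thesis using Some by auto
    qed
    then show ?thesis by blast
  qed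
  ultimately show ?thesis unfolding s1_top_def openin_pullback_topology
    by (intro exI[of _ ?W]) simp
qed

lemma continuous_map_the: "continuous_map (subtopology s1_top (range Some)) euclideanreal the"
proof -
  have "continuous_map (subtopology s1_top (range Some)) (prod_topology euclideanreal euclideanreal) s1_emb"
    using continuous_map_s1_emb by (simp add: continuous_map_from_subtopology prod_topology_euclidean)
  then have X: "continuous_map (subtopology s1_top (range Some)) euclideanreal (\<lambda>t. fst (s1_emb t))"
    and Y: "continuous_map (subtopology s1_top (range Some)) euclideanreal (\<lambda>t. snd (s1_emb t))"
    unfolding continuous_map_pairwise by (simp_all add: o_def)
  have e: "1 - (x\<^sup>2 - 1) / (x\<^sup>2 + 1) = 2 / (1 + x\<^sup>2)" for x :: real
  proof -
    have "x\<^sup>2 + 1 > 0" by (simp add: add_nonneg_pos)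
    then show ?thesis by (simp add: divide_simps)
  qed
  have ne: "1 + x\<^sup>2 \<noteq> 0" for x :: real
    using zero_le_power2[of x] by linarith
  have "continuous_map (subtopology s1_top (range Some)) euclideanreal (\<lambda>t. fst (s1_emb t) / (1 - snd (s1_emb t)))"
    by (intro continuous_map_real_divide continuous_map_diff X Y) (auto simp: e ne)
  then show ?thesis
    by (rule continuous_map_eq) (auto simp: e ne)
qed

section \<open>Automorphisms as a topological space with continuous left translations\<close>

lemma automorphisms_comp:
  assumes "g \<in> automorphisms C" "h \<in> automorphisms C"
  shows "g \<circ> h \<in> automorphisms C"
proof -
  have "bij_betw ((\<lambda>X. g ` X) \<circ> (\<lambda>X. h ` X)) C C"
    using assms unfolding automorphisms_def by (auto intro: bij_betw_trans)
  then show ?thesis using assms unfolding automorphisms_def by (auto simp: o_def image_image intro: bij_comp[unfolded o_def])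
qed

lemma automorphisms_inv:
  assumes "g \<in> automorphisms C"
  shows "inv g \<in> automorphisms C"
proof -
  have g: "bij g" "bij_betw (\<lambda>X. g ` X) C C" using assms unfolding automorphisms_def by auto
  have "bij_betw (\<lambda>X. inv g ` X) C C"
  proof (rule bij_betw_byWitness[where f' = "\<lambda>X. g ` X"])
    show "\<forall>a\<in>C. g ` inv g ` a = a" "\<forall>a'\<in>C. inv g ` g ` a' = a'"
      using g(1) by (simp_all add: image_comp bij_is_inj bij_is_surj surj_iff[THEN iffD1] inj_iff[THEN iffD1])
    show "(\<lambda>X. inv g ` X) ` C \<subseteq> C"
    proof clarify
      fix X assume "X \<in> C"
      then obtain Y where Y: "Y \<in> C" "X = g ` Y" using g(2) unfolding bij_betw_def by blast
      then show "inv g ` X \<in> C" using g(1) by (simp add: image_comp bij_is_inj inj_iff[THEN iffD1])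
    qed
    show "(\<lambda>X. g ` X) ` C \<subseteq> C" using g(2) unfolding bij_betw_def by blast
  qed
  then show ?thesis using g(1) bij_imp_bij_inv unfolding automorphisms_def by blast
qed

lemma automorphisms_bij: "g \<in> automorphisms C \<Longrightarrow> bij g"
  by (simp add: automorphisms_def)

lemma topspace_aut_top [simp]: "topspace (aut_top C) = automorphisms C"
  by (simp add: aut_top_def)

text \<open>Left composition with y o x^-1 carries x to y. It is continuous for the compact-open
  topology because the automorphism composed with is itself continuous, which is what the hypothesis
  supplies.\<close>

lemma has_dimension_aut_top_unique:
  assumes "\<And>g. g \<in> automorphisms C \<Longrightarrow> continuous_map P_top P_top g"
    and "has_dimension (aut_top C) m" "has_dimension (aut_top C) n"
  shows "m = n"
proof (rule has_dimension_unique[OF _ assms(2,3)])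
  have c: "continuous_map (aut_top C) (aut_top C) (\<lambda>f. h \<circ> f)" if "h \<in> automorphisms C" for h
    unfolding aut_top_def continuous_map_in_subtopology
    using continuous_map_from_subtopology[OF continuous_map_comp_left[OF assms(1)[OF that], where X = P_top]]
      automorphisms_comp[OF that] by auto
  fix x y assume "x \<in> topspace (aut_top C)" "y \<in> topspace (aut_top C)"
  then have xy: "x \<in> automorphisms C" "y \<in> automorphisms C" by simp_all
  then have b: "bij x" "bij y" by (simp_all add: automorphisms_bij)
  let ?p = "y \<circ> inv x" and ?q = "x \<circ> inv y"
  have pq: "?p \<in> automorphisms C" "?q \<in> automorphisms C"
    using xy by (simp_all add: automorphisms_comp automorphisms_inv)
  have "inv x (x z) = z" "x (inv x z) = z" "inv y (y z) = z" "y (inv y z) = z" for z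
    using b by (simp_all add: bij_is_inj bij_is_surj surj_f_inv_f)
  then have "homeomorphic_maps (aut_top C) (aut_top C) (\<lambda>f. ?p \<circ> f) (\<lambda>f. ?q \<circ> f) \<and> ?p \<circ> x = y"
    unfolding homeomorphic_maps_def using c pq by (auto simp: fun_eq_iff)
  then show "\<exists>p q. homeomorphic_maps (aut_top C) (aut_top C) p q \<and> p x = y" by blast
qed

lemma openin_aut_eval:
  "openin (aut_top C) {g \<in> automorphisms C. g p \<in> Some ` {l<..<r} \<times> Some ` {l'<..<r'}}"
proof -
  have "openin P_top (Some ` {l<..<r} \<times> Some ` {l'<..<r'})"
    unfolding P_top_def by (simp add: openin_prod_Times_iff openin_Some_interval)
  moreover have "continuous_map (aut_top C) P_top (\<lambda>g. g p)"
    unfolding aut_top_def by (rule continuous_map_from_subtopology, rule continuous_map_eval) auto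
  ultimately have "openin (aut_top C) {g \<in> topspace (aut_top C). g p \<in> Some ` {l<..<r} \<times> Some ` {l'<..<r'}}"
    by (rule openin_continuous_map_preimage[rotated])
  then show ?thesis by simp
qed

text \<open>These are the coordinate functions of the later charts. \<open>the\<close> is continuous
  only off infinity, hence the condition that U keeps the image of p finite.\<close>

lemma continuous_map_aut_coord:
  assumes "\<And>g. g \<in> U \<Longrightarrow> g p \<in> range Some \<times> range Some"
  shows "continuous_map (subtopology (aut_top C) U) euclideanreal (\<lambda>g. the (fst (g p)))"
    and "continuous_map (subtopology (aut_top C) U) euclideanreal (\<lambda>g. the (snd (g p)))"
proof -
  let ?T = "subtopology (aut_top C) U"
  have "continuous_map ?T P_top (\<lambda>g. g p)"
    unfolding aut_top_def by (intro continuous_map_from_subtopology continuous_map_eval) auto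
  then have "continuous_map ?T s1_top (\<lambda>g. fst (g p))" "continuous_map ?T s1_top (\<lambda>g. snd (g p))"
    unfolding P_top_def continuous_map_pairwise by (simp_all add: o_def)
  moreover have "fst (g p) \<in> range Some" "snd (g p) \<in> range Some" if "g \<in> U" for g
    using assms[OF that] by (auto simp: mem_Times_iff)
  ultimately have "continuous_map ?T (subtopology s1_top (range Some)) (\<lambda>g. fst (g p))"
    "continuous_map ?T (subtopology s1_top (range Some)) (\<lambda>g. snd (g p))"
    unfolding continuous_map_in_subtopology by auto
  from this[THEN continuous_map_compose, OF continuous_map_the]
  show "continuous_map ?T euclideanreal (\<lambda>g. the (fst (g p)))"
    "continuous_map ?T euclideanreal (\<lambda>g. the (snd (g p)))" by (simp_all add: o_def)
qed

text \<open>Joint continuity in coefficients and point, followed by currying; all three chart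
  parametrizations have this shape.\<close>

lemma continuous_map_mob_pair:
  assumes "continuous_map T euclideanreal a" "continuous_map T euclideanreal b"
    "continuous_map T euclideanreal c" "continuous_map T euclideanreal d"
    "\<And>t. t \<in> topspace T \<Longrightarrow> a t * d t - b t * c t \<noteq> 0"
    "continuous_map T euclideanreal a'" "continuous_map T euclideanreal b'"
    "continuous_map T euclideanreal c'" "continuous_map T euclideanreal d'"
    "\<And>t. t \<in> topspace T \<Longrightarrow> a' t * d' t - b' t * c' t \<noteq> 0"
    "\<And>t. t \<in> topspace T \<Longrightarrow> map_prod (mob (a t) (b t) (c t) (d t)) (mob (a' t) (b' t) (c' t) (d' t)) \<in> automorphisms C"
  shows "continuous_map T (aut_top C)
     (\<lambda>t. map_prod (mob (a t) (b t) (c t) (d t)) (mob (a' t) (b' t) (c' t) (d' t)))"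
proof -
  let ?X = "prod_topology T P_top"
  have f: "continuous_map ?X euclideanreal (\<lambda>z. h (fst z))" if "continuous_map T euclideanreal h" for h
    using continuous_map_compose[OF continuous_map_fst that] by (simp add: o_def)
  have s: "continuous_map ?X (prod_topology s1_top s1_top) snd"
    unfolding P_top_def by (rule continuous_map_snd)
  then have s': "continuous_map ?X s1_top (\<lambda>z. fst (snd z))" "continuous_map ?X s1_top (\<lambda>z. snd (snd z))"
    using continuous_map_compose[OF s continuous_map_fst] continuous_map_compose[OF s continuous_map_snd]
    by (simp_all add: o_def)
  have "continuous_map ?X P_top (\<lambda>z. (mob (a (fst z)) (b (fst z)) (c (fst z)) (d (fst z)) (fst (snd z)),
      mob (a' (fst z)) (b' (fst z)) (c' (fst z)) (d' (fst z)) (snd (snd z))))"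
    unfolding P_top_def continuous_map_pairwise o_def fst_conv snd_conv
    by (intro conjI continuous_map_mob)
      (use assms(5,10) in \<open>auto intro!: f[unfolded P_top_def] assms(1-4,6-9) s'[unfolded P_top_def]\<close>)
  then have "continuous_map ?X P_top (\<lambda>(t, x). map_prod (mob (a t) (b t) (c t) (d t)) (mob (a' t) (b' t) (c' t) (d' t)) x)"
    by (rule continuous_map_eq) auto
  then have "continuous_map T (compact_open_top P_top P_top)
    (\<lambda>t. map_prod (mob (a t) (b t) (c t) (d t)) (mob (a' t) (b' t) (c' t) (d' t)))"
    by (rule continuous_map_compact_open)
  then show ?thesis unfolding aut_top_def continuous_map_in_subtopology using assms(11) by auto
qed

lemma continuous_map_mob_prod:
  assumes "a * d - b * c \<noteq> 0" "a' * d' - b' * c' \<noteq> 0"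
  shows "continuous_map P_top P_top (map_prod (mob a b c d) (mob a' b' c' d'))"
    and "continuous_map P_top P_top (map_prod (mob a b c d) (mob a' b' c' d') \<circ> prod.swap)"
proof -
  have s: "continuous_map P_top s1_top fst" "continuous_map P_top s1_top snd"
    unfolding P_top_def by (rule continuous_map_fst continuous_map_snd)+
  have k: "continuous_map P_top s1_top (\<lambda>z. mob a b c d (f z))" "continuous_map P_top s1_top (\<lambda>z. mob a' b' c' d' (f z))"
    if "continuous_map P_top s1_top f" for f
    using that assms by (auto intro!: continuous_map_mob)
  have "map_prod (mob a b c d) (mob a' b' c' d') = (\<lambda>z. (mob a b c d (fst z), mob a' b' c' d' (snd z)))"
    "map_prod (mob a b c d) (mob a' b' c' d') \<circ> prod.swap = (\<lambda>z. (mob a b c d (snd z), mob a' b' c' d' (fst z)))"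
    by auto
  then show "continuous_map P_top P_top (map_prod (mob a b c d) (mob a' b' c' d'))"
    "continuous_map P_top P_top (map_prod (mob a b c d) (mob a' b' c' d') \<circ> prod.swap)"
    using k(1)[OF s(1)] k(2)[OF s(2)] k(1)[OF s(2)] k(2)[OF s(1)]
    unfolding P_top_def by (simp_all add: continuous_map_pairwise o_def)
qed

section \<open>Bijections preserving parallelism or lines\<close>

definition par :: "'a \<times> 'a \<Rightarrow> 'a \<times> 'a \<Rightarrow> bool" where
  "par p q \<longleftrightarrow> fst p = fst q \<or> snd p = snd q"

text \<open>Points of one column are pairwise parallel, so each column lands in a single row or a
  single column. The content is that all columns make the same choice.\<close>

lemma par_preserving_columns:
  fixes g :: "'a \<times> 'a \<Rightarrow> 'a \<times> 'a"
  assumes "inj g" and par: "\<And>p q. par (g p) (g q) \<longleftrightarrow> par p q" and two: "\<exists>x y::'a. x \<noteq> y"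
  shows "(\<forall>x y y'. fst (g (x, y)) = fst (g (x, y'))) \<or> (\<forall>x y y'. snd (g (x, y)) = snd (g (x, y')))"
proof -
  have ne: "g (x, y) \<noteq> g (x', y')" if "(x, y) \<noteq> (x', y')" for x y x' y'
    using assms(1) that by (meson injD)
  have col: "(\<forall>y y'. fst (g (x, y)) = fst (g (x, y'))) \<or> (\<forall>y y'. snd (g (x, y)) = snd (g (x, y')))" for x
  proof -
    obtain y0 y1 :: 'a where y: "y0 \<noteq> y1" using two by blast
    have p: "par (g (x, y)) (g (x, y'))" for y y' unfolding par by (simp add: par_def)
    \<comment> \<open>The two images differ, so they share exactly one coordinate; a third image
      parallel to both must share that same one, since it cannot agree with two distinct values in
      the other.\<close>
    have d: "fst (g (x, y0)) \<noteq> fst (g (x, y1)) \<or> snd (g (x, y0)) \<noteq> snd (g (x, y1))"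
      using ne[of x y0 x y1] y by (simp add: prod_eq_iff)
    have "fst (g (x, y)) = fst (g (x, y0))" if "fst (g (x, y0)) = fst (g (x, y1))" for y
      using p[of y y0] p[of y y1] d that unfolding par_def by metis
    moreover have "snd (g (x, y)) = snd (g (x, y0))" if "snd (g (x, y0)) = snd (g (x, y1))" for y
      using p[of y y0] p[of y y1] d that unfolding par_def by metis
    ultimately show ?thesis using p[of y0 y1] unfolding par_def by metis
  qed
  \<comment> \<open>Suppose column x goes into a column and column x' into a row. The two diagonal
    pairs are not parallel, which excludes both ways in which the images of (x, y0) and (x', y0)
    could be parallel.\<close>
  have mixed: False if "\<And>y y'. fst (g (x, y)) = fst (g (x, y'))" "\<And>y y'. snd (g (x', y)) = snd (g (x', y'))"
    "x \<noteq> x'" for x x'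
  proof -
    obtain y0 y1 :: 'a where y: "y0 \<noteq> y1" using two by blast
    have "\<not> par (g (x, y0)) (g (x', y1))" "\<not> par (g (x, y1)) (g (x', y0))" "par (g (x, y0)) (g (x', y0))"
      unfolding par using y that(3) by (simp_all add: par_def)
    then show False using that(1)[of y0 y1] that(2)[of y0 y1] unfolding par_def by metis
  qed
  show ?thesis
  proof (rule ccontr)
    assume "\<not> ?thesis"
    then obtain x x' where x: "\<not> (\<forall>y y'. fst (g (x, y)) = fst (g (x, y')))" "\<not> (\<forall>y y'. snd (g (x', y)) = snd (g (x', y')))"
      by blast
    then have "\<forall>y y'. snd (g (x, y)) = snd (g (x, y'))" "\<forall>y y'. fst (g (x', y)) = fst (g (x', y'))"
      using col by blast+
    moreover from this x have "x' \<noteq> x" by metis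
    ultimately show False using mixed[of x' x] by blast
  qed
qed

lemma bij_map_prodD:
  assumes "bij (map_prod a b)"
  shows "bij a" "bij b"
proof -
  have i: "inj (map_prod a b)" and s: "surj (map_prod a b)" using assms by (simp_all add: bij_is_inj bij_is_surj)
  have "inj a" using i by (intro injI) (metis Pair_inject injD map_prod_simp)
  moreover have "inj b" using i by (intro injI) (metis Pair_inject injD map_prod_simp)
  moreover have "surj a" using s unfolding surj_def by (metis fst_conv fst_map_prod)
  moreover have "surj b" using s unfolding surj_def by (metis snd_conv snd_map_prod)
  ultimately show "bij a" "bij b" by (simp_all add: bij_def)
qed

text \<open>The column lemma is applied to g and to g with exchanged arguments. Surjectivity
  prevents rows and columns from both fixing the same coordinate of the image, so the map
  splits.\<close>

lemma par_preserving_cases: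
  fixes g :: "'a \<times> 'a \<Rightarrow> 'a \<times> 'a"
  assumes "bij g" and par: "\<And>p q. par (g p) (g q) \<longleftrightarrow> par p q" and two: "\<exists>x y::'a. x \<noteq> y"
  obtains a b where "g = map_prod a b" "bij a" "bij b"
    | a b where "g = map_prod a b \<circ> prod.swap" "bij a" "bij b"
proof -
  have inj: "inj g" and surj: "surj g" using assms(1) by (simp_all add: bij_is_inj bij_is_surj)
  obtain u v :: 'a where uv: "u \<noteq> v" using two by blast
  have c: "(\<forall>x y y'. fst (g (x, y)) = fst (g (x, y'))) \<or> (\<forall>x y y'. snd (g (x, y)) = snd (g (x, y')))"
    by (rule par_preserving_columns[OF inj par two])
  have "inj (g \<circ> prod.swap)" using inj by (simp add: inj_compose)
  moreover have "par ((g \<circ> prod.swap) p) ((g \<circ> prod.swap) q) \<longleftrightarrow> par p q" for p q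
    using par by (auto simp: par_def)
  ultimately have r: "(\<forall>x y y'. fst (g (y, x)) = fst (g (y', x))) \<or> (\<forall>x y y'. snd (g (y, x)) = snd (g (y', x)))"
    using par_preserving_columns[OF _ _ two, of "g \<circ> prod.swap"] by simp
  have nf: "\<not> ((\<forall>x y y'. fst (g (x, y)) = fst (g (x, y'))) \<and> (\<forall>x y y'. fst (g (y, x)) = fst (g (y', x))))"
  proof
    assume "(\<forall>x y y'. fst (g (x, y)) = fst (g (x, y'))) \<and> (\<forall>x y y'. fst (g (y, x)) = fst (g (y', x)))"
    then have "fst (g p) = fst (g q)" for p q by (metis prod.collapse)
    then show False using surj uv by (metis fst_conv surjD)
  qed
  have ns: "\<not> ((\<forall>x y y'. snd (g (x, y)) = snd (g (x, y'))) \<and> (\<forall>x y y'. snd (g (y, x)) = snd (g (y', x))))"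
  proof
    assume "(\<forall>x y y'. snd (g (x, y)) = snd (g (x, y'))) \<and> (\<forall>x y y'. snd (g (y, x)) = snd (g (y', x)))"
    then have "snd (g p) = snd (g q)" for p q by (metis prod.collapse)
    then show False using surj uv by (metis snd_conv surjD)
  qed
  show thesis
  proof (cases "\<forall>x y y'. fst (g (x, y)) = fst (g (x, y'))")
    case True
    with nf r have s: "snd (g (y, x)) = snd (g (y', x))" for x y y' by blast
    have g: "g = map_prod (\<lambda>x. fst (g (x, u))) (\<lambda>y. snd (g (u, y)))"
    proof (rule ext)
      fix p show "g p = map_prod (\<lambda>x. fst (g (x, u))) (\<lambda>y. snd (g (u, y))) p"
        using True s by (cases p) (metis map_prod_simp prod.collapse)
    qed
    with assms(1) bij_map_prodD show thesis using that(1) by metis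
  next
    case False
    with c have s: "snd (g (x, y)) = snd (g (x, y'))" for x y y' by blast
    with ns r have f: "fst (g (y, x)) = fst (g (y', x))" for x y y' by blast
    have g: "g = map_prod (\<lambda>y. fst (g (u, y))) (\<lambda>x. snd (g (x, u))) \<circ> prod.swap"
    proof (rule ext)
      fix p show "g p = (map_prod (\<lambda>y. fst (g (u, y))) (\<lambda>x. snd (g (x, u))) \<circ> prod.swap) p"
        using f s by (cases p) (metis comp_apply map_prod_simp prod.collapse swap_simp)
    qed
    have "bij (g \<circ> prod.swap)" using assms(1) bij_swap bij_comp by blast
    moreover have "g \<circ> prod.swap = map_prod (\<lambda>y. fst (g (u, y))) (\<lambda>x. snd (g (x, u)))"
      by (subst g) (simp add: o_assoc[symmetric])
    ultimately show thesis using bij_map_prodD that(2) g by metis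
  qed
qed

text \<open>With k the integer part of n x, monotonicity squeezes both n A(x) and n x A(1) between k
  A(1) and (k + 1) A(1). Their distance is thus at most A(1) for every n, which the Archimedean
  property turns into equality.\<close>

lemma additive_mono_linear:
  fixes A :: "real \<Rightarrow> real"
  assumes add: "\<And>x y. A (x + y) = A x + A y" and "mono A"
  shows "A x = x * A 1"
proof -
  have A0: "A 0 = 0" using add[of 0 0] by simp
  have neg: "A (- x) = - A x" for x using add[of x "- x"] A0 by simp
  have n: "A (real n * x) = real n * A x" for n x
    by (induction n) (simp_all add: A0 add distrib_right)
  have z: "A (of_int k) = of_int k * A 1" for k
  proof (cases "k \<ge> 0")
    case True then show ?thesis using n[of "nat k" 1] by simp
  next
    case False then show ?thesis using n[of "nat (- k)" 1] neg[of "of_int k"] by simp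
  qed
  have A1: "A 1 \<ge> 0" using monoD[OF assms(2), of 0 1] A0 by simp
  have bd: "real n * \<bar>A x - x * A 1\<bar> \<le> A 1" for n
  proof -
    define k where "k = \<lfloor>real n * x\<rfloor>"
    have k: "of_int k \<le> real n * x" "real n * x \<le> of_int (k + 1)" unfolding k_def by linarith+
    have "of_int k * A 1 \<le> real n * A x" "real n * A x \<le> of_int (k + 1) * A 1"
      using monoD[OF assms(2) k(1)] monoD[OF assms(2) k(2)] unfolding n z by simp_all
    moreover have "of_int k * A 1 \<le> real n * x * A 1" "real n * x * A 1 \<le> of_int (k + 1) * A 1"
      using k A1 by (simp_all add: mult_right_mono)
    ultimately have "\<bar>real n * A x - real n * x * A 1\<bar> \<le> A 1" by (simp add: distrib_right)
    moreover have "real n * A x - real n * x * A 1 = real n * (A x - x * A 1)" by (simp add: algebra_simps)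
    ultimately show ?thesis by (simp add: abs_mult)
  qed
  have "\<bar>A x - x * A 1\<bar> = 0"
  proof (rule ccontr)
    assume "\<bar>A x - x * A 1\<bar> \<noteq> 0"
    then have "\<bar>A x - x * A 1\<bar> > 0" by simp
    then obtain n where "A 1 < real n * \<bar>A x - x * A 1\<bar>" using reals_Archimedean3 by blast
    with bd[of n] show False by simp
  qed
  then show ?thesis by simp
qed

text \<open>Normalizing A at 0 and 1 gives \<open>C\<close>. Lines through 0 make \<open>C\<close>
  multiplicative, lines of slope 1 make it additive up to a constant \<open>k\<close>, and once
  \<open>k\<close> is 0 it is a ring endomorphism of the reals, hence the identity.\<close>

lemma line_preserving_affine:
  fixes A B :: "real \<Rightarrow> real"
  assumes inj: "inj A" and surj: "surj A"
    and lines: "\<And>s t. s \<noteq> 0 \<Longrightarrow> \<exists>s' t'. s' \<noteq> 0 \<and> (\<forall>x. B (s * x + t) = s' * A x + t')"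
  shows "\<exists>p q r s. p \<noteq> 0 \<and> r \<noteq> 0 \<and> (\<forall>x. A x = p * x + q) \<and> (\<forall>x. B x = r * x + s)"
proof -
  obtain s1 t1 where s1: "s1 \<noteq> 0" and B: "\<And>x. B x = s1 * A x + t1"
    using lines[of 1 0] by auto
  define D where "D = A 1 - A 0"
  have D: "D \<noteq> 0" using inj unfolding D_def by (metis eq_iff_diff_eq_0 injD zero_neq_one)
  define C where "C x = (A x - A 0) / D" for x
  have A: "A x = D * C x + A 0" for x using D by (simp add: C_def)
  have C01: "C 0 = 0" "C 1 = 1" using D by (simp_all add: C_def D_def)
  have injC: "inj C" using inj A by (metis injD injI)
  have surjC: "\<exists>x. C x = y" for y
  proof -
    obtain x where "A x = D * y + A 0" using surj by (metis surjD)
    then have "C x = y" using D by (simp add: C_def)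
    then show ?thesis by blast
  qed
  have lin: "C (s * x + t) = (C (s + t) - C t) * C x + C t" if s0: "s \<noteq> 0" for s t x
  proof -
    obtain s' t' where "\<And>x. B (s * x + t) = s' * A x + t'" using lines[OF s0] by blast
    then have *: "s1 * (D * C (s * x + t) + A 0) + t1 = s' * (D * C x + A 0) + t'" for x using A B by metis
    define e where "e = (s' * A 0 + t' - t1 - s1 * A 0) / (s1 * D)"
    have c: "C (s * x + t) = s' / s1 * C x + e" for x
    proof -
      have "s1 * D * C (s * x + t) = s' * D * C x + (s' * A 0 + t' - t1 - s1 * A 0)"
        using *[of x] by (simp add: algebra_simps)
      then have "C (s * x + t) = (s' * D * C x + (s' * A 0 + t' - t1 - s1 * A 0)) / (s1 * D)"
        using s1 D by (simp add: eq_divide_eq mult.commute)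
      then show ?thesis unfolding e_def using s1 D by (simp add: add_divide_distrib)
    qed
    have "C t = e" using c[of 0] C01 by simp
    moreover have "C (s + t) = s' / s1 + e" using c[of 1] C01 by simp
    ultimately show ?thesis using c[of x] by simp
  qed
  have add0: "C (x + t) = (C (1 + t) - C t) * C x + C t" for x t using lin[of 1 x t] by simp
  have mult: "C (x * y) = C x * C y" for x y
    using lin[of x y 0] C01 by (cases "x = 0") simp_all
  define k where "k = C 2 - 2"
  \<comment> \<open>The expansion of C (x + t) is not symmetric in x and t; comparing both orders at
    1 and t leaves one constant \<open>k\<close>. If \<open>k\<close> were nonzero, surjectivity
    would give t with C (1 + t) = C t, against injectivity.\<close>
  have sym: "(C (1 + t) - C t - 1) = k * C t" for t
    using add0[of 1 t] add0[of t 1] C01 by (simp add: k_def algebra_simps)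
  have k0: "k = 0"
  proof (rule ccontr)
    assume "k \<noteq> 0"
    obtain t where "C t = - 1 / k" using surjC by blast
    then have "C (1 + t) - C t = 0" using sym[of t] \<open>k \<noteq> 0\<close> by simp
    then have "C (1 + t) = C (0 + t)" by simp
    then show False using injC by (metis add_right_cancel injD zero_neq_one)
  qed
  have add: "C (x + y) = C x + C y" for x y using add0[of x y] sym[of y] k0 by (simp add: algebra_simps)
  \<comment> \<open>Nonnegative numbers are squares, so multiplicativity preserves them; this is
    where monotonicity comes from without any continuity.\<close>
  have pos: "C x \<ge> 0" if "x \<ge> 0" for x
    using mult[of "sqrt x" "sqrt x"] that by simp
  have "mono C"
  proof (rule monoI)
    fix x y :: real assume "x \<le> y"
    then show "C x \<le> C y" using add[of x "y - x"] pos[of "y - x"] by simp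
  qed
  then have Cx: "C x = x" for x using additive_mono_linear[OF add] C01 by simp
  have A': "A x = D * x + A 0" for x using A[of x] Cx[of x] by simp
  have B': "B x = (s1 * D) * x + (s1 * A 0 + t1)" for x using B[of x] A'[of x] by (simp add: algebra_simps)
  have "D \<noteq> 0 \<and> s1 * D \<noteq> 0 \<and> (\<forall>x. A x = D * x + A 0) \<and> (\<forall>x. B x = (s1 * D) * x + (s1 * A 0 + t1))"
    by (intro conjI allI A' B') (use D s1 in simp_all)
  then show ?thesis by blast
qed

text \<open>In logarithmic coordinates the equation is Cauchy's, and antitonicity of f supplies the
  monotone solution and the sign of r.\<close>

lemma multiplicative_powr:
  fixes f :: "real \<Rightarrow> real"
  assumes mult: "\<And>p x. p > 0 \<Longrightarrow> x > 0 \<Longrightarrow> f (p * x) = f p * f x"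
    and pos: "\<And>x. x > 0 \<Longrightarrow> f x > 0" and anti: "\<And>x y. 0 < x \<Longrightarrow> x < y \<Longrightarrow> f y < f x"
  shows "\<exists>r>0. \<forall>x>0. f x = x powr - r"
proof -
  define L where "L t = - ln (f (exp t))" for t
  have "L (x + y) = L x + L y" for x y
    unfolding L_def exp_add using mult[of "exp x" "exp y"] pos[of "exp x"] pos[of "exp y"] by (simp add: ln_mult)
  moreover have "mono L"
  proof (rule monoI)
    fix x y :: real assume "x \<le> y"
    then show "L x \<le> L y" unfolding L_def
      using anti[of "exp x" "exp y"] pos[of "exp x"] pos[of "exp y"] by (cases "x = y") auto
  qed
  ultimately have L: "L x = x * L 1" for x by (rule additive_mono_linear)
  have "f 1 = 1" using mult[of 1 1] pos[of 1] by simp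
  then have "L 1 > 0" unfolding L_def using anti[of 1 "exp 1"] pos[of "exp 1"] by simp
  moreover have "f x = x powr - L 1" if "x > 0" for x
  proof -
    have "- ln (f x) = ln x * L 1" using L[of "ln x"] that by (simp add: L_def)
    then have "ln (f x) = - L 1 * ln x" by (simp add: mult.commute)
    then show ?thesis using pos[OF that] that by (metis exp_ln powr_def less_irrefl)
  qed
  ultimately show ?thesis by blast
qed

section \<open>Circles as graphs\<close>

definition aff :: "real \<Rightarrow> real \<Rightarrow> s1 \<Rightarrow> s1" where
  "aff p q = map_option (\<lambda>x. p * x + q)"

definition hy :: "(real \<Rightarrow> real) \<Rightarrow> (real \<Rightarrow> real) \<Rightarrow> real \<Rightarrow> real" where
  "hy f g x = (if x > 0 then f x else - g (- x))"

text \<open>The circles of the plane are the graphs of the maps in \<open>circle_maps\<close> below: \<open>hyp f g\<close> is the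
  circle \<open>f_abc\<close> with parameters \<open>1, 0, 0\<close>, the others arise from it by \<open>aff\<close>, and the reflection
  \<open>phi\<close> amounts to precomposition with \<open>aff (-1) 0\<close>.\<close>

definition hyp :: "(real \<Rightarrow> real) \<Rightarrow> (real \<Rightarrow> real) \<Rightarrow> s1 \<Rightarrow> s1" where
  "hyp f g z = (case z of None \<Rightarrow> Some 0 | Some x \<Rightarrow> if x = 0 then None else Some (hy f g x))"

definition graph :: "('a \<Rightarrow> 'b) \<Rightarrow> ('a \<times> 'b) set" where
  "graph h = range (\<lambda>x. (x, h x))"

definition circle_maps :: "(real \<Rightarrow> real) \<Rightarrow> (real \<Rightarrow> real) \<Rightarrow> (real \<Rightarrow> real) \<Rightarrow> (real \<Rightarrow> real) \<Rightarrow> (s1 \<Rightarrow> s1) set" where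
  "circle_maps f1 f2 f3 f4 = {aff a c \<circ> hyp f1 f2 \<circ> aff 1 b | a b c. a > 0} \<union> {aff s t | s t. s \<noteq> 0}
     \<union> {aff a c \<circ> hyp f3 f4 \<circ> aff (-1) b | a b c. a > 0}"

lemma aff_simps [simp]: "aff p q None = None" "aff p q (Some x) = Some (p * x + q)"
  by (simp_all add: aff_def)

lemma aff_aff [simp]: "aff p q (aff p' q' z) = aff (p * p') (p * q' + q) z"
  by (cases z) (simp_all add: algebra_simps)

lemma aff_comp [simp]: "aff p q \<circ> aff p' q' = aff (p * p') (p * q' + q)"
  by (simp add: fun_eq_iff)

lemma aff_id [simp]: "aff 1 0 z = z" "aff 1 0 = id"
  by (cases z) (simp_all add: aff_def option.map_ident fun_eq_iff)

lemma aff_eq_None [simp]: "aff p q z = None \<longleftrightarrow> z = None"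
  by (simp add: aff_def)

lemma bij_aff: "p \<noteq> 0 \<Longrightarrow> bij (aff p q)"
  by (rule o_bij[of "aff (1/p) (- q/p)"]) (simp_all add: field_simps)

lemma inv_aff: "p \<noteq> 0 \<Longrightarrow> inv (aff p q) = aff (1/p) (- q/p)"
  by (rule inv_unique_comp) (simp_all add: field_simps)

lemma aff_mob: "aff p q = mob p q 0 1"
  by (rule ext) (simp add: mob_def hpt_def split: option.split)

lemma hyp_simps [simp]: "hyp f g None = Some 0" "hyp f g (Some 0) = None"
  "x \<noteq> 0 \<Longrightarrow> hyp f g (Some x) = Some (hy f g x)"
  by (simp_all add: hyp_def)

lemma mem_graph [simp]: "(x, y) \<in> graph h \<longleftrightarrow> y = h x"
  by (auto simp: graph_def)

lemma graph_inject [simp]: "graph h = graph h' \<longleftrightarrow> h = h'"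
proof
  assume g: "graph h = graph h'"
  have "h x = h' x" for x using mem_graph[of x "h x" h] unfolding g by simp
  then show "h = h'" by blast
qed simp

lemma f_abc_hy: "f_abc f g a b c x = a * hy f g (x + b) + c"
proof -
  have "x > - b \<longleftrightarrow> x + b > 0" "- x - b = - (x + b)" by linarith+
  then show ?thesis unfolding f_abc_def hy_def by simp
qed

lemma f_abc_circle_graph: "f_abc_circle f g a b c = graph (aff a c \<circ> hyp f g \<circ> aff 1 b)"
proof -
  have "(u, v) \<in> f_abc_circle f g a b c \<longleftrightarrow> v = (aff a c \<circ> hyp f g \<circ> aff 1 b) u" for u v
  proof (cases u)
    case None then show ?thesis by (auto simp: f_abc_circle_def)
  next
    case (Some x)
    show ?thesis
    proof (cases "x = - b")
      case True with Some show ?thesis by (auto simp: f_abc_circle_def)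
    next
      case False
      then have "x + b \<noteq> 0" by linarith
      with False Some show ?thesis by (auto simp: f_abc_circle_def f_abc_hy add.commute)
    qed
  qed
  then show ?thesis by (auto simp: set_eq_iff)
qed

lemma line_circle_graph: "line_circle s t = graph (aff s t)"
proof -
  have "(u, v) \<in> line_circle s t \<longleftrightarrow> v = aff s t u" for u v
    by (cases u) (auto simp: line_circle_def)
  then show ?thesis by (auto simp: set_eq_iff)
qed

lemma phi_graph: "phi ` graph h = graph (h \<circ> aff (-1) 0)"
proof -
  have n: "s1_neg z = aff (-1) 0 z" for z by (cases z) simp_all
  have "(u, v) \<in> phi ` graph h \<longleftrightarrow> v = h (aff (-1) 0 u)" for u v
  proof
    assume "v = h (aff (-1) 0 u)"
    then have "(u, v) = phi (aff (-1) 0 u, v)" "(aff (-1) 0 u, v) \<in> graph h"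
      by (simp_all add: phi_def n)
    then show "(u, v) \<in> phi ` graph h" by (rule image_eqI)
  next
    assume "(u, v) \<in> phi ` graph h"
    then obtain p where "p \<in> graph h" "(u, v) = phi p" by blast
    then show "v = h (aff (-1) 0 u)" by (cases p) (simp add: phi_def n)
  qed
  then show ?thesis by (auto simp: set_eq_iff)
qed

lemma circle_maps_cases:
  assumes "h \<in> circle_maps f1 f2 f3 f4"
  obtains a b c where "a > 0" "h = aff a c \<circ> hyp f1 f2 \<circ> aff 1 b" | s t where "s \<noteq> 0" "h = aff s t"
    | a b c where "a > 0" "h = aff a c \<circ> hyp f3 f4 \<circ> aff (-1) b"
  using assms unfolding circle_maps_def by blast

lemma M_circles_graph: "M_circles f1 f2 f3 f4 = graph ` circle_maps f1 f2 f3 f4"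
proof
  show "M_circles f1 f2 f3 f4 \<subseteq> graph ` circle_maps f1 f2 f3 f4"
  proof
    fix X assume "X \<in> M_circles f1 f2 f3 f4"
    then consider a b c where "a > 0" "X = f_abc_circle f1 f2 a b c" | s t where "s < 0" "X = line_circle s t"
      | a b c where "a > 0" "X = phi ` f_abc_circle f3 f4 a b c" | s t where "s < 0" "X = phi ` line_circle s t"
      unfolding M_circles_def C_plus_def C_minus_def by blast
    then show "X \<in> graph ` circle_maps f1 f2 f3 f4"
    proof cases
      case 1 then show ?thesis unfolding circle_maps_def f_abc_circle_graph by blast
    next
      case 2 then show ?thesis unfolding circle_maps_def line_circle_graph by fast
    next
      case 3
      then have "X = graph (aff a c \<circ> hyp f3 f4 \<circ> aff (-1) b)" by (simp add: f_abc_circle_graph phi_graph o_assoc[symmetric])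
      with 3 show ?thesis unfolding circle_maps_def by blast
    next
      case 4
      then have "X = graph (aff (- s) t)" by (simp add: line_circle_graph phi_graph)
      with 4 show ?thesis unfolding circle_maps_def by force
    qed
  qed
  show "graph ` circle_maps f1 f2 f3 f4 \<subseteq> M_circles f1 f2 f3 f4"
  proof clarify
    fix h assume "h \<in> circle_maps f1 f2 f3 f4"
    then show "graph h \<in> M_circles f1 f2 f3 f4"
    proof (cases rule: circle_maps_cases)
      case (1 a b c)
      then have "graph h = f_abc_circle f1 f2 a b c" by (simp add: f_abc_circle_graph)
      with 1 show ?thesis unfolding M_circles_def C_minus_def by blast
    next
      case (2 s t)
      show ?thesis
      proof (cases "s < 0")
        case True
        with 2 have "line_circle s t \<in> C_minus f1 f2" unfolding C_minus_def by blast
        then show ?thesis using 2 by (simp add: line_circle_graph M_circles_def)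
      next
        \<comment> \<open>A line of positive slope occurs among the circles only as the reflection
          of one of negative slope.\<close>
        case False
        with 2 have "line_circle (- s) t \<in> C_minus f3 f4" unfolding C_minus_def by fastforce
        moreover have "graph h = phi ` line_circle (- s) t" using 2 by (simp add: line_circle_graph phi_graph)
        ultimately show ?thesis unfolding M_circles_def C_plus_def by blast
      qed
    next
      case (3 a b c)
      then have "graph h = phi ` f_abc_circle f3 f4 a b c" by (simp add: f_abc_circle_graph phi_graph o_assoc[symmetric])
      moreover have "f_abc_circle f3 f4 a b c \<in> C_minus f3 f4" using 3 unfolding C_minus_def by blast
      ultimately show ?thesis unfolding M_circles_def C_plus_def by blast
    qed
  qed
qed

section \<open>Monotonicity, continuity and limits of hyperbola branches\<close>

lemma strongly_hyperbolic_pos: "strongly_hyperbolic f \<Longrightarrow> x > 0 \<Longrightarrow> f x > 0"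
  by (simp add: strongly_hyperbolic_def)

lemma strongly_hyperbolic_tendsto_0: "strongly_hyperbolic f \<Longrightarrow> (f \<longlongrightarrow> 0) at_top"
  by (simp add: strongly_hyperbolic_def)

lemma strongly_hyperbolic_at_top: "strongly_hyperbolic f \<Longrightarrow> filterlim f at_top (at_right 0)"
  by (simp add: strongly_hyperbolic_def)

lemma strongly_hyperbolic_continuous: "strongly_hyperbolic f \<Longrightarrow> continuous_on {0<..} f"
  unfolding strongly_hyperbolic_def
  by (auto intro!: continuous_at_imp_continuous_on differentiable_imp_continuous_within)

text \<open>If f x \<le> f y, convexity keeps f at least f y beyond y, which contradicts the limit 0
  because f y is positive.\<close>

lemma strongly_hyperbolic_strict_anti:
  assumes f: "strongly_hyperbolic f" and xy: "0 < x" "x < y"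
  shows "f y < f x"
proof (rule ccontr)
  assume "\<not> f y < f x"
  then have le: "f x \<le> f y" by simp
  have cv: "f (t * u + (1 - t) * v) < t * f u + (1 - t) * f v"
    if "u > 0" "v > 0" "u \<noteq> v" "0 < t" "t < 1" for t u v
    using f that unfolding strongly_hyperbolic_def strictly_convex_on_def by auto
  have "f y \<le> f z" if "z > y" for z
  proof -
    define t where "t = (z - y) / (z - x)"
    have t: "0 < t" "t < 1" using xy that by (simp_all add: t_def)
    have "t * x + (1 - t) * z = z - t * (z - x)" by (simp add: algebra_simps)
    also have "\<dots> = y" using xy that by (simp add: t_def)
    finally have "f y < t * f x + (1 - t) * f z" using cv[of x z t] xy that t by simp
    also have "\<dots> \<le> t * f y + (1 - t) * f z" using le t by (simp add: mult_left_mono)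
    finally have "(1 - t) * f y < (1 - t) * f z" by (simp add: algebra_simps)
    then show ?thesis using t by simp
  qed
  then have "eventually (\<lambda>z. f y \<le> f z) at_top"
    using eventually_gt_at_top[of y] by (rule eventually_mono[rotated])
  then have "f y \<le> 0"
    by (rule tendsto_lowerbound[OF strongly_hyperbolic_tendsto_0[OF f]]) simp
  then show False using strongly_hyperbolic_pos[OF f, of y] xy by simp
qed

lemma hy_pos: "x > 0 \<Longrightarrow> hy f g x = f x"
  and hy_neg: "x < 0 \<Longrightarrow> hy f g x = - g (- x)"
  by (simp_all add: hy_def)

context
  fixes f g assumes f: "strongly_hyperbolic f" and g: "strongly_hyperbolic g"
begin

lemma hy_pos_iff: "x \<noteq> 0 \<Longrightarrow> hy f g x > 0 \<longleftrightarrow> x > 0"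
  using strongly_hyperbolic_pos[OF f, of x] strongly_hyperbolic_pos[OF g, of "- x"] by (auto simp: hy_def)

lemma hy_nonzero: "x \<noteq> 0 \<Longrightarrow> hy f g x \<noteq> 0"
  using strongly_hyperbolic_pos[OF f, of x] strongly_hyperbolic_pos[OF g, of "- x"] by (auto simp: hy_def)

lemma hy_inject:
  assumes "x \<noteq> 0" "y \<noteq> 0" "hy f g x = hy f g y"
  shows "x = y"
proof -
  have "x > 0 \<longleftrightarrow> y > 0" using hy_pos_iff assms by metis
  then have "(x > 0 \<and> y > 0) \<or> (x < 0 \<and> y < 0)" using assms by linarith
  then show ?thesis
  proof
    assume p: "x > 0 \<and> y > 0"
    then show ?thesis using strongly_hyperbolic_strict_anti[OF f, of x y] strongly_hyperbolic_strict_anti[OF f, of y x] assms(3)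
      by (simp add: hy_pos) (metis less_irrefl linorder_neqE_linordered_idom)
  next
    assume p: "x < 0 \<and> y < 0"
    then show ?thesis using strongly_hyperbolic_strict_anti[OF g, of "- x" "- y"] strongly_hyperbolic_strict_anti[OF g, of "- y" "- x"] assms(3)
      by (simp add: hy_neg) (metis less_irrefl linorder_neqE_linordered_idom)
  qed
qed

lemma inj_hyp: "inj (hyp f g)"
proof (rule injI)
  fix x y assume e: "hyp f g x = hyp f g y"
  consider "x = None" | "x = Some 0" | u where "x = Some u" "u \<noteq> 0" by (cases x) blast+
  note X = this
  consider "y = None" | "y = Some 0" | u where "y = Some u" "u \<noteq> 0" by (cases y) blast+
  note Y = this
  show "x = y"
  proof (cases rule: X)
    case 1
    show ?thesis
    proof (cases rule: Y)
      case (3 v) with e 1 hy_nonzero[of v] show ?thesis by simp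
    qed (use e 1 in auto)
  next
    case 2
    with e show ?thesis by (cases rule: Y) auto
  next
    case (3 u)
    show ?thesis
    proof (cases rule: Y)
      case 1 with e 3 hy_nonzero[of u] show ?thesis by simp
    next
      case 2 with e 3 show ?thesis by simp
    next
      case (3 v) with e \<open>x = Some u\<close> \<open>u \<noteq> 0\<close> hy_inject[of u v] show ?thesis by simp
    qed
  qed
qed

lemma continuous_on_hy: "continuous_on (- {0}) (hy f g)"
proof -
  have "continuous_on {0<..} (hy f g)"
    by (rule continuous_on_eq[OF strongly_hyperbolic_continuous[OF f]]) (simp add: hy_pos)
  moreover have "continuous_on {..<0} (hy f g)"
  proof (rule continuous_on_eq)
    show "continuous_on {..<0} (\<lambda>x. - g (- x))"
      by (intro continuous_on_minus continuous_on_compose2[OF strongly_hyperbolic_continuous[OF g]] continuous_on_id) auto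
  qed (simp add: hy_neg)
  ultimately have "continuous_on ({..<0} \<union> {0<..}) (hy f g)"
    by (intro continuous_on_open_Un open_lessThan open_greaterThan)
  moreover have "{..<0} \<union> {0<..} = - {0::real}" by auto
  ultimately show ?thesis by simp
qed

lemma hy_tendsto_0: "(hy f g \<longlongrightarrow> 0) at_infinity"
proof -
  have t: "(hy f g \<longlongrightarrow> 0) at_top"
  proof (rule Lim_transform_eventually[OF strongly_hyperbolic_tendsto_0[OF f]])
    show "eventually (\<lambda>x. f x = hy f g x) at_top"
      using eventually_gt_at_top[of 0] by eventually_elim (simp add: hy_pos)
  qed
  have "((\<lambda>x. - g (- x)) \<longlongrightarrow> - 0) at_bot"
    by (intro tendsto_minus filterlim_compose[OF strongly_hyperbolic_tendsto_0[OF g]] filterlim_uminus_at_top_at_bot)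
  then have "((\<lambda>x. - g (- x)) \<longlongrightarrow> 0) at_bot" by simp
  moreover have "eventually (\<lambda>x. - g (- x) = hy f g x) at_bot"
    using eventually_gt_at_bot[of 0] by eventually_elim (simp add: hy_neg)
  ultimately have "(hy f g \<longlongrightarrow> 0) at_bot"
    by (rule Lim_transform_eventually)
  with t show ?thesis unfolding at_infinity_eq_at_top_bot by (simp add: filterlim_sup)
qed

text \<open>The one-sided limits at 0 have opposite infinite signs; \<open>at_infinity\<close>
  admits both, so the limit is two-sided.\<close>

lemma hy_left_0: "filterlim (hy f g) at_infinity (at 0)"
proof -
  have "filterlim (hy f g) at_top (at_right 0)"
    by (rule filterlim_mono_eventually[OF strongly_hyperbolic_at_top[OF f] order_refl order_refl])
      (auto simp: eventually_at_right_field hy_pos intro!: exI[of _ 1])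
  then have r: "filterlim (hy f g) at_infinity (at_right 0)" by (rule filterlim_at_top_imp_at_infinity)
  have "filterlim (\<lambda>x. g (- x)) at_top (at_left 0)"
    using strongly_hyperbolic_at_top[OF g] by (simp add: filterlim_at_left_to_right)
  then have "filterlim (\<lambda>x. - g (- x)) at_bot (at_left 0)"
    by (simp add: filterlim_uminus_at_bot)
  then have "filterlim (hy f g) at_bot (at_left 0)"
    by (rule filterlim_mono_eventually[OF _ order_refl order_refl])
      (auto simp: eventually_at_left_field hy_neg intro!: exI[of _ "-1"])
  then have "filterlim (hy f g) at_infinity (at_left 0)" by (rule filterlim_at_bot_imp_at_infinity)
  with r show ?thesis by (simp add: filterlim_split_at)
qed

end

section \<open>Automorphisms and the stabilizer of infinity\<close>

lemma bij_map_prod: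
  assumes "bij a" "bij b"
  shows "bij (map_prod a b)"
  using assms by (simp add: bij_def prod.inj_map map_prod_surj)

lemma inv_map_prod:
  assumes "bij a" "bij b"
  shows "inv (map_prod a b) = map_prod (inv a) (inv b)"
  using assms by (intro inv_unique_comp)
    (auto simp: map_prod.comp map_prod.id bij_is_inj bij_is_surj surj_iff[THEN iffD1] inj_iff[THEN iffD1])

lemma map_prod_graph:
  assumes "bij a"
  shows "map_prod a b ` graph h = graph (b \<circ> h \<circ> inv a)"
proof -
  have "(u, v) \<in> map_prod a b ` graph h \<longleftrightarrow> v = (b \<circ> h \<circ> inv a) u" for u v
  proof
    assume "(u, v) \<in> map_prod a b ` graph h"
    then obtain x where "u = a x" "v = b (h x)" by (auto simp: graph_def)
    then show "v = (b \<circ> h \<circ> inv a) u" using assms by (simp add: bij_is_inj)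
  next
    assume "v = (b \<circ> h \<circ> inv a) u"
    then have "(u, v) = map_prod a b (inv a u, h (inv a u))"
      using assms by (simp add: bij_is_surj surj_f_inv_f)
    then show "(u, v) \<in> map_prod a b ` graph h" by (rule image_eqI) simp
  qed
  then show ?thesis by (auto simp: set_eq_iff)
qed

section \<open>Incidence, parallelism and the action of automorphisms on circle maps\<close>

locale hyperbola_plane =
  fixes f1 f2 f3 f4 :: "real \<Rightarrow> real"
  assumes f1: "strongly_hyperbolic f1" and f2: "strongly_hyperbolic f2"
    and f3: "strongly_hyperbolic f3" and f4: "strongly_hyperbolic f4"
    and f1_1: "f1 1 = 1" and f3_1: "f3 1 = 1"
begin

definition H :: "(s1 \<Rightarrow> s1) set" where "H = circle_maps f1 f2 f3 f4"

definition Aut :: "(pt \<Rightarrow> pt) set" where "Aut = automorphisms (M_circles f1 f2 f3 f4)"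

lemma M_circles_H: "M_circles f1 f2 f3 f4 = graph ` H"
  by (simp add: M_circles_graph H_def)

lemma H_cases:
  assumes "h \<in> H"
  obtains a b c where "a > 0" "h = aff a c \<circ> hyp f1 f2 \<circ> aff 1 b" | s t where "s \<noteq> 0" "h = aff s t"
    | a b c where "a > 0" "h = aff a c \<circ> hyp f3 f4 \<circ> aff (-1) b"
  using circle_maps_cases[OF assms[unfolded H_def]] .

lemma H_minus: "a > 0 \<Longrightarrow> aff a c \<circ> hyp f1 f2 \<circ> aff 1 b \<in> H"
  and H_line: "s \<noteq> 0 \<Longrightarrow> aff s t \<in> H"
  and H_plus: "a > 0 \<Longrightarrow> aff a c \<circ> hyp f3 f4 \<circ> aff (-1) b \<in> H"
  unfolding H_def circle_maps_def by blast+

lemma inj_H: "h \<in> H \<Longrightarrow> inj h"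
  by (erule H_cases)
    (simp_all add: inj_compose inj_hyp[OF f1 f2] inj_hyp[OF f3 f4] bij_is_inj[OF bij_aff] del: aff_comp)

lemma H_aff: "h \<in> H \<Longrightarrow> r > 0 \<Longrightarrow> aff r s \<circ> h \<circ> aff 1 b \<in> H"
proof (erule H_cases)
  fix a b' c assume *: "r > 0" "0 < a" "h = aff a c \<circ> hyp f1 f2 \<circ> aff 1 b'"
  have "aff r s \<circ> h \<circ> aff 1 b = aff (r * a) (r * c + s) \<circ> hyp f1 f2 \<circ> aff 1 (b + b')"
    by (simp add: * fun_eq_iff)
  with * show "aff r s \<circ> h \<circ> aff 1 b \<in> H" by (simp add: H_minus)
next
  fix s' t assume "r > 0" "s' \<noteq> 0" "h = aff s' t"
  then show "aff r s \<circ> h \<circ> aff 1 b \<in> H" by (simp add: H_line)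
next
  fix a b' c assume *: "r > 0" "0 < a" "h = aff a c \<circ> hyp f3 f4 \<circ> aff (-1) b'"
  have "aff r s \<circ> h \<circ> aff 1 b = aff (r * a) (r * c + s) \<circ> hyp f3 f4 \<circ> aff (-1) (b' - b)"
    by (simp add: * fun_eq_iff)
  with * show "aff r s \<circ> h \<circ> aff 1 b \<in> H" by (simp add: H_plus)
qed

lemma f2_pos: "f2 1 > 0" using strongly_hyperbolic_pos[OF f2] by simp

lemma join_None:
  assumes "x' \<noteq> None" "y \<noteq> y'"
  shows "\<exists>h\<in>H. h None = y \<and> h x' = y'"
proof -
  obtain u where u: "x' = Some u" using assms(1) by blast
  show ?thesis
  proof (cases y)
    case None
    with assms(2) obtain v where v: "y' = Some v" by (cases y') auto
    show ?thesis by (rule bexI[OF _ H_line[of 1 "v - u"]]) (simp_all add: None u v)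
  next
    case (Some c)
    show ?thesis
    proof (cases y')
      case None
      show ?thesis by (rule bexI[OF _ H_minus[of 1 c "- u"]]) (simp_all add: None Some u)
    next
      case (Some v)
      with \<open>y = Some c\<close> assms(2) consider "v > c" | "v < c" by force
      then show ?thesis
      proof cases
        \<comment> \<open>The right branch passes through (1, 1), the left one through (-1, - f2 1).
          Translating u to 1 or -1 and scaling the height difference v - c gives the two
          witnesses.\<close>
        case 1
        then show ?thesis
          by (intro bexI[OF _ H_minus[of "v - c" c "1 - u"]]) (simp_all add: Some \<open>y = Some c\<close> u hy_pos f1_1)
      next
        case 2
        then show ?thesis using f2_pos
          by (intro bexI[OF _ H_minus[of "(c - v) / f2 1" c "- 1 - u"]]) (simp_all add: Some \<open>y = Some c\<close> u hy_neg)
      qed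
    qed
  qed
qed

lemma join_finite:
  assumes "u \<noteq> u'" "y \<noteq> y'"
  shows "\<exists>h\<in>H. h (Some u) = y \<and> h (Some u') = y'"
proof -
  have N: "\<exists>h\<in>H. h (Some u) = None \<and> h (Some u') = Some v" if "u \<noteq> u'" for u u' v
    by (rule bexI[OF _ H_minus[of 1 "v - hy f1 f2 (u' - u)" "- u"]])
      (use that in simp_all)
  show ?thesis
  proof (cases y)
    case None
    with assms N show ?thesis by (cases y') auto
  next
    case (Some v)
    show ?thesis
    proof (cases y')
      case None
      with assms(1) N[of u' u v] Some show ?thesis by auto
    next
      case (Some v')
      with assms \<open>y = Some v\<close> have "(v' - v) / (u' - u) \<noteq> 0" by simp
      moreover have "(v' - v) / (u' - u) * u' + (v - (v' - v) / (u' - u) * u) = v'"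
      proof -
        have "(v' - v) / (u' - u) * u' + (v - (v' - v) / (u' - u) * u) = (v' - v) / (u' - u) * (u' - u) + v"
          by (simp only: right_diff_distrib)
        then show ?thesis using assms(1) by simp
      qed
      ultimately show ?thesis using Some \<open>y = Some v\<close>
        by (intro bexI[OF _ H_line[of "(v' - v) / (u' - u)" "v - (v' - v) / (u' - u) * u"]]) simp_all
    qed
  qed
qed

lemma join:
  assumes "x \<noteq> x'" "y \<noteq> y'"
  shows "\<exists>h\<in>H. h x = y \<and> h x' = y'"
proof (cases x)
  case None
  with assms join_None[of x' y y'] show ?thesis by auto
next
  case (Some u)
  show ?thesis
  proof (cases x')
    case None
    with assms Some join_None[of x y' y] show ?thesis by auto
  next
    case (Some u')
    with assms \<open>x = Some u\<close> join_finite[of u u' y y'] show ?thesis by simp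
  qed
qed

text \<open>Parallelism is expressed by circles alone, so automorphisms must respect it. Circle maps
  are injective and thus never join parallel points; \<open>join\<close> connects all the
  others.\<close>

lemma par_iff: "p \<noteq> q \<Longrightarrow> par p q \<longleftrightarrow> \<not> (\<exists>X\<in>M_circles f1 f2 f3 f4. p \<in> X \<and> q \<in> X)"
proof (cases p, cases q)
  fix x y x' y' assume pq: "p \<noteq> q" "p = (x, y)" "q = (x', y')"
  show "par p q \<longleftrightarrow> \<not> (\<exists>X\<in>M_circles f1 f2 f3 f4. p \<in> X \<and> q \<in> X)"
  proof
    assume "par p q"
    then have "x = x' \<or> y = y'" using pq by (simp add: par_def)
    moreover have "y \<noteq> y' \<or> x \<noteq> x'" using pq by auto
    ultimately have "\<not> (y = h x \<and> y' = h x')" if "h \<in> H" for h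
      using inj_H[OF that] by (metis injD)
    then show "\<not> (\<exists>X\<in>M_circles f1 f2 f3 f4. p \<in> X \<and> q \<in> X)" using pq by (auto simp: M_circles_H)
  next
    assume *: "\<not> (\<exists>X\<in>M_circles f1 f2 f3 f4. p \<in> X \<and> q \<in> X)"
    show "par p q"
    proof (rule ccontr)
      assume "\<not> par p q"
      then have "x \<noteq> x'" "y \<noteq> y'" using pq by (simp_all add: par_def)
      then obtain h where "h \<in> H" "h x = y" "h x' = y'" using join by blast
      then have "graph h \<in> M_circles f1 f2 f3 f4" "p \<in> graph h" "q \<in> graph h" using pq by (auto simp: M_circles_H)
      with * show False by blast
    qed
  qed
qed

lemma Aut_comp: "g \<in> Aut \<Longrightarrow> h \<in> Aut \<Longrightarrow> g \<circ> h \<in> Aut"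
  and Aut_inv: "g \<in> Aut \<Longrightarrow> inv g \<in> Aut"
  and Aut_bij: "g \<in> Aut \<Longrightarrow> bij g"
  unfolding Aut_def by (simp_all add: automorphisms_comp automorphisms_inv automorphisms_bij)

lemma Aut_circle: "g \<in> Aut \<Longrightarrow> X \<in> M_circles f1 f2 f3 f4 \<Longrightarrow> g ` X \<in> M_circles f1 f2 f3 f4"
  unfolding Aut_def automorphisms_def bij_betw_def by blast

lemma Aut_cases:
  assumes "g \<in> Aut"
  obtains a b where "g = map_prod a b" "bij a" "bij b"
    | a b where "g = map_prod a b \<circ> prod.swap" "bij a" "bij b"
proof -
  have b: "bij g" using assms by (rule Aut_bij)
  have imp: "par p q" if "g \<in> Aut" "par (g p) (g q)" for g p q
  proof (cases "p = q")
    case False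
    then have "g p \<noteq> g q" using Aut_bij[OF that(1)] by (metis bij_is_inj injD)
    with that have *: "\<not> (\<exists>X\<in>M_circles f1 f2 f3 f4. g p \<in> X \<and> g q \<in> X)" using par_iff by blast
    have "\<not> (\<exists>X\<in>M_circles f1 f2 f3 f4. p \<in> X \<and> q \<in> X)"
    proof clarify
      fix X assume X: "X \<in> M_circles f1 f2 f3 f4" "p \<in> X" "q \<in> X"
      have "g p \<in> g ` X" "g q \<in> g ` X" using X by simp_all
      moreover have "g ` X \<in> M_circles f1 f2 f3 f4" by (rule Aut_circle[OF that(1) X(1)])
      ultimately have "\<exists>X\<in>M_circles f1 f2 f3 f4. g p \<in> X \<and> g q \<in> X" by (intro bexI[of _ "g ` X"] conjI)
      with * show False by contradiction
    qed
    then show ?thesis unfolding par_iff[OF False] .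
  qed (simp add: par_def)
  have "par (g p) (g q) \<longleftrightarrow> par p q" for p q
  proof
    assume "par p q"
    moreover have "inv g (g p) = p" "inv g (g q) = q" using b by (simp_all add: bij_is_inj)
    ultimately show "par (g p) (g q)" using imp[OF Aut_inv[OF assms], of "g p" "g q"] by simp
  qed (rule imp[OF assms])
  then show thesis
  proof (rule par_preserving_cases[OF b])
    show "\<exists>x y :: s1. x \<noteq> y" by (rule exI[of _ None], rule exI[of _ "Some 0"]) simp
  qed (use that in blast)+
qed

lemma pair_bij: "map_prod a b \<in> Aut \<Longrightarrow> bij a" "map_prod a b \<in> Aut \<Longrightarrow> bij b"
  using Aut_bij bij_map_prodD by blast+

lemma pair_H:
  assumes "map_prod a b \<in> Aut" "h \<in> H"
  shows "b \<circ> h \<circ> inv a \<in> H"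
proof -
  have "map_prod a b ` graph h \<in> M_circles f1 f2 f3 f4"
    using assms(2) by (intro Aut_circle[OF assms(1)]) (simp add: M_circles_H)
  then show ?thesis
    unfolding map_prod_graph[OF pair_bij(1)[OF assms(1)]] M_circles_H by auto
qed

lemma pair_inv: "map_prod a b \<in> Aut \<Longrightarrow> map_prod (inv a) (inv b) \<in> Aut"
  using Aut_inv pair_bij inv_map_prod by metis

lemma pair_H_inv:
  assumes "map_prod a b \<in> Aut" "h \<in> H"
  shows "inv b \<circ> h \<circ> a \<in> H"
  using pair_H[OF pair_inv[OF assms(1)] assms(2)] pair_bij(1)[OF assms(1)] by (simp add: inv_inv_eq)

lemma pair_comp: "map_prod a b \<in> Aut \<Longrightarrow> map_prod a' b' \<in> Aut \<Longrightarrow> map_prod (a \<circ> a') (b \<circ> b') \<in> Aut"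
  using Aut_comp[of "map_prod a b" "map_prod a' b'"] by (simp add: map_prod.comp)

lemma pairI:
  assumes "bij a" "bij b" "\<And>h. h \<in> H \<Longrightarrow> b \<circ> h \<circ> inv a \<in> H" "\<And>h. h \<in> H \<Longrightarrow> inv b \<circ> h \<circ> a \<in> H"
  shows "map_prod a b \<in> Aut"
proof -
  have a: "inv a \<circ> a = id" "a \<circ> inv a = id" and b: "inv b \<circ> b = id" "b \<circ> inv b = id"
    using assms(1,2) by (simp_all add: bij_is_inj bij_is_surj surj_iff[THEN iffD1] inj_iff[THEN iffD1])
  have "bij_betw (\<lambda>X. map_prod a b ` X) (graph ` H) (graph ` H)"
  proof (rule bij_betw_byWitness[where f' = "\<lambda>X. map_prod (inv a) (inv b) ` X"])
    have "map_prod (inv a) (inv b) \<circ> map_prod a b = id" "map_prod a b \<circ> map_prod (inv a) (inv b) = id"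
      by (simp_all add: map_prod.comp a b map_prod.id)
    then show "\<forall>X\<in>graph ` H. map_prod (inv a) (inv b) ` map_prod a b ` X = X"
      "\<forall>X\<in>graph ` H. map_prod a b ` map_prod (inv a) (inv b) ` X = X"
      by (simp_all add: image_comp)
    show "(`) (map_prod a b) ` graph ` H \<subseteq> graph ` H"
      using assms(3) by (auto simp: map_prod_graph[OF assms(1)])
    show "(`) (map_prod (inv a) (inv b)) ` graph ` H \<subseteq> graph ` H"
      using assms(4) by (auto simp: map_prod_graph[OF bij_imp_bij_inv[OF assms(1)]] inv_inv_eq assms(1))
  qed
  then show ?thesis unfolding Aut_def automorphisms_def M_circles_H using bij_map_prod assms by blast
qed

text \<open>These maps exist whatever the four functions are, since the circle parameters a, b, c
  absorb them; they account for dimension 3.\<close>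

lemma translation_Aut: "r > 0 \<Longrightarrow> map_prod (aff 1 b) (aff r s) \<in> Aut"
  by (rule pairI) (simp_all add: bij_aff inv_aff H_aff)

lemma H_None_None:
  assumes "h \<in> H" "h None = None"
  shows "\<exists>s t. s \<noteq> 0 \<and> h = aff s t"
  using assms(1)
proof (rule H_cases)
  fix a b c assume "h = aff a c \<circ> hyp f1 f2 \<circ> aff 1 b"
  with assms(2) show ?thesis by simp
next
  fix a b c assume "h = aff a c \<circ> hyp f3 f4 \<circ> aff (-1) b"
  with assms(2) show ?thesis by simp
qed blast

lemma pair_stabilizer:
  assumes "map_prod a b \<in> Aut \<or> map_prod a b \<circ> prod.swap \<in> Aut" "bij a" "bij b" "a None = None" "b None = None"
  obtains p q r s where "p \<noteq> 0" "r \<noteq> 0" "a = aff p q" "b = aff r s"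
proof -
  have fin: "g (Some x) = Some (the (g (Some x)))" if "bij g" "g None = None" for g :: "s1 \<Rightarrow> s1" and x
    using that by (metis bij_pointE not_Some_eq option.exhaust_sel)
  define A where "A x = the (a (Some x))" for x
  define B where "B x = the (b (Some x))" for x
  have A: "a (Some x) = Some (A x)" and B: "b (Some x) = Some (B x)" for x
    unfolding A_def B_def using fin assms by simp_all
  have bijR: "inj G \<and> surj G" if g: "bij g" "g None = None" "\<And>x. g (Some x) = Some (G x)" for g and G :: "real \<Rightarrow> real"
  proof
    show "inj G" using g by (intro injI) (metis bij_is_inj injD option.inject)
    show "surj G" unfolding surj_def
    proof
      fix y obtain z where "g z = Some y" using bij_is_surj[OF g(1)] unfolding surj_def by metis
      then show "\<exists>x. y = G x" using g(2,3) by (cases z) auto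
    qed
  qed
  have fin: "\<exists>p q r s. p \<noteq> 0 \<and> r \<noteq> 0 \<and> (\<forall>x. A x = p * x + q) \<and> (\<forall>x. B x = r * x + s)"
    using assms(1)
  proof
    assume g: "map_prod a b \<in> Aut"
    have "\<exists>s' t'. s' \<noteq> 0 \<and> (\<forall>x. B (s * x + t) = s' * A x + t')" if "s \<noteq> 0" for s t
    proof -
      have h: "b \<circ> aff s t \<circ> inv a \<in> H" by (rule pair_H[OF g H_line[OF that]])
      have ia: "inv a None = None" using assms(2,4) by (metis bij_is_inj inv_f_f)
      then obtain s' t' where st: "s' \<noteq> 0" "b \<circ> aff s t \<circ> inv a = aff s' t'"
        using H_None_None[OF h] assms(5) by auto
      have "B (s * x + t) = s' * A x + t'" for x
      proof -
        have "(b \<circ> aff s t \<circ> inv a) (a (Some x)) = aff s' t' (a (Some x))" unfolding st ..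
        moreover have "inv a (a (Some x)) = Some x" using assms(2) by (simp add: bij_is_inj)
        ultimately show ?thesis by (simp add: A B)
      qed
      with st(1) show ?thesis by blast
    qed
    then show ?thesis using line_preserving_affine[of A B] bijR[OF assms(2,4) A] by blast
  next
    assume g: "map_prod a b \<circ> prod.swap \<in> Aut"
    \<comment> \<open>After an exchange of the factors the image of a line is read in the other
      direction: the line equation is solved for A, and \<open>line_preserving_affine\<close> is
      used with A and B interchanged.\<close>
    have "\<exists>s' t'. s' \<noteq> 0 \<and> (\<forall>x. A (s * x + t) = s' * B x + t')" if "s \<noteq> 0" for s t
    proof -
      have "(map_prod a b \<circ> prod.swap) ` graph (aff s t) \<in> M_circles f1 f2 f3 f4"
        by (rule Aut_circle[OF g]) (use H_line[OF that] in \<open>simp add: M_circles_H\<close>)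
      then obtain h where h: "h \<in> H" "(map_prod a b \<circ> prod.swap) ` graph (aff s t) = graph h"
        by (auto simp: M_circles_H)
      have hx: "h (a (aff s t x)) = b x" for x
      proof -
        have "(map_prod a b \<circ> prod.swap) (x, aff s t x) \<in> graph h" unfolding h(2)[symmetric] by (rule imageI) simp
        then show ?thesis by simp
      qed
      from hx[of None] have "h None = None" using assms(4,5) by simp
      then obtain s' t' where st: "s' \<noteq> 0" "h = aff s' t'" using H_None_None[OF h(1)] by blast
      have "A (s * x + t) = (1 / s') * B x + (- t' / s')" for x
        using hx[of "Some x"] st by (simp add: A B field_simps)
      then show ?thesis using st(1) by (intro exI[of _ "1 / s'"] exI[of _ "- t' / s'"]) simp
    qed
    then have "\<exists>p q r s. p \<noteq> 0 \<and> r \<noteq> 0 \<and> (\<forall>x. B x = p * x + q) \<and> (\<forall>x. A x = r * x + s)"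
      using line_preserving_affine[of B A] bijR[OF assms(3,5) B] by blast
    then show ?thesis by blast
  qed
  then obtain p q r s where pq: "p \<noteq> 0" "r \<noteq> 0" "\<And>x. A x = p * x + q" "\<And>x. B x = r * x + s" by blast
  have "a = aff p q"
  proof
    fix z show "a z = aff p q z" by (cases z) (simp_all add: assms A pq)
  qed
  moreover have "b = aff r s"
  proof
    fix z show "b z = aff r s z" by (cases z) (simp_all add: assms B pq)
  qed
  ultimately show thesis using that pq by blast
qed

end

section \<open>Automorphisms moving infinity\<close>

text \<open>The coefficient \<open>s\<close> is the reciprocal of the parameter s_1 or s_2 of the
  theorem.\<close>

definition is_power :: "real \<Rightarrow> real \<Rightarrow> (real \<Rightarrow> real) \<Rightarrow> (real \<Rightarrow> real) \<Rightarrow> bool" where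
  "is_power r s f g \<longleftrightarrow> (\<forall>x>0. f x = x powr - r \<and> g x = s * x powr - r)"

text \<open>The admissible scaling factors form a group; being nondiscrete it is dense, hence everything
  by continuity.\<close>

lemma is_power_of_small_scalings:
  assumes f: "strongly_hyperbolic f" and g: "strongly_hyperbolic g" and f1: "f 1 = 1"
    and small: "\<And>e. e > 0 \<Longrightarrow> \<exists>p>0. p \<noteq> 1 \<and> \<bar>p - 1\<bar> < e \<and> (\<exists>l. \<forall>x>0. f (p * x) = l * f x \<and> g (p * x) = l * g x)"
  shows "\<exists>r s. r > 0 \<and> s > 0 \<and> is_power r s f g"
proof -
  have fpos: "f x > 0" and gpos: "g x > 0" if "x > 0" for x
    using that strongly_hyperbolic_pos f g by blast+
  \<comment> \<open>Logarithms turn scaling factors into an additive subgroup of the reals.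
    Evaluation at 1, where f is 1, shows that the common factor of f and g can only be f (exp
    y).\<close>
  define S where "S = {y. \<forall>x>0. f (exp y * x) = f (exp y) * f x \<and> g (exp y * x) = f (exp y) * g x}"
  have S0: "0 \<in> S" by (simp add: S_def f1)
  have S_add: "y + z \<in> S" if yz: "y \<in> S" "z \<in> S" for y z
  proof -
    have "f (exp (y + z) * x) = f (exp (y + z)) * f x \<and> g (exp (y + z) * x) = f (exp (y + z)) * g x" if x: "x > 0" for x
    proof -
      have "f (exp y * (exp z * x)) = f (exp y) * (f (exp z) * f x)" "g (exp y * (exp z * x)) = f (exp y) * (f (exp z) * g x)"
        "f (exp y * exp z) = f (exp y) * f (exp z)"
        using yz x by (simp_all add: S_def)
      then show ?thesis by (simp add: exp_add mult.assoc)
    qed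
    then show ?thesis by (simp add: S_def)
  qed
  have S_neg: "- y \<in> S" if y: "y \<in> S" for y
  proof -
    have "f (exp (- y) * x) = f (exp (- y)) * f x \<and> g (exp (- y) * x) = f (exp (- y)) * g x" if x: "x > 0" for x
    proof -
      have e: "exp y * (exp (- y) * z) = z" for z :: real by (simp add: exp_minus)
      have "f (exp y * (exp (- y) * x)) = f (exp y) * f (exp (- y) * x)" "g (exp y * (exp (- y) * x)) = f (exp y) * g (exp (- y) * x)"
        "f (exp y * (exp (- y) * 1)) = f (exp y) * f (exp (- y) * 1)"
        using y x by (simp_all add: S_def del: mult_1_right)
      then have "f x = f (exp y) * f (exp (- y) * x)" "g x = f (exp y) * g (exp (- y) * x)" "1 = f (exp y) * f (exp (- y))"
        unfolding e by (simp_all add: f1)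
      moreover have "f (exp y) \<noteq> 0" using fpos[of "exp y"] by simp
      ultimately show ?thesis by (simp add: field_simps)
    qed
    then show ?thesis by (simp add: S_def)
  qed
  have S_nat: "real n * y \<in> S" if "y \<in> S" for n y
    by (induction n) (auto simp: S0 distrib_right intro: S_add that)
  have S_int: "of_int k * y \<in> S" if "y \<in> S" for k y
  proof (cases "k \<ge> 0")
    case True then show ?thesis using S_nat[OF that, of "nat k"] by simp
  next
    case False then show ?thesis using S_neg[OF S_nat[OF that, of "nat (- k)"]] by simp
  qed
  have S_small: "\<exists>y\<in>S. 0 < y \<and> y < d" if d: "d > 0" for d
  proof -
    have "\<exists>e>0. \<forall>p. \<bar>p - 1\<bar> < e \<longrightarrow> \<bar>ln p\<bar> < d \<and> p > 0"
    proof -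
      have "isCont ln (1::real)" by (rule isCont_ln) simp
      then obtain e where "e > 0" "\<And>p. \<bar>p - 1\<bar> < e \<Longrightarrow> \<bar>ln p\<bar> < d"
        using d unfolding continuous_at_eps_delta dist_real_def by (metis diff_zero ln_one)
      then show ?thesis by (intro exI[of _ "min e 1"]) auto
    qed
    then obtain e where e: "e > 0" "\<And>p. \<bar>p - 1\<bar> < e \<Longrightarrow> \<bar>ln p\<bar> < d" by blast
    obtain p l where p: "p > 0" "p \<noteq> 1" "\<bar>p - 1\<bar> < e" "\<And>x. x > 0 \<Longrightarrow> f (p * x) = l * f x \<and> g (p * x) = l * g x"
      using small[OF e(1)] by blast
    have "f p = l" using p(4)[of 1] by (simp add: f1)
    then have y: "ln p \<in> S" using p by (simp add: S_def)
    have "ln p \<noteq> 0" "\<bar>ln p\<bar> < d" using p e by simp_all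
    then have "0 < ln p \<and> ln p < d \<or> 0 < - ln p \<and> - ln p < d" by linarith
    then show ?thesis using y S_neg[OF y] by blast
  qed
  have S_dense: "\<exists>y\<in>S. \<bar>y - t\<bar> < d" if d: "d > 0" for t d
  proof -
    obtain y where y: "y \<in> S" "0 < y" "y < d" using S_small[OF d] by blast
    define k where "k = \<lfloor>t / y\<rfloor>"
    have "of_int k \<le> t / y" "t / y < of_int k + 1" unfolding k_def by linarith+
    then have "of_int k * y \<le> t" "t < of_int k * y + y" using y(2) by (simp_all add: field_simps)
    then have "\<bar>of_int k * y - t\<bar> < d" using y by simp
    then show ?thesis using S_int[OF y(1)] by blast
  qed
  have cf: "isCont h (exp t * x)" if "strongly_hyperbolic h" "x > 0" for h t x
    using strongly_hyperbolic_continuous[OF that(1)] that(2)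
    by (simp add: continuous_on_eq_continuous_at)
  have cexp: "isCont (\<lambda>t. h (exp t * x)) t" if h: "strongly_hyperbolic h" "x > 0" for h t x
    by (rule isCont_o2[where f = "\<lambda>t. exp t * x"]) (use cf[OF h] in simp_all)
  have S_closed: "t \<in> S" for t
  proof -
    have "h (exp t * x) - f (exp t * 1) * h x = 0" if h: "strongly_hyperbolic h" "x > 0"
      "\<And>y. y \<in> S \<Longrightarrow> h (exp y * x) = f (exp y) * h x" for h x
    proof (rule ccontr)
      assume ne: "h (exp t * x) - f (exp t * 1) * h x \<noteq> 0"
      have c: "isCont (\<lambda>t. h (exp t * x) - f (exp t * 1) * h x) t"
        using cexp[OF h(1,2), of t] cexp[OF f, of 1 t] by (intro continuous_intros) simp_all
      obtain e where e: "e > 0" "\<And>y. dist t y < e \<Longrightarrow> h (exp y * x) - f (exp y * 1) * h x \<noteq> 0"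
        using continuous_at_avoid[OF c, of 0] ne by auto
      obtain y where "y \<in> S" "\<bar>y - t\<bar> < e" using S_dense[OF e(1)] by blast
      then show False using e(2)[of y] h(3)[of y] by (simp add: dist_real_def abs_minus_commute)
    qed
    from this[OF f] this[OF g] show ?thesis by (simp add: S_def)
  qed
  have fm: "f (p * x) = f p * f x" and gm: "g (p * x) = f p * g x" if "p > 0" "x > 0" for p x
    using S_closed[of "ln p"] that by (simp_all add: S_def)
  obtain r where r: "r > 0" "\<And>x. x > 0 \<Longrightarrow> f x = x powr - r"
    using multiplicative_powr[of f, OF fm fpos strongly_hyperbolic_strict_anti[OF f]] by blast
  have "g x = g 1 * x powr - r" if "x > 0" for x using gm[of x 1] r that by simp
  then have "is_power r (g 1) f g" using r(2) unfolding is_power_def by blast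
  then show ?thesis using r(1) gpos[of 1] by (intro exI[of _ r] exI[of _ "g 1"]) simp
qed

lemma hy_minus: "x > 0 \<Longrightarrow> hy f g (- x) = - g x"
  by (simp add: hy_def)

lemma hy_power_scale:
  assumes "is_power r s f g" "t > 0" "y \<noteq> 0"
  shows "hy f g (t * y) = t powr - r * hy f g y"
proof (cases "y > 0")
  case True
  with assms show ?thesis by (simp add: hy_def is_power_def powr_mult)
next
  case False
  then have y: "- y > 0" "\<not> t * y > 0" using assms by (auto simp: zero_less_mult_iff)
  have "g (t * - y) = s * (t * - y) powr - r" using assms y by (simp add: is_power_def mult_pos_neg)
  also have "(t * - y) powr - r = t powr - r * (- y) powr - r" using assms y(1) by (intro powr_mult)
  finally show ?thesis using assms y by (simp add: hy_def is_power_def)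
qed

text \<open>\<open>S\<close> stands for the maps that yield automorphisms when applied to one
  coordinate alone, so that one statement serves both coordinates; e = -1 covers a reflected branch.
  The map X is homogeneous of degree -r for positive factors, so X o X has degree r^2, and being
  linear it forces r = 1.\<close>

lemma power_eq_inversion:
  assumes pw: "is_power r s f g" "r > 0" "s > 0" and e: "e = 1 \<or> e = - 1"
    and mem: "hyp f g \<circ> aff e 0 \<in> S"
    and comp: "\<And>a b. a \<in> S \<Longrightarrow> b \<in> S \<Longrightarrow> a \<circ> b \<in> S" and tr: "\<And>t. aff 1 t \<in> S"
    and stab: "\<And>a. a \<in> S \<Longrightarrow> a None = None \<Longrightarrow> \<exists>p q. a = aff p q"
  shows "r = 1 \<and> s = 1"
proof -
  define X where "X = hyp f g \<circ> aff e 0"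
  define F where "F x = hy f g (e * x)" for x
  have XN: "X None = Some 0" "X (Some 0) = None" by (simp_all add: X_def)
  have X: "X (Some x) = Some (F x)" if "x \<noteq> 0" for x using that e by (auto simp: X_def F_def)
  have XS: "X \<in> S" using mem by (simp add: X_def)
  obtain p q where pq: "X \<circ> X = aff p q" using stab[OF comp[OF XS XS]] XN by auto
  have "(X \<circ> X) (Some 0) = Some q" unfolding pq by simp
  then have q: "q = 0" using XN by simp
  have hne: "hy f g x \<noteq> 0" if "x \<noteq> 0" for x
    using pw that powr_gt_zero[of x "-r"] powr_gt_zero[of "-x" "-r"] by (auto simp: hy_def is_power_def)
  have Fne: "F x \<noteq> 0" if "x \<noteq> 0" for x using hne[of "e * x"] e that by (auto simp: F_def)
  have FF: "F (F x) = p * x" if "x \<noteq> 0" for x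
  proof -
    have "(X \<circ> X) (Some x) = Some (p * x)" unfolding pq using q by simp
    then show ?thesis using X Fne that by simp
  qed
  have Fs: "F (t * x) = t powr - r * F x" if "t > 0" "x \<noteq> 0" for t x
    using hy_power_scale[OF pw(1) that(1), of "e * x"] e that by (auto simp: F_def mult.left_commute)
  have "F (F (2 * 1)) = (2 powr - r) powr - r * F (F 1)"
    unfolding Fs[of 2 1, simplified] by (subst Fs) (simp_all add: Fs Fne)
  then have "p * 2 = 2 powr (r * r) * p" using FF[of 2] FF[of 1] by (simp add: powr_powr)
  moreover have "p \<noteq> 0" using FF[of 1] Fne[of "F 1"] Fne[of 1] by simp
  ultimately have "2 powr (r * r) = 2 powr (1::real)" by simp
  then have "r * r = 1" using powr_inj[of 2 "r * r" 1] by simp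
  then have r: "r = 1" using pw(2) by (metis abs_of_pos power2_eq_square real_sqrt_abs real_sqrt_one)
  have fx: "f x = 1 / x" "g x = s / x" if "x > 0" for x
    using pw(1) that unfolding is_power_def r by (simp_all add: powr_minus_divide)
  have "s = 1" using e
  proof
    assume e1: "e = 1"
    have F: "F x = (if x > 0 then 1 / x else s / x)" if "x \<noteq> 0" for x
      using that fx[of x] fx[of "- x"] by (auto simp: F_def e1 hy_def)
    \<comment> \<open>For r = 1 and e = 1 the square of X is the identity whatever s is, so a longer
      word is needed. Y sends infinity through 0, 1, 1, 0 back to infinity; three of its values
      overdetermine an affine map and leave (2 s + 1) (s - 1) = 0.\<close>
    define Y where "Y = X \<circ> aff 1 (-1) \<circ> X \<circ> aff 1 1 \<circ> X"
    have "Y \<in> S" unfolding Y_def by (intro comp XS tr)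
    moreover have "Y None = None" unfolding Y_def using X[of 1] F[of 1] XN by simp
    ultimately obtain u v where uv: "Y = aff u v" using stab by blast
    have "Y (Some 1) = Some (- 2 * s)" unfolding Y_def by (simp add: X F)
    moreover have "Y (Some 2) = Some (- 3 * s)" unfolding Y_def by (simp add: X F)
    moreover have "Y (Some (- 2 * s)) = Some 1" unfolding Y_def using pw(3) by (simp add: X F)
    ultimately have "u + v = - 2 * s" "2 * u + v = - 3 * s" "u * (- 2 * s) + v = 1" unfolding uv by simp_all
    then have "u = - s" "v = - s" "u * (- 2 * s) + v = 1" by linarith+
    then have "(2 * s + 1) * (s - 1) = 0" by (simp add: algebra_simps)
    then show "s = 1" using pw(3) by simp
  next
    assume e1: "e = - 1"
    have F: "F x = (if x > 0 then - s / x else - 1 / x)" if "x \<noteq> 0" for x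
      using that fx[of x] fx[of "- x"] by (auto simp: F_def e1 hy_def)
    \<comment> \<open>On a reflected branch X exchanges the two half-lines, so the square sees s:
      its slope is 1 / s at 1 and s at -1.\<close>
    have "p = 1 / s" "- p = - s" using FF[of 1] FF[of "-1"] F[of 1] F[of "-1"] F[of "-s"] pw(3) by simp_all
    then have "s * s = 1" using pw(3) by (simp add: field_simps)
    then show "s = 1" using pw(3) by (metis abs_of_pos power2_eq_square real_sqrt_abs real_sqrt_one)
  qed
  with r show ?thesis by simp
qed

context hyperbola_plane
begin

lemma H_None_0:
  assumes "h \<in> H" "h None = Some 0" "h (Some 0) = None"
  shows "\<exists>a>0. h = aff a 0 \<circ> hyp f1 f2 \<or> h = aff a 0 \<circ> hyp f3 f4 \<circ> aff (-1) 0"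
  using assms(1)
proof (rule H_cases)
  fix a b c assume h: "a > 0" "h = aff a c \<circ> hyp f1 f2 \<circ> aff 1 b"
  with assms(2,3) have "c = 0" "b = 0" by (auto simp: hyp_def split: if_splits)
  with h show ?thesis by auto
next
  fix a b c assume h: "a > 0" "h = aff a c \<circ> hyp f3 f4 \<circ> aff (-1) b"
  with assms(2,3) have "c = 0" "b = 0" by (auto simp: hyp_def split: if_splits)
  with h show ?thesis by auto
qed (use assms(2) in auto)

lemma second_stabilizer:
  assumes "map_prod id b \<in> Aut" "b None = None"
  shows "\<exists>p q. b = aff p q"
proof (rule pair_stabilizer[of id b])
  show "map_prod id b \<in> Aut \<or> map_prod id b \<circ> prod.swap \<in> Aut" using assms by simp
qed (use assms pair_bij in auto)

lemma first_stabilizer: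
  assumes "map_prod a id \<in> Aut" "a None = None"
  shows "\<exists>p q. p \<noteq> 0 \<and> a = aff p q"
proof (rule pair_stabilizer[of a id])
  show "map_prod a id \<in> Aut \<or> map_prod a id \<circ> prod.swap \<in> Aut" using assms by simp
qed (use assms pair_bij in auto)

lemma second_comp: "map_prod id b \<in> Aut \<Longrightarrow> map_prod id b' \<in> Aut \<Longrightarrow> map_prod id (b \<circ> b') \<in> Aut"
  using pair_comp[of id b id b'] by simp

lemma second_aff: "r > 0 \<Longrightarrow> map_prod id (aff r s) \<in> Aut"
  using translation_Aut[of r 0 s] by simp

lemma first_comp: "map_prod a id \<in> Aut \<Longrightarrow> map_prod a' id \<in> Aut \<Longrightarrow> map_prod (a \<circ> a') id \<in> Aut"
  using pair_comp[of a id a' id] by simp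

lemma first_aff: "map_prod (aff 1 s) id \<in> Aut"
  using translation_Aut[of 1 s 0] by simp

lemma bij_moves_None:
  assumes "bij a" "a None \<noteq> None"
  obtains u v where "a None = Some u" "a (Some v) = None"
proof -
  obtain z where z: "a z = None" using bij_is_surj[OF assms(1)] unfolding surj_def by metis
  with assms(2) obtain v where "z = Some v" by (cases z) auto
  with z assms(2) that show thesis by auto
qed

text \<open>Composing the translated map, which exchanges 0 and infinity, with the line of slope s
  gives a circle through the same two points, hence a scaled branch. Slopes s > 0 yield the scaling
  law of the pair of functions occurring in X; slope -1 identifies the other pair with it up to a
  factor, and the normalization at 1 makes that factor 1.\<close>

lemma second_moves:
  assumes "map_prod id b \<in> Aut" "b None \<noteq> None"
  shows "is_power 1 1 f1 f2 \<and> is_power 1 1 f3 f4"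
proof -
  obtain u v where uv: "b None = Some u" "b (Some v) = None"
    using bij_moves_None[OF pair_bij(2)[OF assms(1)] assms(2)] by blast
  define b' where "b' = aff 1 (- u) \<circ> b \<circ> aff 1 v"
  have b': "map_prod id b' \<in> Aut" unfolding b'_def by (intro second_comp second_aff assms) simp_all
  have b'N: "b' None = Some 0" "b' (Some 0) = None" using uv by (simp_all add: b'_def)
  have line: "\<exists>a>0. c \<circ> aff s 0 = aff a 0 \<circ> hyp f1 f2 \<or> c \<circ> aff s 0 = aff a 0 \<circ> hyp f3 f4 \<circ> aff (-1) 0"
    if "map_prod id c \<in> Aut" "c None = Some 0" "c (Some 0) = None" "s \<noteq> 0" for c s
    using pair_H[OF that(1) H_line[OF that(4)], of 0] that by (intro H_None_0) simp_all
  obtain a where a: "a > 0" "b' = aff a 0 \<circ> hyp f1 f2 \<or> b' = aff a 0 \<circ> hyp f3 f4 \<circ> aff (-1) 0"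
    using line[OF b' b'N, of 1] by auto
  define X where "X = aff (1 / a) 0 \<circ> b'"
  have X: "map_prod id X \<in> Aut" unfolding X_def using a(1) b' by (intro second_comp second_aff) simp_all
  have XN: "X None = Some 0" "X (Some 0) = None" using b'N by (simp_all add: X_def)
  have X2: "X = hyp f1 f2 \<or> X = hyp f3 f4 \<circ> aff (-1) 0"
    using a unfolding X_def by (auto simp: fun_eq_iff)
  note lineX = line[OF X XN]
  have inv: "r = 1 \<and> s = 1" if "is_power r s f g" "r > 0" "s > 0" "e = 1 \<or> e = - 1" "hyp f g \<circ> aff e 0 = X" for r s f g e
    using power_eq_inversion[OF that(1-4), of "{c. map_prod id c \<in> Aut}"] that(5) X second_comp second_aff[of 1] second_stabilizer
    by simp
  have pos: "hy f1 f2 t > 0 \<longleftrightarrow> t > 0" "hy f3 f4 t > 0 \<longleftrightarrow> t > 0" if "t \<noteq> 0" for t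
    using that by (simp_all add: hy_pos_iff f1 f2 f3 f4)
  show ?thesis using X2
  proof
    assume XE: "X = hyp f1 f2"
    have sc: "\<exists>l. \<forall>x>0. f1 (s * x) = l * f1 x \<and> f2 (s * x) = l * f2 x" if s: "s > 0" for s
    proof -
      obtain a where a: "a > 0" "X \<circ> aff s 0 = aff a 0 \<circ> hyp f1 f2 \<or> X \<circ> aff s 0 = aff a 0 \<circ> hyp f3 f4 \<circ> aff (-1) 0"
        using lineX[of s] s by auto
      \<comment> \<open>\<open>hy\<close> has the sign of its argument, so a branch of the other
        family has the wrong sign at 1.\<close>
      have "\<not> X \<circ> aff s 0 = aff a 0 \<circ> hyp f3 f4 \<circ> aff (-1) 0"
      proof
        assume "X \<circ> aff s 0 = aff a 0 \<circ> hyp f3 f4 \<circ> aff (-1) 0"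
        from fun_cong[OF this, of "Some 1"] have "hy f1 f2 s = a * hy f3 f4 (- 1)" using s by (simp add: XE)
        then show False using pos[of s] pos[of "-1"] s a(1) by (metis less_irrefl neg_less_0_iff_less zero_less_mult_iff zero_less_one neg_0_equal_iff_equal not_less_iff_gr_or_eq)
      qed
      then have h: "hyp f1 f2 \<circ> aff s 0 = aff a 0 \<circ> hyp f1 f2" using a(2) XE by simp
      have "f1 (s * x) = a * f1 x \<and> f2 (s * x) = a * f2 x" if "x > 0" for x
        using fun_cong[OF h, of "Some x"] fun_cong[OF h, of "Some (- x)"] that s mult_pos_pos[OF s that]
        by (simp add: hy_pos hy_minus)
      then show ?thesis by blast
    qed
    have "\<exists>p>0. p \<noteq> 1 \<and> \<bar>p - 1\<bar> < d \<and> (\<exists>l. \<forall>x>0. f1 (p * x) = l * f1 x \<and> f2 (p * x) = l * f2 x)" if "d > 0" for d :: real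
      using sc[of "1 + d / 2"] that by (intro exI[of _ "1 + d / 2"]) simp
    then obtain r s where rs: "r > 0" "s > 0" "is_power r s f1 f2"
      using is_power_of_small_scalings[OF f1 f2 f1_1] by blast
    obtain a where a: "a > 0" "X \<circ> aff (-1) 0 = aff a 0 \<circ> hyp f1 f2 \<or> X \<circ> aff (-1) 0 = aff a 0 \<circ> hyp f3 f4 \<circ> aff (-1) 0"
      using lineX[of "-1"] by auto
    have "\<not> X \<circ> aff (-1) 0 = aff a 0 \<circ> hyp f1 f2"
    proof
      assume "X \<circ> aff (-1) 0 = aff a 0 \<circ> hyp f1 f2"
      from fun_cong[OF this, of "Some 1"] have "hy f1 f2 (-1) = a * hy f1 f2 1" by (simp add: XE)
      then show False using pos[of 1] pos[of "-1"] a(1) by (simp add: zero_less_mult_iff)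
    qed
    then have h: "hyp f1 f2 \<circ> aff (-1) 0 = aff a 0 \<circ> hyp f3 f4 \<circ> aff (-1) 0" using a(2) XE by simp
    have e: "f1 x = a * f3 x \<and> f2 x = a * f4 x" if "x > 0" for x
      using fun_cong[OF h, of "Some x"] fun_cong[OF h, of "Some (- x)"] that by (simp add: hy_pos hy_minus)
    then have "a = 1" using e[of 1] f1_1 f3_1 by simp
    with e rs have rs': "is_power r s f3 f4" by (simp add: is_power_def)
    have "r = 1 \<and> s = 1" using inv[OF rs(3,1,2), of 1] XE by simp
    with rs rs' show ?thesis by simp
  next
    assume XE: "X = hyp f3 f4 \<circ> aff (-1) 0"
    have sc: "\<exists>l. \<forall>x>0. f3 (s * x) = l * f3 x \<and> f4 (s * x) = l * f4 x" if s: "s > 0" for s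
    proof -
      obtain a where a: "a > 0" "X \<circ> aff s 0 = aff a 0 \<circ> hyp f1 f2 \<or> X \<circ> aff s 0 = aff a 0 \<circ> hyp f3 f4 \<circ> aff (-1) 0"
        using lineX[of s] s by auto
      have "\<not> X \<circ> aff s 0 = aff a 0 \<circ> hyp f1 f2"
      proof
        assume "X \<circ> aff s 0 = aff a 0 \<circ> hyp f1 f2"
        from fun_cong[OF this, of "Some (-1)"] have "hy f3 f4 s = a * hy f1 f2 (- 1)" using s by (simp add: XE)
        then show False using pos[of s] pos[of "-1"] s a(1) by (simp add: zero_less_mult_iff)
      qed
      then have h: "hyp f3 f4 \<circ> aff (- s) 0 = aff a 0 \<circ> hyp f3 f4 \<circ> aff (-1) 0" using a(2) XE by (simp add: o_assoc[symmetric])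
      have "f3 (s * x) = a * f3 x \<and> f4 (s * x) = a * f4 x" if "x > 0" for x
        using fun_cong[OF h, of "Some x"] fun_cong[OF h, of "Some (- x)"] that s mult_pos_pos[OF s that]
        by (simp add: hy_pos hy_minus)
      then show ?thesis by blast
    qed
    have "\<exists>p>0. p \<noteq> 1 \<and> \<bar>p - 1\<bar> < d \<and> (\<exists>l. \<forall>x>0. f3 (p * x) = l * f3 x \<and> f4 (p * x) = l * f4 x)" if "d > 0" for d :: real
      using sc[of "1 + d / 2"] that by (intro exI[of _ "1 + d / 2"]) simp
    then obtain r s where rs: "r > 0" "s > 0" "is_power r s f3 f4"
      using is_power_of_small_scalings[OF f3 f4 f3_1] by blast
    obtain a where a: "a > 0" "X \<circ> aff (-1) 0 = aff a 0 \<circ> hyp f1 f2 \<or> X \<circ> aff (-1) 0 = aff a 0 \<circ> hyp f3 f4 \<circ> aff (-1) 0"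
      using lineX[of "-1"] by auto
    have "\<not> X \<circ> aff (-1) 0 = aff a 0 \<circ> hyp f3 f4 \<circ> aff (-1) 0"
    proof
      assume "X \<circ> aff (-1) 0 = aff a 0 \<circ> hyp f3 f4 \<circ> aff (-1) 0"
      from fun_cong[OF this, of "Some 1"] have "hy f3 f4 1 = a * hy f3 f4 (- 1)" by (simp add: XE)
      then show False using pos[of 1] pos[of "-1"] a(1) by (simp add: zero_less_mult_iff)
    qed
    then have h: "hyp f3 f4 = aff a 0 \<circ> hyp f1 f2" using a(2) XE by (simp add: o_assoc[symmetric])
    have e: "f3 x = a * f1 x \<and> f4 x = a * f2 x" if "x > 0" for x
      using fun_cong[OF h, of "Some x"] fun_cong[OF h, of "Some (- x)"] that by (simp add: hy_pos hy_minus)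
    then have "a = 1" using e[of 1] f1_1 f3_1 by simp
    with e rs have rs': "is_power r s f1 f2" by (simp add: is_power_def)
    have "r = 1 \<and> s = 1" using inv[OF rs(3,1,2), of "-1"] XE by simp
    with rs rs' show ?thesis by simp
  qed
qed

end

text \<open>Negating the values interchanges the two branches; this handles a negative factor k in
  \<open>first_moves\<close>.\<close>

lemma neg_hyp: "aff (-1) 0 \<circ> hyp f g = hyp g f \<circ> aff (-1) 0"
proof
  fix z show "(aff (-1) 0 \<circ> hyp f g) z = (hyp g f \<circ> aff (-1) 0) z"
  proof (cases z)
    case (Some x)
    then show ?thesis by (cases "x = 0") (auto simp: hy_def)
  qed simp
qed

lemma aff_hyp: "aff a 0 \<circ> hyp f g = hyp (\<lambda>x. a * f x) (\<lambda>x. a * g x)"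
proof
  fix z show "(aff a 0 \<circ> hyp f g) z = hyp (\<lambda>x. a * f x) (\<lambda>x. a * g x) z"
  proof (cases z)
    case (Some x)
    then show ?thesis by (cases "x = 0") (auto simp: hy_def)
  qed simp
qed

lemma hyp_aff_power:
  assumes "is_power r s f g" "y > 0"
  shows "hyp f g \<circ> aff y 0 = aff (y powr - r) 0 \<circ> hyp f g"
proof
  fix z show "(hyp f g \<circ> aff y 0) z = (aff (y powr - r) 0 \<circ> hyp f g) z"
  proof (cases z)
    case (Some x)
    then show ?thesis using assms hy_power_scale[OF assms] by (cases "x = 0") simp_all
  qed simp
qed

section \<open>Scalings of the first coordinate\<close>

context hyperbola_plane
begin

text \<open>For a power function a scaling of the argument equals a scaling of the value, which the
  circle parameter a absorbs.\<close>

lemma scaling_Aut: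
  assumes "is_power r s f1 f2" "is_power r' s' f3 f4" "y > 0"
  shows "map_prod (aff y 0) id \<in> Aut"
proof -
  have "h \<circ> aff y 0 \<in> H" if "h \<in> H" "y > 0" for h y
    using that(1)
  proof (rule H_cases)
    fix a b c assume h: "a > 0" "h = aff a c \<circ> hyp f1 f2 \<circ> aff 1 b"
    have "h \<circ> aff y 0 = aff a c \<circ> (hyp f1 f2 \<circ> aff y 0) \<circ> aff 1 (b / y)"
      using h that(2) by (simp add: o_assoc[symmetric])
    also have "\<dots> = aff (a * y powr - r) c \<circ> hyp f1 f2 \<circ> aff 1 (b / y)"
      unfolding hyp_aff_power[OF assms(1) that(2)] by (simp add: o_assoc)
    finally show ?thesis using H_minus h that(2) by simp
  next
    fix a b c assume h: "a > 0" "h = aff a c \<circ> hyp f3 f4 \<circ> aff (-1) b"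
    have "h \<circ> aff y 0 = aff a c \<circ> (hyp f3 f4 \<circ> aff y 0) \<circ> aff (-1) (b / y)"
      using h that(2) by (simp add: o_assoc[symmetric])
    also have "\<dots> = aff (a * y powr - r') c \<circ> hyp f3 f4 \<circ> aff (-1) (b / y)"
      unfolding hyp_aff_power[OF assms(2) that(2)] by (simp add: o_assoc)
    finally show ?thesis using H_plus h that(2) by simp
  next
    fix s t assume "s \<noteq> 0" "h = aff s t"
    then show ?thesis using that(2) by (simp add: H_line)
  qed
  from this[of _ y] this[of _ "1 / y"] show ?thesis using assms(3)
    by (intro pairI) (simp_all add: bij_aff inv_aff)
qed

lemma hy_signs:
  assumes "t > 0"
  shows "hy f1 f2 t > 0" "hy f3 f4 t > 0" "hy f1 f2 (- t) < 0" "hy f3 f4 (- t) < 0"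
  using assms strongly_hyperbolic_pos f1 f2 f3 f4 by (simp_all add: hy_pos hy_minus)

text \<open>Precomposing the basic branch with the scaling gives a circle through (infinity, 0) and
  (0, infinity) again; a sign at 1 excludes the other family.\<close>

lemma scaling_AutD:
  assumes "map_prod (aff y 0) id \<in> Aut" "y > 0"
  shows "\<exists>l. \<forall>x>0. f1 (y * x) = l * f1 x \<and> f2 (y * x) = l * f2 x"
    and "\<exists>l. \<forall>x>0. f3 (y * x) = l * f3 x \<and> f4 (y * x) = l * f4 x"
proof -
  have h: "hyp f1 f2 \<circ> aff y 0 \<in> H"
    using pair_H_inv[OF assms(1) H_minus[of 1 0 0]] by simp
  obtain a where a: "a > 0"
    "hyp f1 f2 \<circ> aff y 0 = aff a 0 \<circ> hyp f1 f2 \<or> hyp f1 f2 \<circ> aff y 0 = aff a 0 \<circ> hyp f3 f4 \<circ> aff (-1) 0"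
    using H_None_0[OF h] by auto
  have "hyp f1 f2 \<circ> aff y 0 \<noteq> aff a 0 \<circ> hyp f3 f4 \<circ> aff (-1) 0"
  proof
    assume "hyp f1 f2 \<circ> aff y 0 = aff a 0 \<circ> hyp f3 f4 \<circ> aff (-1) 0"
    from fun_cong[OF this, of "Some 1"] have "hy f1 f2 y = a * hy f3 f4 (- 1)" using assms(2) by simp
    then show False using hy_signs(1)[OF assms(2)] mult_pos_neg[OF a(1) hy_signs(4)[of 1]] by simp
  qed
  with a have h: "hyp f1 f2 \<circ> aff y 0 = aff a 0 \<circ> hyp f1 f2" by simp
  have "f1 (y * x) = a * f1 x \<and> f2 (y * x) = a * f2 x" if "x > 0" for x
    using fun_cong[OF h, of "Some x"] fun_cong[OF h, of "Some (- x)"] that assms(2) mult_pos_pos[OF assms(2) that]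
    by (simp add: hy_pos hy_minus)
  then show "\<exists>l. \<forall>x>0. f1 (y * x) = l * f1 x \<and> f2 (y * x) = l * f2 x" by blast
next
  have h: "hyp f3 f4 \<circ> aff (- y) 0 \<in> H"
    using pair_H_inv[OF assms(1) H_plus[of 1 0 0]] by (simp add: o_assoc[symmetric])
  obtain a where a: "a > 0"
    "hyp f3 f4 \<circ> aff (- y) 0 = aff a 0 \<circ> hyp f1 f2 \<or> hyp f3 f4 \<circ> aff (- y) 0 = aff a 0 \<circ> hyp f3 f4 \<circ> aff (-1) 0"
    using H_None_0[OF h] by auto
  have "hyp f3 f4 \<circ> aff (- y) 0 \<noteq> aff a 0 \<circ> hyp f1 f2"
  proof
    assume "hyp f3 f4 \<circ> aff (- y) 0 = aff a 0 \<circ> hyp f1 f2"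
    from fun_cong[OF this, of "Some 1"] have "hy f3 f4 (- y) = a * hy f1 f2 1" using assms(2) by simp
    then show False using hy_signs(4)[OF assms(2)] mult_pos_pos[OF a(1) hy_signs(1)[of 1]] by simp
  qed
  with a have h: "hyp f3 f4 \<circ> aff (- y) 0 = aff a 0 \<circ> hyp f3 f4 \<circ> aff (-1) 0" by simp
  have "f3 (y * x) = a * f3 x \<and> f4 (y * x) = a * f4 x" if "x > 0" for x
    using fun_cong[OF h, of "Some x"] fun_cong[OF h, of "Some (- x)"] that assms(2) mult_pos_pos[OF assms(2) that]
    by (simp add: hy_pos hy_minus)
  then show "\<exists>l. \<forall>x>0. f3 (y * x) = l * f3 x \<and> f4 (y * x) = l * f4 x" by blast
qed

lemma is_power_of_small_Aut:
  assumes "\<And>e. e > 0 \<Longrightarrow> \<exists>p>0. p \<noteq> 1 \<and> \<bar>p - 1\<bar> < e \<and> map_prod (aff p 0) id \<in> Aut"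
  shows "\<exists>r s. r > 0 \<and> s > 0 \<and> is_power r s f1 f2" "\<exists>r s. r > 0 \<and> s > 0 \<and> is_power r s f3 f4"
proof -
  have "\<exists>p>0. p \<noteq> 1 \<and> \<bar>p - 1\<bar> < e \<and> (\<exists>l. \<forall>x>0. f1 (p * x) = l * f1 x \<and> f2 (p * x) = l * f2 x)"
    "\<exists>p>0. p \<noteq> 1 \<and> \<bar>p - 1\<bar> < e \<and> (\<exists>l. \<forall>x>0. f3 (p * x) = l * f3 x \<and> f4 (p * x) = l * f4 x)" if "e > 0" for e
    using assms[OF that] scaling_AutD by metis+
  then show "\<exists>r s. r > 0 \<and> s > 0 \<and> is_power r s f1 f2" "\<exists>r s. r > 0 \<and> s > 0 \<and> is_power r s f3 f4"
    using is_power_of_small_scalings[OF f1 f2 f1_1] is_power_of_small_scalings[OF f3 f4 f3_1] by blast+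
qed

lemma first_moves:
  assumes "map_prod a id \<in> Aut" "a None \<noteq> None"
  shows "is_power 1 1 f1 f2 \<and> is_power 1 1 f3 f4"
proof -
  obtain u v where uv: "a None = Some u" "a (Some v) = None"
    using bij_moves_None[OF pair_bij(1)[OF assms(1)] assms(2)] by blast
  define X where "X = aff 1 (- u) \<circ> a \<circ> aff 1 v"
  have X: "map_prod X id \<in> Aut" unfolding X_def by (intro first_comp first_aff assms(1))
  have XN: "X None = Some 0" "X (Some 0) = None" using uv by (simp_all add: X_def)
  have bX: "bij X" by (rule pair_bij(1)[OF X])
  have XH: "h \<circ> X \<in> H" if "h \<in> H" for h using pair_H_inv[OF X that] by simp
  define F where "F = hy f1 f2"
  \<comment> \<open>The composite fixes infinity and 0, so it is a line through the origin. Thus X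
    is the inverse of the basic branch up to scaling.\<close>
  obtain k where k: "k \<noteq> 0" "hyp f1 f2 \<circ> X = aff k 0"
  proof -
    have h: "hyp f1 f2 \<circ> X \<in> H" using XH[OF H_minus[of 1 0 0]] by simp
    have "(hyp f1 f2 \<circ> X) None = None" using XN by simp
    then obtain k t where kt: "k \<noteq> 0" "hyp f1 f2 \<circ> X = aff k t" using H_None_None[OF h] by blast
    have "(hyp f1 f2 \<circ> X) (Some 0) = Some t" unfolding kt by simp
    then have "t = 0" using XN by simp
    then show thesis using kt that by blast
  qed
  obtain k' where k': "k' \<noteq> 0" "hyp f3 f4 \<circ> aff (-1) 0 \<circ> X = aff k' 0"
  proof -
    have h: "hyp f3 f4 \<circ> aff (-1) 0 \<circ> X \<in> H" using XH[OF H_plus[of 1 0 0]] by simp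
    have "(hyp f3 f4 \<circ> aff (-1) 0 \<circ> X) None = None" using XN by simp
    then obtain k t where kt: "k \<noteq> 0" "hyp f3 f4 \<circ> aff (-1) 0 \<circ> X = aff k t" using H_None_None[OF h] by blast
    have "(hyp f3 f4 \<circ> aff (-1) 0 \<circ> X) (Some 0) = Some t" unfolding kt by simp
    then have "t = 0" using XN by simp
    then show thesis using kt that by blast
  qed
  obtain p where p: "p \<noteq> 0" "X \<circ> X = aff p 0"
  proof -
    have "(X \<circ> X) None = None" using XN by simp
    then obtain p t where pt: "p \<noteq> 0" "X \<circ> X = aff p t" using first_stabilizer[OF first_comp[OF X X]] by blast
    have "(X \<circ> X) (Some 0) = Some t" unfolding pt by simp
    then have "t = 0" using XN by simp
    then show thesis using pt that by blast
  qed
  have Fne: "F x \<noteq> 0" if "x \<noteq> 0" for x using that hy_nonzero[OF f1 f2] by (simp add: F_def)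
  \<comment> \<open>The relation E o X = k is applied at X z. As X o X is multiplication by p, it
    gives X x = E (p x) / k, a formula free of inverse functions, from which continuity and limits
    can be read off.\<close>
  define A where "A x = F (p * x) / k" for x
  have Ane: "A x \<noteq> 0" if "x \<noteq> 0" for x using that Fne p(1) k(1) by (simp add: A_def)
  have EX: "hyp f1 f2 (X z) = aff k 0 z" and XX: "X (X z) = aff p 0 z" for z
    using fun_cong[OF k(2), of z] fun_cong[OF p(2), of z] by simp_all
  have XA: "X (Some x) = Some (A x)" if "x \<noteq> 0" for x
  proof -
    have "aff k 0 (X (Some x)) = Some (F (p * x))"
      using EX[of "X (Some x)"] XX[of "Some x"] that p(1) by (simp add: F_def)
    then show ?thesis using k(1) by (cases "X (Some x)") (auto simp: A_def field_simps)
  qed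
  have AA: "A (A x) = p * x" if "x \<noteq> 0" for x using XX[of "Some x"] XA that Ane by simp
  have Ap: "A (p * x) = p * A x" if "x \<noteq> 0" for x using AA[OF Ane[OF that]] AA[OF that] by simp
  have Adiv: "A (A x / p) = x" if "x \<noteq> 0" for x
    using Ap[of "A x / p"] AA[OF that] Ane[OF that] p(1) by simp
  have Ainj: "x = y" if "A x = A y" "x \<noteq> 0" "y \<noteq> 0" for x y
    using Adiv that by metis
  have Acont: "continuous_on (- {0}) A"
    unfolding A_def F_def
    by (intro continuous_intros continuous_on_compose2[OF continuous_on_hy[OF f1 f2]]) (use p(1) k(1) in auto)
  have A_inf: "(A \<longlongrightarrow> 0) at_infinity"
  proof -
    have "filterlim (\<lambda>x. p * x) at_infinity at_infinity"
      using p(1) by (intro tendsto_mult_filterlim_at_infinity[where c = p] tendsto_const filterlim_ident)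
    then have "((\<lambda>x. F (p * x)) \<longlongrightarrow> 0) at_infinity"
      unfolding F_def by (rule filterlim_compose[OF hy_tendsto_0[OF f1 f2]])
    then have "((\<lambda>x. F (p * x) / k) \<longlongrightarrow> 0 / k) at_infinity" by (intro tendsto_divide tendsto_const k(1))
    then show ?thesis unfolding A_def by simp
  qed
  have A_0: "filterlim (\<lambda>b. A (- b)) at_infinity (at_right 0)"
  proof -
    have "filterlim (\<lambda>b. p * - b) (at 0) (at_right 0)"
      unfolding filterlim_at
    proof
      show "\<forall>\<^sub>F b in at_right 0. p * - b \<in> UNIV \<and> p * - b \<noteq> 0"
        using eventually_at_right_less[of 0] by eventually_elim (use p(1) in simp)
      show "((\<lambda>b. p * - b) \<longlongrightarrow> 0) (at_right 0)"
        by (rule tendsto_eq_intros refl tendsto_ident_at)+ simp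
    qed
    then have "filterlim (\<lambda>b. F (p * - b)) at_infinity (at_right 0)"
      unfolding F_def by (rule filterlim_compose[OF hy_left_0[OF f1 f2]])
    then have "filterlim (\<lambda>b. 1 / k * F (p * - b)) at_infinity (at_right 0)"
      using k(1) by (intro tendsto_mult_filterlim_at_infinity[where c = "1 / k"] tendsto_const) simp_all
    then show ?thesis unfolding A_def by simp
  qed
  define d where "d b = X \<circ> aff 1 (- A b) \<circ> X \<circ> aff 1 b \<circ> X" for b
  \<comment> \<open>The slope of \<open>d b\<close>, computed from its value A (- A b) at 0 and its
    zero at A (- b) / p.\<close>
  define q where "q b = - p * A (- A b) / A (- b)" for b
  have dAut: "map_prod (d b) id \<in> Aut" for b unfolding d_def by (intro first_comp first_aff X)
  have d: "d b = aff (q b) (A (- A b))" "q b \<noteq> 0" if b: "b > 0" for b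
  proof -
    have bn: "b \<noteq> 0" "- b \<noteq> 0" "A b \<noteq> 0" "- A b \<noteq> 0" "A (- b) \<noteq> 0" "A (- A b) \<noteq> 0" using b Ane by simp_all
    have "d b None = None" unfolding d_def using XN XA[OF bn(1)] by simp
    then obtain s t where st: "s \<noteq> 0" "d b = aff s t" using first_stabilizer[OF dAut] by blast
    have "d b (Some 0) = Some (A (- A b))" unfolding d_def using XN XA[OF bn(4)] by simp
    then have t: "t = A (- A b)" unfolding st by simp
    have "X (Some (A (- b) / p)) = Some (- b)" using XA[of "A (- b) / p"] Adiv[OF bn(2)] bn p(1) by simp
    then have "d b (Some (A (- b) / p)) = Some 0" unfolding d_def using XN by simp
    then have "s * (A (- b) / p) = - A (- A b)" unfolding st t by simp
    then have "s = q b" unfolding q_def using bn p(1) by (simp add: field_simps)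
    with st t show "d b = aff (q b) (A (- A b))" "q b \<noteq> 0" by simp_all
  qed
  \<comment> \<open>\<open>d b\<close> is evaluated at A i / p, the preimage of i under X. Applying
    A once more removes the outer A, because A o A is multiplication by p.\<close>
  have d_eq: "A (q b * (A i / p) + A (- A b)) = p * (A (i + b) - A b)" if "b > 0" "i > 0" for b i
  proof -
    have n: "i \<noteq> 0" "i + b \<noteq> 0" "b \<noteq> 0" "A i / p \<noteq> 0" using that Ane[of i] p(1) by simp_all
    have "A (i + b) \<noteq> A b" using Ainj[of "i + b" b] n that by auto
    then have nz: "A (i + b) - A b \<noteq> 0" by simp
    have "X (Some (A i / p)) = Some i" using XA[OF n(4)] Adiv[OF n(1)] by simp
    then have "d b (Some (A i / p)) = Some (A (A (i + b) - A b))"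
      unfolding d_def using XA[OF n(2)] XA[OF nz] by simp
    then have "q b * (A i / p) + A (- A b) = A (A (i + b) - A b)" unfolding d(1)[OF that(1)] by simp
    then show ?thesis using AA[OF nz] by simp
  qed
  \<comment> \<open>With constant slope, the argument of A on the left of \<open>d_eq\<close> is a
    constant plus a nonzero multiple of A (- b). It tends to infinity as b tends to 0, so A (i + b)
    - A b tends to 0 for every i > 0. Subtracting the cases i = 1 and i = 2 removes the unbounded
    term A b and gives A 1 = A 2.\<close>
  have "\<exists>b1>0. \<exists>b2>0. q b1 \<noteq> q b2"
  proof (rule ccontr)
    assume "\<not> ?thesis"
    then have qc: "q b = q 1" if "b > 0" for b using that zero_less_one by blast
    have lim0: "((\<lambda>b. p * (A (i + b) - A b)) \<longlongrightarrow> 0) (at_right 0)" if i: "i > 0" for i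
    proof -
      have "filterlim (\<lambda>b. - q 1 / p * A (- b)) at_infinity (at_right 0)"
        using d(2)[of 1] p(1) by (intro tendsto_mult_filterlim_at_infinity[where c = "- q 1 / p"] tendsto_const A_0) simp_all
      then have "filterlim (\<lambda>b. q 1 * (A i / p) + - q 1 / p * A (- b)) at_infinity (at_right 0)"
        by (intro tendsto_add_filterlim_at_infinity[where c = "q 1 * (A i / p)"] tendsto_const)
      then have "((\<lambda>b. A (q 1 * (A i / p) + - q 1 / p * A (- b))) \<longlongrightarrow> 0) (at_right 0)"
        by (rule filterlim_compose[OF A_inf])
      moreover have "\<forall>\<^sub>F b in at_right 0. A (q 1 * (A i / p) + - q 1 / p * A (- b)) = p * (A (i + b) - A b)"
        using eventually_at_right_less[of 0]
      proof eventually_elim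
        case (elim b)
        then have "- q 1 / p * A (- b) = A (- A b)"
          using qc[of b] Ane[of "- b"] p(1) unfolding q_def[of b] by (simp add: field_simps)
        then show ?case using d_eq[of b i] elim i qc[of b] by simp
      qed
      ultimately show ?thesis by (rule Lim_transform_eventually)
    qed
    have Ac: "((\<lambda>b. A (i + b)) \<longlongrightarrow> A i) (at_right 0)" if "i > 0" for i
    proof -
      have "isCont A i" using Acont that by (simp add: continuous_on_eq_continuous_at open_Compl)
      moreover have "((\<lambda>b. i + b) \<longlongrightarrow> i) (at_right 0)"
        by (rule tendsto_eq_intros refl tendsto_ident_at)+ simp
      ultimately show ?thesis by (rule isCont_tendsto_compose)
    qed
    have "((\<lambda>b. p * (A (1 + b) - A b) - p * (A (2 + b) - A b)) \<longlongrightarrow> 0 - 0) (at_right 0)"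
      by (intro tendsto_diff lim0) simp_all
    then have "((\<lambda>b. p * (A (1 + b) - A (2 + b))) \<longlongrightarrow> 0) (at_right 0)" by (simp add: algebra_simps)
    moreover have "((\<lambda>b. p * (A (1 + b) - A (2 + b))) \<longlongrightarrow> p * (A 1 - A 2)) (at_right 0)"
      by (intro tendsto_mult tendsto_const tendsto_diff Ac) simp_all
    ultimately have "p * (A 1 - A 2) = 0" by (intro tendsto_unique[of "at_right 0"]) simp_all
    then show False using Ainj[of 1 2] p(1) by simp
  qed
  then obtain b1 b2 where b12: "b1 > 0" "b2 > 0" "q b1 \<noteq> q b2" by blast
  have qcont: "continuous_on {0<..} q"
    unfolding q_def
  proof (intro continuous_intros)
    show "continuous_on {0<..} (\<lambda>b. A (- b))"
      by (rule continuous_on_compose2[OF Acont]) (auto intro!: continuous_intros)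
    have Ap: "continuous_on {0<..} A" by (rule continuous_on_subset[OF Acont]) auto
    show "continuous_on {0<..} (\<lambda>b. A (- A b))"
      by (rule continuous_on_compose2[OF Acont]) (use Ane in \<open>fastforce intro!: continuous_intros Ap\<close>)+
    show "\<forall>b\<in>{0<..}. A (- b) \<noteq> 0" using Ane by simp
  qed
  have small: "\<exists>y>0. y \<noteq> 1 \<and> \<bar>y - 1\<bar> < e \<and> map_prod (aff y 0) id \<in> Aut" if e: "e > 0" for e
  proof -
    define D where "D = q b2 / q b1 - 1"
    have q1: "q b1 \<noteq> 0" using d(2) b12 by simp
    have D: "D \<noteq> 0" using b12 q1 by (simp add: D_def field_simps)
    \<comment> \<open>\<open>t\<close> \<le> 1 keeps y = 1 + t D between 1 and 1 + D, where the
      intermediate value argument reaches it; the second bound keeps y within e of 1 and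
      positive.\<close>
    define t where "t = min 1 (min (e / 2) (1 / 2) / \<bar>D\<bar>)"
    have t: "0 < t" "t \<le> 1" "t * \<bar>D\<bar> \<le> min (e / 2) (1 / 2)"
    proof -
      show "0 < t" "t \<le> 1" using D e by (simp_all add: t_def)
      have "t \<le> min (e / 2) (1 / 2) / \<bar>D\<bar>" by (simp add: t_def)
      then show "t * \<bar>D\<bar> \<le> min (e / 2) (1 / 2)" using D by (simp add: pos_le_divide_eq)
    qed
    define y where "y = 1 + t * D"
    have y1: "\<bar>y - 1\<bar> = t * \<bar>D\<bar>" using t by (simp add: y_def abs_mult)
    then have y: "\<bar>y - 1\<bar> < e" "y > 0" using t(3) e by linarith+
    have "y \<noteq> 1" using t D by (simp add: y_def)
    have "\<exists>b>0. q b / q b1 = y"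
    proof -
      have c: "connected ((\<lambda>b. q b / q b1) ` {0<..})"
        using q1 by (intro connected_continuous_image continuous_intros qcont) simp_all
      have m: "1 \<in> (\<lambda>b. q b / q b1) ` {0<..}" "1 + D \<in> (\<lambda>b. q b / q b1) ` {0<..}"
        using b12 q1 by (auto intro!: image_eqI[of _ _ b1] image_eqI[of _ _ b2] simp: D_def)
      have "y \<in> (\<lambda>b. q b / q b1) ` {0<..}"
      proof (cases "D > 0")
        case True
        then have "1 \<le> y" "y \<le> 1 + D" using t by (simp_all add: y_def)
        then show ?thesis using connectedD_interval[OF c m] by simp
      next
        case False
        with D have "D < 0" by simp
        moreover have "D \<le> t * D" using t(2) \<open>D < 0\<close> mult_right_mono_neg[of t 1 D] by simp
        moreover have "t * D \<le> 0" using t \<open>D < 0\<close> by (simp add: mult_nonneg_nonpos)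
        ultimately have "1 + D \<le> y" "y \<le> 1" by (simp_all add: y_def)
        then show ?thesis using connectedD_interval[OF c m(2,1)] by simp
      qed
      then show ?thesis by auto
    qed
    then obtain b where b: "b > 0" "q b / q b1 = y" by blast
    \<comment> \<open>Slopes multiply, so \<open>d b\<close> after the inverse of
      \<open>d b1\<close> has slope y; a translation then removes the constant term.\<close>
    have "map_prod (inv (d b1)) id \<in> Aut" using pair_inv[OF dAut[of b1]] by simp
    then have "map_prod (d b \<circ> inv (d b1)) id \<in> Aut" by (rule first_comp[OF dAut])
    moreover obtain w where "d b \<circ> inv (d b1) = aff y w"
      using b(2) by (simp add: d(1)[OF b(1)] d(1)[OF b12(1)] inv_aff[OF q1])
    ultimately have "map_prod (aff 1 (- w) \<circ> aff y w) id \<in> Aut" by (intro first_comp first_aff) simp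
    then show ?thesis using y \<open>y \<noteq> 1\<close> by auto
  qed
  obtain r s where rs: "r > 0" "s > 0" "is_power r s f1 f2" using is_power_of_small_Aut(1)[OF small] by blast
  obtain r' s' where rs': "is_power r' s' f3 f4" using is_power_of_small_Aut(2)[OF small] by blast
  note sc = scaling_Aut[OF rs(3) rs']
  define e where "e = sgn p"
  have e: "e = 1 \<or> e = - 1" using p(1) by (auto simp: e_def sgn_if)
  have Xk: "aff k 0 \<circ> X = hyp f1 f2 \<circ> aff p 0"
  proof
    fix z show "(aff k 0 \<circ> X) z = (hyp f1 f2 \<circ> aff p 0) z" using EX[of "X z"] XX[of z] by simp
  qed
  \<comment> \<open>The scalings now available reduce X to the basic branch up to sign: k and p are
    replaced by their signs.\<close>
  have Y: "map_prod (aff \<bar>k\<bar> 0 \<circ> X \<circ> aff (1 / \<bar>p\<bar>) 0) id \<in> Aut"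
    using k(1) p(1) by (intro first_comp sc X) simp_all
  have pe: "p * (1 / \<bar>p\<bar>) = e" using p(1) by (simp add: e_def sgn_if)
  have inv: "r1 = 1 \<and> s1 = 1" if "is_power r1 s1 g1 g2" "r1 > 0" "s1 > 0" "map_prod (hyp g1 g2 \<circ> aff e 0) id \<in> Aut" "e = 1 \<or> e = - 1"
    for r1 s1 g1 g2 e
    using power_eq_inversion[OF that(1-3,5), of "{c. map_prod c id \<in> Aut}"] that(4) first_comp first_aff first_stabilizer
    by blast
  have rs1: "r = 1 \<and> s = 1"
  proof (cases "k > 0")
    case True
    have "aff \<bar>k\<bar> 0 \<circ> X \<circ> aff (1 / \<bar>p\<bar>) 0 = hyp f1 f2 \<circ> aff e 0"
      using True Xk pe by (simp add: o_assoc[symmetric])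
    with inv[OF rs(3,1,2)] Y e show ?thesis by simp
  next
    case False
    then have ka: "aff \<bar>k\<bar> 0 z = aff (-1) 0 (aff k 0 z)" for z by simp
    have "aff \<bar>k\<bar> 0 \<circ> X \<circ> aff (1 / \<bar>p\<bar>) 0 = hyp f2 f1 \<circ> aff (- e) 0"
    proof
      fix z
      have "aff (-1) 0 (aff k 0 (X (aff (1 / \<bar>p\<bar>) 0 z))) = aff (-1) 0 (hyp f1 f2 (aff e 0 z))"
        using fun_cong[OF Xk, of "aff (1 / \<bar>p\<bar>) 0 z"] pe by simp
      also have "\<dots> = hyp f2 f1 (aff (- e) 0 z)"
        using fun_cong[OF neg_hyp[of f1 f2], of "aff e 0 z"] by simp
      finally show "(aff \<bar>k\<bar> 0 \<circ> X \<circ> aff (1 / \<bar>p\<bar>) 0) z = (hyp f2 f1 \<circ> aff (- e) 0) z"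
        unfolding ka o_apply .
    qed
    with Y have Y': "map_prod (hyp f2 f1 \<circ> aff (- e) 0) id \<in> Aut" by simp
    \<comment> \<open>After the exchange of branches f2 comes first; division by s restores the
      value 1 at 1 that \<open>is_power\<close> requires.\<close>
    have "map_prod (aff (1 / s) 0 \<circ> (hyp f2 f1 \<circ> aff (- e) 0)) id \<in> Aut"
      by (rule first_comp[OF sc Y']) (use rs in simp)
    then have "map_prod (hyp (\<lambda>x. 1 / s * f2 x) (\<lambda>x. 1 / s * f1 x) \<circ> aff (- e) 0) id \<in> Aut"
      unfolding o_assoc aff_hyp .
    moreover have "is_power r (1 / s) (\<lambda>x. 1 / s * f2 x) (\<lambda>x. 1 / s * f1 x)"
      using rs by (simp add: is_power_def)
    ultimately have "r = 1 \<and> 1 / s = 1" using rs e by (intro inv[of r "1 / s" _ _ "- e"]) auto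
    then show ?thesis using rs by simp
  qed
  then have P12: "is_power 1 1 f1 f2" using rs by simp
  \<comment> \<open>Both families become lines when composed with X. Eliminating the common argument
    z expresses the reflected second family as a multiple of the first.\<close>
  have hy34: "hy f3 f4 (- x) = k' / k * hy f1 f2 x" if "x \<noteq> 0" for x
  proof -
    obtain z where z: "X z = Some x" using bij_is_surj[OF bX] unfolding surj_def by metis
    have "hyp f1 f2 (Some x) = aff k 0 z" "hyp f3 f4 (aff (-1) 0 (Some x)) = aff k' 0 z"
      using EX[of z] fun_cong[OF k'(2), of z] z by simp_all
    then show ?thesis using that k(1) by (cases z) simp_all
  qed
  have h: "f4 x = - (k' / k) * f1 x" "f3 x = - (k' / k) * f2 x" if "x > 0" for x
    using hy34[of x] hy34[of "- x"] that by (simp_all add: hy_pos hy_minus)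
  have "f2 1 = 1" using P12 by (simp add: is_power_def)
  with h(2)[of 1] f3_1 have "k' / k = - 1" by simp
  with h P12 have "is_power 1 1 f3 f4" by (simp add: is_power_def)
  with P12 show ?thesis by simp
qed

end

section \<open>Fractional linear maps and continuity of automorphisms\<close>

lemma mob_mob:
  assumes "a * d - b * c \<noteq> 0" "a' * d' - b' * c' \<noteq> 0"
  shows "mob a b c d (mob a' b' c' d' z) = mob (a * a' + b * c') (a * b' + b * d') (c * a' + d * c') (c * b' + d * d') z"
    and "(a * a' + b * c') * (c * b' + d * d') - (a * b' + b * d') * (c * a' + d * c') \<noteq> 0"
proof -
  have "(a * a' + b * c') * (c * b' + d * d') - (a * b' + b * d') * (c * a' + d * c') = (a * d - b * c) * (a' * d' - b' * c')"
    by (simp add: algebra_simps)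
  with assms show D: "(a * a' + b * c') * (c * b' + d * d') - (a * b' + b * d') * (c * a' + d * c') \<noteq> 0" by simp
  obtain u v where z: "z = hpt u v" "u \<noteq> 0 \<or> v \<noteq> 0" by (rule hpt_cases)
  show "mob a b c d (mob a' b' c' d' z) = mob (a * a' + b * c') (a * b' + b * d') (c * a' + d * c') (c * b' + d * d') z"
    unfolding z(1) mob_hpt(1)[OF z(2) assms(2)] mob_hpt(1)[OF mob_hpt(2)[OF z(2) assms(2)] assms(1)]
      mob_hpt(1)[OF z(2) D] by (simp add: algebra_simps)
qed

lemma mob_scale: "l \<noteq> 0 \<Longrightarrow> mob (l * a) (l * b) (l * c) (l * d) = mob a b c d"
proof
  fix z assume l: "l \<noteq> 0"
  have h: "hpt (l * u) (l * v) = hpt u v" for u v using l by (simp add: hpt_def)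
  have "l * a * x + l * b = l * (a * x + b)" "l * c * x + l * d = l * (c * x + d)" for x by (simp_all add: algebra_simps)
  then show "mob (l * a) (l * b) (l * c) (l * d) z = mob a b c d z"
    unfolding mob_def by (simp add: h split: option.split)
qed

text \<open>The projective group PGL(2, R) on the projective line, with determinants of either
  sign.\<close>

definition Mob :: "(s1 \<Rightarrow> s1) set" where
  "Mob = {mob a b c d | a b c d. a * d - b * c \<noteq> 0}"

lemma MobI: "a * d - b * c \<noteq> 0 \<Longrightarrow> mob a b c d \<in> Mob"
  unfolding Mob_def by blast

lemma MobE:
  assumes "m \<in> Mob"
  obtains a b c d where "a * d - b * c \<noteq> 0" "m = mob a b c d"
  using assms unfolding Mob_def by blast

lemma Mob_comp:
  assumes "m \<in> Mob" "m' \<in> Mob"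
  shows "m \<circ> m' \<in> Mob"
proof -
  obtain a b c d where m: "a * d - b * c \<noteq> 0" "m = mob a b c d" using assms(1) by (rule MobE)
  obtain a' b' c' d' where m': "a' * d' - b' * c' \<noteq> 0" "m' = mob a' b' c' d'" using assms(2) by (rule MobE)
  have "m \<circ> m' = mob (a * a' + b * c') (a * b' + b * d') (c * a' + d * c') (c * b' + d * d')"
    by (rule ext) (simp add: m(2) m'(2) mob_mob(1)[OF m(1) m'(1)])
  then show ?thesis using MobI[OF mob_mob(2)[OF m(1) m'(1)]] by simp
qed

lemma Mob_aff: "p \<noteq> 0 \<Longrightarrow> aff p q \<in> Mob"
  unfolding aff_mob by (rule MobI) simp

lemma Mob_inv:
  assumes "m \<in> Mob"
  shows "bij m" "inv m \<in> Mob"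
proof -
  obtain a b c d where m: "a * d - b * c \<noteq> 0" "m = mob a b c d" using assms by (rule MobE)
  define m' where "m' = mob d (- b) (- c) a"
  have D: "d * a - (- b) * (- c) \<noteq> 0" using m(1) by (simp add: mult.commute)
  have i: "mob l 0 0 l = id" if "l \<noteq> 0" for l
    using mob_scale[OF that, of 1 0 0 1] aff_mob[of 1 0] by simp
  have "m (m' z) = z" for z
    unfolding m(2) m'_def mob_mob(1)[OF m(1) D] using i[OF m(1)] by (simp add: mult.commute)
  moreover have "m' (m z) = z" for z
    unfolding m(2) m'_def mob_mob(1)[OF D m(1)] using i[OF m(1)] by (simp add: mult.commute)
  ultimately have c: "m \<circ> m' = id" "m' \<circ> m = id" by (simp_all add: fun_eq_iff)
  then show "bij m" using o_bij by blast
  have "inv m = m'" by (rule inv_unique_comp[OF c])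
  then show "inv m \<in> Mob" unfolding m'_def using MobI[OF D] by simp
qed

lemma Mob_to_None: "\<exists>m\<in>Mob. m z = None"
proof (cases z)
  case None
  then show ?thesis using Mob_aff[of 1 0] by (intro bexI[of _ "aff 1 0"]) simp_all
next
  case (Some u)
  have "mob 0 1 1 (- u) \<in> Mob" by (rule MobI) simp
  then show ?thesis using Some by (intro bexI[of _ "mob 0 1 1 (- u)"]) (simp_all add: mob_def hpt_def)
qed

text \<open>The Bruhat decomposition, written in the shape of a circle with parameters a, b, c. The
  outer factor has the sign opposite to the determinant, and this sign selects the family.\<close>

lemma mob_aff_inversion:
  assumes "c \<noteq> 0"
  shows "mob a b c d = aff (- (a * d - b * c) / c\<^sup>2) (a / c) \<circ> mob 0 1 1 0 \<circ> aff 1 (d / c)"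
proof
  fix z show "mob a b c d z = (aff (- (a * d - b * c) / c\<^sup>2) (a / c) \<circ> mob 0 1 1 0 \<circ> aff 1 (d / c)) z"
  proof (cases z)
    case None then show ?thesis using assms by (simp add: mob_def hpt_def)
  next
    case (Some x)
    have e: "x + d / c = (c * x + d) / c" using assms by (simp add: field_simps)
    show ?thesis
    proof (cases "c * x + d = 0")
      case True
      then show ?thesis using Some e by (simp add: mob_def hpt_def)
    next
      case False
      have "(a * x + b) / (c * x + d) = - (a * d - b * c) / c\<^sup>2 * (1 / ((c * x + d) / c)) + a / c"
      proof -
        define w where "w = c * x + d"
        have w: "w \<noteq> 0" using False by (simp add: w_def)
        have n: "c * (a * x + b) = a * w - (a * d - b * c)" by (simp add: w_def algebra_simps)
        have "(a * x + b) / w = c * (a * x + b) / (c * w)" using assms by simp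
        also have "\<dots> = a / c - (a * d - b * c) / (c * w)" unfolding n using assms w by (simp add: diff_divide_distrib)
        also have "\<dots> = - (a * d - b * c) / c\<^sup>2 * (1 / (w / c)) + a / c"
        proof -
          have "a / c - D / (c * w) = - D / c\<^sup>2 * (1 / (w / c)) + a / c" for D
            using assms w by (simp add: power2_eq_square)
          then show ?thesis .
        qed
        finally show ?thesis by (simp add: w_def)
      qed
      then show ?thesis using Some e False assms by (simp add: mob_def hpt_def)
    qed
  qed
qed

lemma hyp_inversion: "is_power 1 1 f g \<Longrightarrow> hyp f g = mob 0 1 1 0"
  by (rule ext) (simp add: hyp_def mob_def hpt_def hy_def is_power_def powr_minus_divide split: option.split)

section \<open>The classical plane, and fractional linearity of all automorphisms\<close>

context hyperbola_plane
begin

definition classical :: bool where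
  "classical \<longleftrightarrow> is_power 1 1 f1 f2 \<and> is_power 1 1 f3 f4"

text \<open>A nontrivial translation fixes infinity only, so its conjugate by a fixes only the image
  of infinity under a.\<close>

lemma conj_moves_None:
  assumes "bij a" "a None \<noteq> None"
  shows "(a \<circ> aff 1 1 \<circ> inv a) None \<noteq> None"
proof
  assume "(a \<circ> aff 1 1 \<circ> inv a) None = None"
  then have "aff 1 1 (inv a None) = inv a None"
    using assms(1) by (metis bij_inv_eq_iff comp_apply)
  moreover have "inv a None \<noteq> None" using assms by (metis bij_inv_eq_iff)
  ultimately show False by (cases "inv a None") auto
qed

text \<open>Conjugation by an automorphism that exchanges the factors carries the second component
  of a pair to the first place and conversely.\<close>

lemma swap_conj:
  assumes g: "map_prod a b \<circ> prod.swap \<in> Aut" "bij a" "bij b" and "map_prod c d \<in> Aut"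
  shows "map_prod (a \<circ> d \<circ> inv a) (b \<circ> c \<circ> inv b) \<in> Aut"
proof -
  have a: "a (inv a x) = x" "inv a (a x) = x" and b: "b (inv b x) = x" "inv b (b x) = x" for x
    using g(2,3) by (simp_all add: bij_is_inj bij_is_surj surj_f_inv_f)
  have "inv (map_prod a b \<circ> prod.swap) = prod.swap \<circ> map_prod (inv a) (inv b)"
    by (rule inv_unique_comp) (auto simp: a b)
  then have "map_prod a b \<circ> prod.swap \<circ> map_prod c d \<circ> (prod.swap \<circ> map_prod (inv a) (inv b)) \<in> Aut"
    using Aut_comp[OF Aut_comp[OF g(1) assms(4)] Aut_inv[OF g(1)]] by simp
  moreover have "map_prod a b \<circ> prod.swap \<circ> map_prod c d \<circ> (prod.swap \<circ> map_prod (inv a) (inv b))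
    = map_prod (a \<circ> d \<circ> inv a) (b \<circ> c \<circ> inv b)" by auto
  ultimately show ?thesis by simp
qed

lemma id_conj: "bij a \<Longrightarrow> a \<circ> id \<circ> inv a = id"
  by (simp add: bij_is_surj surj_iff[THEN iffD1])

lemma Aut_fixes_None:
  assumes "\<not> classical" and g: "map_prod a b \<in> Aut \<or> map_prod a b \<circ> prod.swap \<in> Aut" "bij a" "bij b"
  shows "a None = None" "b None = None"
proof -
  have A: "map_prod (a \<circ> aff 1 1 \<circ> inv a) id \<in> Aut"
    using g(1)
  proof
    assume "map_prod a b \<in> Aut"
    from pair_comp[OF pair_comp[OF this first_aff[of 1]] pair_inv[OF this]]
    show ?thesis using id_conj[OF g(3)] by simp
  next
    assume "map_prod a b \<circ> prod.swap \<in> Aut"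
    \<comment> \<open>In the presence of an exchange it is the translation of the second coordinate
      that is carried to the first.\<close>
    from swap_conj[OF this g(2,3) second_aff[of 1 1]] show ?thesis using id_conj[OF g(3)] by simp
  qed
  have B: "map_prod id (b \<circ> aff 1 1 \<circ> inv b) \<in> Aut"
    using g(1)
  proof
    assume "map_prod a b \<in> Aut"
    from pair_comp[OF pair_comp[OF this second_aff[of 1 1]] pair_inv[OF this]]
    show ?thesis using id_conj[OF g(2)] by simp
  next
    assume "map_prod a b \<circ> prod.swap \<in> Aut"
    from swap_conj[OF this g(2,3) first_aff[of 1]] show ?thesis using id_conj[OF g(2)] by simp
  qed
  show "a None = None"
    using first_moves[OF A] conj_moves_None[OF g(2)] assms(1) unfolding classical_def by blast
  show "b None = None"
    using second_moves[OF B] conj_moves_None[OF g(3)] assms(1) unfolding classical_def by blast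
qed

lemma classical_H:
  assumes classical
  shows "H = Mob"
proof -
  have J: "hyp f1 f2 = mob 0 1 1 0" "hyp f3 f4 = mob 0 1 1 0"
    using assms hyp_inversion unfolding classical_def by blast+
  have JM: "mob 0 1 1 0 \<in> Mob" by (rule MobI) simp
  show ?thesis
  proof
    show "H \<subseteq> Mob"
    proof
      fix h assume "h \<in> H"
      then show "h \<in> Mob"
        by (rule H_cases) (auto simp: J simp del: aff_comp intro!: Mob_comp Mob_aff JM)
    qed
    show "Mob \<subseteq> H"
    proof
      fix m assume "m \<in> Mob"
      then obtain a b c d where m: "a * d - b * c \<noteq> 0" "m = mob a b c d" by (rule MobE)
      show "m \<in> H"
      proof (cases "c = 0")
        case True
        with m have d: "d \<noteq> 0" "a \<noteq> 0" by auto
        then have "m = aff (a / d) (b / d)"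
          using mob_scale[of d "a / d" "b / d" 0 1] True m(2) by (simp add: aff_mob)
        then show ?thesis using H_line d by simp
      next
        case False
        define l where "l = - (a * d - b * c) / c\<^sup>2"
        have mm: "m = aff l (a / c) \<circ> mob 0 1 1 0 \<circ> aff 1 (d / c)"
          using mob_aff_inversion[OF False] m(2) by (simp add: l_def)
        have "l \<noteq> 0" using m(1) False by (simp add: l_def)
        then consider "l > 0" | "l < 0" by linarith
        then show ?thesis
        proof cases
          case 1 then show ?thesis using H_minus[OF 1, of "a / c" "d / c"] J mm by simp
        next
          case 2
          \<comment> \<open>The inversion is odd, so a negative outer factor can be traded for a
            reflection of the argument, which leads to the other family.\<close>
          have "aff l (a / c) (mob 0 1 1 0 (aff 1 (d / c) z)) = aff (- l) (a / c) (mob 0 1 1 0 (aff (- 1) (- d / c) z))" for z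
          proof (cases z)
            case (Some x)
            define y where "y = x + d / c"
            have "aff 1 (d / c) z = Some y" "aff (- 1) (- d / c) z = Some (- y)" using Some by (simp_all add: y_def)
            then show ?thesis by (simp add: mob_def hpt_def)
          qed (simp add: mob_def hpt_def)
          then have "m = aff (- l) (a / c) \<circ> mob 0 1 1 0 \<circ> aff (-1) (- d / c)"
            unfolding mm by (simp add: fun_eq_iff)
          then show ?thesis using H_plus[of "- l" "a / c" "- d / c"] 2 J by simp
        qed
      qed
    qed
  qed
qed

lemma classical_Mob_Aut:
  assumes classical "m \<in> Mob" "m' \<in> Mob"
  shows "map_prod m m' \<in> Aut"
  by (rule pairI) (use assms Mob_inv Mob_comp in \<open>auto simp: classical_H\<close>)

text \<open>In the classical plane all pairs of fractional linear maps are automorphisms, so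
  composing with one brings the image of infinity back and reduces to the stabilizer; otherwise
  infinity is fixed from the start.\<close>

lemma Aut_Mob:
  assumes g: "map_prod a b \<in> Aut \<or> map_prod a b \<circ> prod.swap \<in> Aut" "bij a" "bij b"
  shows "a \<in> Mob" "b \<in> Mob"
proof -
  have "a \<in> Mob \<and> b \<in> Mob"
  proof (cases classical)
    case False
    show ?thesis
      by (rule pair_stabilizer[OF g Aut_fixes_None[OF False g]]) (auto intro: Mob_aff)
  next
    case True
    obtain m m' where m: "m \<in> Mob" "m (a None) = None" and m': "m' \<in> Mob" "m' (b None) = None"
      using Mob_to_None by metis
    have mm: "map_prod m m' \<in> Aut" by (rule classical_Mob_Aut[OF True m(1) m'(1)])
    have "map_prod (m \<circ> a) (m' \<circ> b) \<in> Aut \<or> map_prod (m \<circ> a) (m' \<circ> b) \<circ> prod.swap \<in> Aut"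
      using g(1)
    proof
      assume "map_prod a b \<in> Aut"
      then show ?thesis using pair_comp[OF mm] by blast
    next
      assume "map_prod a b \<circ> prod.swap \<in> Aut"
      then show ?thesis using Aut_comp[OF mm, of "map_prod a b \<circ> prod.swap"]
        by (simp add: o_assoc map_prod.comp)
    qed
    then obtain p q r s where pq: "p \<noteq> 0" "r \<noteq> 0" "m \<circ> a = aff p q" "m' \<circ> b = aff r s"
      by (rule pair_stabilizer) (use Mob_inv m m' g in \<open>auto intro: bij_comp\<close>)
    have "inv m \<circ> (m \<circ> a) = a" "inv m' \<circ> (m' \<circ> b) = b"
      using Mob_inv(1)[OF m(1)] Mob_inv(1)[OF m'(1)] by (simp_all add: fun_eq_iff bij_is_inj)
    then show ?thesis using pq Mob_comp[OF Mob_inv(2)[OF m(1)] Mob_aff[OF pq(1), of q]]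
        Mob_comp[OF Mob_inv(2)[OF m'(1)] Mob_aff[OF pq(2), of s]] by simp
  qed
  then show "a \<in> Mob" "b \<in> Mob" by simp_all
qed

lemma Aut_continuous:
  assumes "g \<in> Aut"
  shows "continuous_map P_top P_top g"
  using assms
proof (rule Aut_cases)
  fix a b assume g: "g = map_prod a b" "bij a" "bij b"
  then have "a \<in> Mob" "b \<in> Mob" using Aut_Mob assms by blast+
  then show ?thesis unfolding g(1) by (auto elim!: MobE intro: continuous_map_mob_prod)
next
  fix a b assume g: "g = map_prod a b \<circ> prod.swap" "bij a" "bij b"
  then have "a \<in> Mob" "b \<in> Mob" using Aut_Mob assms by blast+
  then show ?thesis unfolding g(1) by (auto elim!: MobE intro: continuous_map_mob_prod)
qed

lemma has_dimension_unique_Aut: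
  assumes "has_dimension (aut_top (M_circles f1 f2 f3 f4)) m" "has_dimension (aut_top (M_circles f1 f2 f3 f4)) n"
  shows "m = n"
  by (rule has_dimension_aut_top_unique[OF _ assms]) (use Aut_continuous in \<open>simp add: Aut_def\<close>)

end

section \<open>Local charts\<close>

definition near :: "real \<Rightarrow> real \<Rightarrow> s1 \<Rightarrow> bool" where
  "near e t z \<longleftrightarrow> (\<exists>x. z = Some x \<and> \<bar>x - t\<bar> < e)"

lemma near_iff: "near e t z \<longleftrightarrow> z \<in> Some ` {t - e<..<t + e}"
  by (auto simp: near_def abs_less_iff)

lemma near_Some [simp]: "near e t (Some x) \<longleftrightarrow> \<bar>x - t\<bar> < e"
  by (simp add: near_def)

lemma near_the: "near e t z \<Longrightarrow> z = Some (the z) \<and> \<bar>the z - t\<bar> < e"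
  by (auto simp: near_def)

text \<open>The number k of conditions is independent of the dimension n: for affine maps the image
  of -1 is constrained although it is not a coordinate.\<close>

lemma openin_Euclidean_box:
  fixes L :: "nat \<Rightarrow> (nat \<Rightarrow> real) \<Rightarrow> real"
  assumes "\<And>i. continuous_map (Euclidean_space n) euclideanreal (L i)"
  shows "openin (Euclidean_space n) {v \<in> topspace (Euclidean_space n). \<forall>i<k. \<bar>L i v\<bar> < e}"
proof (induction k)
  case (Suc k)
  have "openin (Euclidean_space n) {v \<in> topspace (Euclidean_space n). L k v \<in> {- e<..<e}}"
    by (rule openin_continuous_map_preimage[OF assms]) simp
  then have "openin (Euclidean_space n) ({v \<in> topspace (Euclidean_space n). \<forall>i<k. \<bar>L i v\<bar> < e} \<inter> {v \<in> topspace (Euclidean_space n). L k v \<in> {- e<..<e}})"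
    using Suc by (rule openin_Int[rotated])
  moreover have "{v \<in> topspace (Euclidean_space n). \<forall>i<k. \<bar>L i v\<bar> < e} \<inter> {v \<in> topspace (Euclidean_space n). L k v \<in> {- e<..<e}}
    = {v \<in> topspace (Euclidean_space n). \<forall>i<Suc k. \<bar>L i v\<bar> < e}"
    by (auto simp: less_Suc_eq abs_less_iff)
  ultimately show ?case by simp
qed simp

lemma continuous_map_Euclidean_coord: "continuous_map (Euclidean_space n) euclideanreal (\<lambda>v. v i)"
  unfolding Euclidean_space_def
  by (rule continuous_map_from_subtopology) (rule continuous_map_product_projection, simp)

text \<open>The fractional linear map with values \<open>y0, y1, y2\<close> at \<open>0, 1, -1\<close>.\<close>

definition mob3 :: "real \<Rightarrow> real \<Rightarrow> real \<Rightarrow> s1 \<Rightarrow> s1" where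
  "mob3 y0 y1 y2 = mob (y0 * (y1 + y2) - 2 * y1 * y2) (y0 * (y1 - y2)) (2 * y0 - y1 - y2) (y1 - y2)"

text \<open>The factorization shows that \<open>mob3\<close> degenerates only when two of the three
  prescribed values coincide.\<close>

lemma mob3_det:
  fixes y0 y1 y2 :: real
  shows "(y0 * (y1 + y2) - 2 * y1 * y2) * (y1 - y2) - (y0 * (y1 - y2)) * (2 * y0 - y1 - y2) = 2 * (y1 - y2) * (y1 - y0) * (y0 - y2)"
  by (simp add: algebra_simps)

lemma mob3_Mob: "y2 < y0 \<Longrightarrow> y0 < y1 \<Longrightarrow> mob3 y0 y1 y2 \<in> Mob"
  unfolding mob3_def by (rule MobI) (simp add: mob3_det)

lemma mob3_values:
  assumes "y2 < y0" "y0 < y1"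
  shows "mob3 y0 y1 y2 (Some 0) = Some y0" "mob3 y0 y1 y2 (Some 1) = Some y1" "mob3 y0 y1 y2 (Some (-1)) = Some y2"
proof -
  show "mob3 y0 y1 y2 (Some 0) = Some y0" using assms by (simp add: mob3_def mob_def hpt_def)
  have "y0 * (y1 + y2) - 2 * y1 * y2 + y0 * (y1 - y2) = y1 * (2 * (y0 - y2))" "2 * y0 - y1 - y2 + (y1 - y2) = 2 * (y0 - y2)"
    by (simp_all add: algebra_simps)
  then show "mob3 y0 y1 y2 (Some 1) = Some y1" using assms by (simp add: mob3_def mob_def hpt_def)
  have n: "y0 * (y1 - y2) - (y0 * (y1 + y2) - 2 * y1 * y2) = y2 * (2 * (y1 - y0))" "y1 - y2 - (2 * y0 - y1 - y2) = 2 * (y1 - y0)"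
    by (simp_all add: algebra_simps)
  have m: "mob a b c d (Some (- 1)) = hpt (b - a) (d - c)" for a b c d by (simp add: mob_def)
  have "mob3 y0 y1 y2 (Some (-1)) = hpt (y2 * (2 * (y1 - y0))) (2 * (y1 - y0))" unfolding mob3_def m n ..
  then show "mob3 y0 y1 y2 (Some (-1)) = Some y2" using assms by (simp add: hpt_def)
qed

text \<open>Three values determine the matrix up to a factor; the factor l makes the lower right
  entry y1 - y2, as in \<open>mob3\<close>.\<close>

lemma Mob_eq_mob3:
  assumes "m \<in> Mob" "y2 < y0" "y0 < y1"
    and "m (Some 0) = Some y0" "m (Some 1) = Some y1" "m (Some (-1)) = Some y2"
  shows "m = mob3 y0 y1 y2"
proof -
  obtain a b c d where m: "a * d - b * c \<noteq> 0" "m = mob a b c d" using assms(1) by (rule MobE)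
  have d: "d \<noteq> 0" "b = y0 * d" using assms(4) unfolding m(2) by (auto simp: mob_def hpt_def split: if_splits)
  have s: "a + b = y1 * (c + d)" using assms(5) unfolding m(2) by (auto simp: mob_def hpt_def split: if_splits)
  have t: "- a + b = y2 * (- c + d)" using assms(6) unfolding m(2) by (auto simp: mob_def hpt_def split: if_splits)
  have "2 * b = y1 * (c + d) + y2 * (- c + d)" using s t by linarith
  then have c: "(y1 - y2) * c = (2 * y0 - y1 - y2) * d" using d(2) by (simp add: algebra_simps)
  have "2 * a = y1 * (c + d) - y2 * (- c + d)" using s t by linarith
  then have "2 * ((y1 - y2) * a) = (y1 - y2) * (y1 * (c + d) - y2 * (- c + d))" by simp
  also have "\<dots> = (y1 + y2) * ((y1 - y2) * c) + (y1 - y2) * (y1 - y2) * d" by (simp add: algebra_simps)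
  also have "\<dots> = 2 * ((y0 * (y1 + y2) - 2 * y1 * y2) * d)" unfolding c by (simp add: algebra_simps)
  finally have a: "(y1 - y2) * a = (y0 * (y1 + y2) - 2 * y1 * y2) * d" by simp
  define l where "l = (y1 - y2) / d"
  have l: "l \<noteq> 0" using assms(2,3) d by (simp add: l_def)
  have "l * a = y0 * (y1 + y2) - 2 * y1 * y2" "l * b = y0 * (y1 - y2)" "l * c = 2 * y0 - y1 - y2" "l * d = y1 - y2"
    using a c d by (simp_all add: l_def)
  then show ?thesis using mob_scale[OF l, of a b c d] m(2) by (simp add: mob3_def)
qed

context hyperbola_plane
begin

text \<open>The condition at \<open>(0, 1)\<close> excludes automorphisms exchanging the two factors.\<close>

definition near_id :: "real \<Rightarrow> (pt \<Rightarrow> pt) set" where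
  "near_id e = {g \<in> Aut. \<forall>(s, t) \<in> {(0, 0), (1, 1), (-1, -1), (0, 1)}.
     near e s (fst (g (Some s, Some t))) \<and> near e t (snd (g (Some s, Some t)))}"

lemma openin_near_id: "openin (aut_top (M_circles f1 f2 f3 f4)) (near_id e)"
proof -
  let ?T = "aut_top (M_circles f1 f2 f3 f4)"
  let ?B = "\<lambda>s t. {g \<in> Aut. g (Some s, Some t) \<in> Some ` {s - e<..<s + e} \<times> Some ` {t - e<..<t + e}}"
  have o: "openin ?T (?B s t)" for s t unfolding Aut_def by (rule openin_aut_eval)
  have "openin ?T (?B 0 0 \<inter> ?B 1 1 \<inter> ?B (-1) (-1) \<inter> ?B 0 1)" by (intro openin_Int o)
  moreover have "?B 0 0 \<inter> ?B 1 1 \<inter> ?B (-1) (-1) \<inter> ?B 0 1 = near_id e"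
    unfolding near_id_def near_iff by (auto simp: mem_Times_iff)
  ultimately show ?thesis by simp
qed

lemma near_id_pairI:
  assumes "map_prod a b \<in> Aut" "\<And>s. s \<in> {0, 1, -1} \<Longrightarrow> near e s (a (Some s)) \<and> near e s (b (Some s))"
  shows "map_prod a b \<in> near_id e"
  using assms unfolding near_id_def by simp

lemma near_id_pairE:
  assumes "g \<in> near_id e" "e \<le> 1 / 2"
  obtains a b where "g = map_prod a b" "map_prod a b \<in> Aut"
    "\<And>s. s \<in> {0, 1, -1} \<Longrightarrow> near e s (a (Some s)) \<and> near e s (b (Some s))"
proof -
  have g: "g \<in> Aut" using assms(1) by (simp add: near_id_def)
  have n: "near e s (fst (g (Some s, Some t))) \<and> near e t (snd (g (Some s, Some t)))"
    if "(s, t) \<in> {(0, 0), (1, 1), (-1, -1), (0, 1)}" for s t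
    using assms(1) that unfolding near_id_def by blast
  show thesis
    using g
  proof (rule Aut_cases)
    fix a b assume ab: "g = map_prod a b" "bij a" "bij b"
    have "near e s (a (Some s)) \<and> near e s (b (Some s))" if "s \<in> {0, 1, -1}" for s
      using n[of s s] that unfolding ab(1) by auto
    then show thesis using that[of a b] g ab(1) by simp
  next
    fix a b assume ab: "g = map_prod a b \<circ> prod.swap" "bij a" "bij b"
    \<comment> \<open>With an exchange, the second coordinate of the image is b 0 at both (0, 0) and
      (0, 1), so b 0 would be within 1/2 of 0 and of 1.\<close>
    have "near e 0 (b (Some 0))" using n[of 0 0] unfolding ab(1) by simp
    moreover have "near e 1 (b (Some 0))" using n[of 0 1] unfolding ab(1) by simp
    ultimately obtain x where "\<bar>x\<bar> < e" "\<bar>x - 1\<bar> < e" by (auto simp: near_def)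
    then show thesis using assms(2) by linarith
  qed
qed

lemma near_id_coord:
  assumes "e \<le> 1 / 2" "s \<in> {0, 1, -1}"
  shows "continuous_map (subtopology (aut_top (M_circles f1 f2 f3 f4)) (near_id e)) euclideanreal (\<lambda>g. the (fst (g (Some s, Some s))))"
    and "continuous_map (subtopology (aut_top (M_circles f1 f2 f3 f4)) (near_id e)) euclideanreal (\<lambda>g. the (snd (g (Some s, Some s))))"
proof -
  have "g (Some s, Some s) \<in> range Some \<times> range Some" if "g \<in> near_id e" for g
    using near_id_pairE[OF that assms(1)] assms(2) near_the by (metis map_prod_simp mem_Sigma_iff rangeI)
  then show "continuous_map (subtopology (aut_top (M_circles f1 f2 f3 f4)) (near_id e)) euclideanreal (\<lambda>g. the (fst (g (Some s, Some s))))"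
    "continuous_map (subtopology (aut_top (M_circles f1 f2 f3 f4)) (near_id e)) euclideanreal (\<lambda>g. the (snd (g (Some s, Some s))))"
    using continuous_map_aut_coord[of "near_id e"] by blast+
qed

lemma chart_continuous:
  assumes "\<And>v. v \<in> V \<Longrightarrow> a v * d v - b v * c v \<noteq> 0" "\<And>v. v \<in> V \<Longrightarrow> a' v * d' v - b' v * c' v \<noteq> 0"
    and "\<And>v. v \<in> V \<Longrightarrow> map_prod (mob (a v) (b v) (c v) (d v)) (mob (a' v) (b' v) (c' v) (d' v)) \<in> Aut"
    and "\<And>h. h \<in> {a, b, c, d, a', b', c', d'} \<Longrightarrow> continuous_map (Euclidean_space n) euclideanreal h"
  shows "continuous_map (subtopology (Euclidean_space n) V) (aut_top (M_circles f1 f2 f3 f4))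
    (\<lambda>v. map_prod (mob (a v) (b v) (c v) (d v)) (mob (a' v) (b' v) (c' v) (d' v)))"
  by (rule continuous_map_mob_pair)
    (use assms in \<open>auto intro!: continuous_map_from_subtopology simp: Aut_def\<close>)

lemma has_dimension_6:
  assumes classical
  shows "has_dimension (aut_top (M_circles f1 f2 f3 f4)) 6"
proof -
  define e :: real where "e = 1 / 2"
  define L where "L i v = v i - [0, 1, -1, 0, 1, -1] ! i" for i and v :: "nat \<Rightarrow> real"
  define V where "V = {v \<in> topspace (Euclidean_space 6). \<forall>i<6. \<bar>L i v\<bar> < e}"
  define rd where "rd g = (!) [the (fst (g (Some 0, Some 0))), the (fst (g (Some 1, Some 1))), the (fst (g (Some (-1), Some (-1)))),
     the (snd (g (Some 0, Some 0))), the (snd (g (Some 1, Some 1))), the (snd (g (Some (-1), Some (-1))))]" for g :: "pt \<Rightarrow> pt"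
  define par where "par v = map_prod (mob3 (v 0) (v 1) (v 2)) (mob3 (v 3) (v 4) (v 5))" for v :: "nat \<Rightarrow> real"
  have six: "(\<forall>i<6. P i) \<longleftrightarrow> P 0 \<and> P 1 \<and> P 2 \<and> P 3 \<and> P 4 \<and> P 5" for P :: "nat \<Rightarrow> bool"
    by (simp add: numeral_eq_Suc All_less_Suc) blast
  have V: "v \<in> V \<longleftrightarrow> v \<in> topspace (Euclidean_space 6) \<and> \<bar>v 0\<bar> < e \<and> \<bar>v 1 - 1\<bar> < e \<and> \<bar>v 2 + 1\<bar> < e \<and> \<bar>v 3\<bar> < e \<and> \<bar>v 4 - 1\<bar> < e \<and> \<bar>v 5 + 1\<bar> < e" for v
    unfolding V_def mem_Collect_eq six L_def by (simp add: numeral_eq_Suc)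
  have ord: "v 2 < v 0" "v 0 < v 1" "v 5 < v 3" "v 3 < v 4" if "v \<in> V" for v
    using that unfolding V e_def by linarith+
  have oV: "openin (Euclidean_space 6) V"
    unfolding V_def L_def
    by (rule openin_Euclidean_box) (intro continuous_map_diff continuous_map_Euclidean_coord continuous_map_const[THEN iffD2], simp)
  have parA: "par v \<in> Aut" if "v \<in> V" for v
    unfolding par_def by (intro classical_Mob_Aut assms mob3_Mob ord that)
  have rdp: "rd (par v) i = v i" if "v \<in> V" "i < 6" for v i
  proof -
    have "\<forall>i<6. rd (par v) i = v i"
      unfolding six rd_def par_def using mob3_values[OF ord(1,2)[OF that(1)]] mob3_values[OF ord(3,4)[OF that(1)]] by simp
    then show ?thesis using that(2) by simp
  qed
  show ?thesis
  proof (rule has_dimensionI[OF openin_near_id[of e] oV, where par = par and rd = rd])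
    show "(\<lambda>i. if i < 6 then [0, 1, -1, 0, 1, -1] ! i else 0) \<in> V"
      unfolding V by (simp add: topspace_Euclidean_space e_def numeral_eq_Suc)
    show "continuous_map (subtopology (Euclidean_space 6) V) (aut_top (M_circles f1 f2 f3 f4)) par"
      unfolding par_def mob3_def
    proof (rule chart_continuous)
      show "map_prod (mob (v 0 * (v 1 + v 2) - 2 * v 1 * v 2) (v 0 * (v 1 - v 2)) (2 * v 0 - v 1 - v 2) (v 1 - v 2))
          (mob (v 3 * (v 4 + v 5) - 2 * v 4 * v 5) (v 3 * (v 4 - v 5)) (2 * v 3 - v 4 - v 5) (v 4 - v 5)) \<in> Aut" if "v \<in> V" for v
        using parA[OF that] by (simp add: par_def mob3_def)
    next
      fix v assume "v \<in> V"
      from ord[OF this]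
      show "(v 0 * (v 1 + v 2) - 2 * v 1 * v 2) * (v 1 - v 2) - v 0 * (v 1 - v 2) * (2 * v 0 - v 1 - v 2) \<noteq> 0"
        "(v 3 * (v 4 + v 5) - 2 * v 4 * v 5) * (v 4 - v 5) - v 3 * (v 4 - v 5) * (2 * v 3 - v 4 - v 5) \<noteq> 0"
        unfolding mob3_det by simp_all
    next
      fix h :: "(nat \<Rightarrow> real) \<Rightarrow> real"
      note [intro] = continuous_map_diff continuous_map_add continuous_map_real_mult continuous_map_Euclidean_coord
      assume "h \<in> {\<lambda>v. v 0 * (v 1 + v 2) - 2 * v 1 * v 2, \<lambda>v. v 0 * (v 1 - v 2), \<lambda>v. 2 * v 0 - v 1 - v 2, \<lambda>v. v 1 - v 2,
        \<lambda>v. v 3 * (v 4 + v 5) - 2 * v 4 * v 5, \<lambda>v. v 3 * (v 4 - v 5), \<lambda>v. 2 * v 3 - v 4 - v 5, \<lambda>v. v 4 - v 5}"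
      then show "continuous_map (Euclidean_space 6) euclideanreal h"
        by (elim insertE emptyE; simp only:;
            intro continuous_map_diff continuous_map_add continuous_map_real_mult continuous_map_Euclidean_coord
              continuous_map_const[THEN iffD2]; simp)
    qed
    show "par v \<in> near_id e" if v: "v \<in> V" for v
      using parA[OF v] unfolding par_def
      by (rule near_id_pairI)
        (use mob3_values[OF ord(1,2)[OF v]] mob3_values[OF ord(3,4)[OF v]] v in \<open>auto simp: V\<close>)
    show "continuous_map (subtopology (aut_top (M_circles f1 f2 f3 f4)) (near_id e)) euclideanreal (\<lambda>g. rd g i)" if "i < 6" for i
    proof -
      have "\<forall>i<6. continuous_map (subtopology (aut_top (M_circles f1 f2 f3 f4)) (near_id e)) euclideanreal (\<lambda>g. rd g i)"
        unfolding six rd_def using near_id_coord[of e] by (simp add: e_def)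
      then show ?thesis using that by blast
    qed
    show "rd (par v) i = v i" if "v \<in> V" "i < 6" for v i by (rule rdp[OF that])
    fix g assume gU: "g \<in> near_id e"
    let ?v = "\<lambda>i. if i < 6 then rd g i else 0"
    obtain a b where ab: "g = map_prod a b" "map_prod a b \<in> Aut"
      "\<And>s. s \<in> {0, 1, -1} \<Longrightarrow> near e s (a (Some s)) \<and> near e s (b (Some s))"
      using near_id_pairE[OF gU] unfolding e_def by auto
    have n: "a (Some s) = Some (the (a (Some s)))" "\<bar>the (a (Some s)) - s\<bar> < e"
      "b (Some s) = Some (the (b (Some s)))" "\<bar>the (b (Some s)) - s\<bar> < e" if "s \<in> {0, 1, -1}" for s
      using ab(3)[OF that] near_the by blast+
    have v: "?v 0 = the (a (Some 0))" "?v 1 = the (a (Some 1))" "?v 2 = the (a (Some (-1)))"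
      "?v 3 = the (b (Some 0))" "?v 4 = the (b (Some 1))" "?v 5 = the (b (Some (-1)))"
      unfolding rd_def ab(1) by simp_all
    have vV: "?v \<in> V"
      unfolding V v using n[of 0] n[of 1] n[of "-1"] by (simp add: topspace_Euclidean_space)
    have M: "a \<in> Mob" "b \<in> Mob" using Aut_Mob ab(2) pair_bij by blast+
    have "a = mob3 (?v 0) (?v 1) (?v 2)"
      by (rule Mob_eq_mob3[OF M(1) ord(1,2)[OF vV]]) (unfold v, (rule n, simp)+)
    moreover have "b = mob3 (?v 3) (?v 4) (?v 5)"
      by (rule Mob_eq_mob3[OF M(2) ord(3,4)[OF vV]]) (unfold v, (rule n, simp)+)
    ultimately show "?v \<in> V \<and> par ?v = g" using vV unfolding par_def ab(1) by simp
  qed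
qed

lemma aff_pair_Aut:
  assumes "map_prod (aff p 0) id \<in> Aut" "r > 0"
  shows "map_prod (aff p q) (aff r s) \<in> Aut"
  using pair_comp[OF translation_Aut[OF assms(2), of q s] assms(1)] by simp

text \<open>The three points 0, 1, -1 force p and r to be positive. Undoing the translations and the
  scaling of y, which are always automorphisms, isolates the scaling of x.\<close>

lemma near_id_affE:
  assumes "\<not> classical" "e \<le> 1 / 2" "g \<in> near_id e"
  obtains p q r s where "g = map_prod (aff p q) (aff r s)" "p > 0" "r > 0" "map_prod (aff p 0) id \<in> Aut"
    "\<bar>q\<bar> < e" "\<bar>p + q - 1\<bar> < e" "\<bar>- p + q + 1\<bar> < e" "\<bar>s\<bar> < e" "\<bar>r + s - 1\<bar> < e" "\<bar>- r + s + 1\<bar> < e"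
proof -
  obtain a b where ab: "g = map_prod a b" "map_prod a b \<in> Aut"
    "\<And>s. s \<in> {0, 1, -1} \<Longrightarrow> near e s (a (Some s)) \<and> near e s (b (Some s))"
    using near_id_pairE[OF assms(3,2)] by blast
  have "map_prod a b \<in> Aut \<or> map_prod a b \<circ> prod.swap \<in> Aut" "bij a" "bij b"
    using ab(2) pair_bij by blast+
  then obtain p q r s where pq: "a = aff p q" "b = aff r s"
    using Aut_fixes_None[OF assms(1)] pair_stabilizer by metis
  have n: "\<bar>q\<bar> < e" "\<bar>p + q - 1\<bar> < e" "\<bar>- p + q + 1\<bar> < e" "\<bar>s\<bar> < e" "\<bar>r + s - 1\<bar> < e" "\<bar>- r + s + 1\<bar> < e"
    using ab(3)[of 0] ab(3)[of 1] ab(3)[of "-1"] by (simp_all add: pq)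
  then have pr: "p > 0" "r > 0" using assms(2) by linarith+
  have "map_prod (aff p q) (aff r s) \<in> Aut" using ab(2) by (simp add: pq)
  from pair_comp[OF translation_Aut[of "1 / r" "- q" "- s / r"] this]
  have "map_prod (aff p 0) id \<in> Aut" using pr by simp
  then show thesis using that[of p q r s] ab(1) pq n pr by simp
qed

lemma has_dimension_4:
  assumes "\<not> classical" "is_power r s f1 f2" "is_power r' s' f3 f4"
  shows "has_dimension (aut_top (M_circles f1 f2 f3 f4)) 4"
proof -
  define e :: real where "e = 1 / 2"
  define L where "L i v = [v 0, v 1 - 1, 2 * v 0 - v 1 + 1, v 2, v 3 - 1, 2 * v 2 - v 3 + 1] ! (i mod 6)" for i and v :: "nat \<Rightarrow> real"
  define V where "V = {v \<in> topspace (Euclidean_space 4). \<forall>i<6. \<bar>L i v\<bar> < e}"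
  define rd where "rd g = (!) [the (fst (g (Some 0, Some 0))), the (fst (g (Some 1, Some 1))),
     the (snd (g (Some 0, Some 0))), the (snd (g (Some 1, Some 1)))]" for g :: "pt \<Rightarrow> pt"
  define par where "par v = map_prod (mob (v 1 - v 0) (v 0) 0 1) (mob (v 3 - v 2) (v 2) 0 1)" for v :: "nat \<Rightarrow> real"
  have par: "par v = map_prod (aff (v 1 - v 0) (v 0)) (aff (v 3 - v 2) (v 2))" for v by (simp add: par_def aff_mob)
  have four: "(\<forall>i<4. P i) \<longleftrightarrow> P 0 \<and> P 1 \<and> P 2 \<and> P 3" for P :: "nat \<Rightarrow> bool"
    by (simp add: numeral_eq_Suc All_less_Suc) blast
  have six: "(\<forall>i<6. P i) \<longleftrightarrow> P 0 \<and> P 1 \<and> P 2 \<and> P 3 \<and> P 4 \<and> P 5" for P :: "nat \<Rightarrow> bool"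
    by (simp add: numeral_eq_Suc All_less_Suc) blast
  have V: "v \<in> V \<longleftrightarrow> v \<in> topspace (Euclidean_space 4) \<and> \<bar>v 0\<bar> < e \<and> \<bar>v 1 - 1\<bar> < e \<and> \<bar>2 * v 0 - v 1 + 1\<bar> < e \<and> \<bar>v 2\<bar> < e \<and> \<bar>v 3 - 1\<bar> < e \<and> \<bar>2 * v 2 - v 3 + 1\<bar> < e" for v
    unfolding V_def mem_Collect_eq six L_def by simp
  have ord: "v 1 - v 0 > 0" "v 3 - v 2 > 0" if "v \<in> V" for v
    using that unfolding V e_def by linarith+
  have oV: "openin (Euclidean_space 4) V"
    unfolding V_def
  proof (rule openin_Euclidean_box)
    have "\<forall>i<6. continuous_map (Euclidean_space 4) euclideanreal (L i)"
      unfolding six L_def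
      by (simp, intro conjI continuous_map_diff continuous_map_add continuous_map_real_mult continuous_map_Euclidean_coord
          continuous_map_const[THEN iffD2]; simp)
    moreover have "L i = L (i mod 6)" for i by (simp add: L_def fun_eq_iff)
    ultimately show "continuous_map (Euclidean_space 4) euclideanreal (L i)" for i
      by (metis mod_less_divisor zero_less_numeral)
  qed
  have parA: "par v \<in> Aut" if "v \<in> V" for v
    unfolding par using ord[OF that] by (intro aff_pair_Aut scaling_Aut[OF assms(2,3)])
  show ?thesis
  proof (rule has_dimensionI[OF openin_near_id[of e] oV, where par = par and rd = rd])
    show "(\<lambda>i. if i = 1 \<or> i = 3 then 1 else 0) \<in> V"
      unfolding V by (simp add: topspace_Euclidean_space e_def)
    show "continuous_map (subtopology (Euclidean_space 4) V) (aut_top (M_circles f1 f2 f3 f4)) par"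
      unfolding par_def
    proof (rule chart_continuous)
      show "map_prod (mob (v 1 - v 0) (v 0) 0 1) (mob (v 3 - v 2) (v 2) 0 1) \<in> Aut" if "v \<in> V" for v
        using parA[OF that] by (simp add: par_def)
    next
      fix v assume "v \<in> V"
      from ord[OF this] show "(v 1 - v 0) * 1 - v 0 * 0 \<noteq> 0" "(v 3 - v 2) * 1 - v 2 * 0 \<noteq> 0" by simp_all
    next
      fix h :: "(nat \<Rightarrow> real) \<Rightarrow> real"
      assume "h \<in> {\<lambda>v. v 1 - v 0, \<lambda>v. v 0, \<lambda>v. 0, \<lambda>v. 1, \<lambda>v. v 3 - v 2, \<lambda>v. v 2, \<lambda>v. 0, \<lambda>v. 1}"
      then show "continuous_map (Euclidean_space 4) euclideanreal h"
        by (elim insertE emptyE; simp only:;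
            intro continuous_map_diff continuous_map_Euclidean_coord continuous_map_const[THEN iffD2]; simp)
    qed
    show "par v \<in> near_id e" if v: "v \<in> V" for v
      using parA[OF v] v unfolding par by (intro near_id_pairI) (auto simp: V)
    show "continuous_map (subtopology (aut_top (M_circles f1 f2 f3 f4)) (near_id e)) euclideanreal (\<lambda>g. rd g i)" if "i < 4" for i
    proof -
      have "\<forall>i<4. continuous_map (subtopology (aut_top (M_circles f1 f2 f3 f4)) (near_id e)) euclideanreal (\<lambda>g. rd g i)"
        unfolding four rd_def using near_id_coord[of e] by (simp add: e_def)
      then show ?thesis using that by blast
    qed
    show "rd (par v) i = v i" if "v \<in> V" "i < 4" for v i
    proof -
      have "\<forall>i<4. rd (par v) i = v i" unfolding four rd_def par by simp
      then show ?thesis using that(2) by simp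
    qed
    fix g assume gU: "g \<in> near_id e"
    let ?v = "\<lambda>i. if i < 4 then rd g i else 0"
    obtain p q r s where g: "g = map_prod (aff p q) (aff r s)"
      and n: "\<bar>q\<bar> < e" "\<bar>p + q - 1\<bar> < e" "\<bar>- p + q + 1\<bar> < e" "\<bar>s\<bar> < e" "\<bar>r + s - 1\<bar> < e" "\<bar>- r + s + 1\<bar> < e"
      by (rule near_id_affE[OF assms(1) _ gU]) (simp add: e_def)
    have v: "?v 0 = q" "?v 1 = p + q" "?v 2 = s" "?v 3 = r + s"
      unfolding rd_def g by simp_all
    have "?v \<in> V" unfolding V v using n by (simp add: topspace_Euclidean_space algebra_simps)
    moreover have "par ?v = g" unfolding par v unfolding g by simp
    ultimately show "?v \<in> V \<and> par ?v = g" ..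
  qed
qed

lemma has_dimension_3:
  assumes "\<not> classical"
    and "\<not> ((\<exists>r s. r > 0 \<and> s > 0 \<and> is_power r s f1 f2) \<and> (\<exists>r s. r > 0 \<and> s > 0 \<and> is_power r s f3 f4))"
  shows "has_dimension (aut_top (M_circles f1 f2 f3 f4)) 3"
proof -
  obtain d where d: "d > 0" "\<And>p. p > 0 \<Longrightarrow> \<bar>p - 1\<bar> < d \<Longrightarrow> map_prod (aff p 0) id \<in> Aut \<Longrightarrow> p = 1"
    using is_power_of_small_Aut assms(2) by metis
  define e :: real where "e = min (1 / 2) (d / 2)"
  have e: "0 < e" "e \<le> 1 / 2" "2 * e \<le> d" using d(1) by (simp_all add: e_def)
  define L where "L i v = [v 0, v 1, v 2 - 1, 2 * v 1 - v 2 + 1] ! (i mod 4)" for i and v :: "nat \<Rightarrow> real"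
  define V where "V = {v \<in> topspace (Euclidean_space 3). \<forall>i<4. \<bar>L i v\<bar> < e}"
  define rd where "rd g = (!) [the (fst (g (Some 0, Some 0))), the (snd (g (Some 0, Some 0))), the (snd (g (Some 1, Some 1)))]"
    for g :: "pt \<Rightarrow> pt"
  define par where "par v = map_prod (mob 1 (v 0) 0 1) (mob (v 2 - v 1) (v 1) 0 1)" for v :: "nat \<Rightarrow> real"
  have par: "par v = map_prod (aff 1 (v 0)) (aff (v 2 - v 1) (v 1))" for v by (simp add: par_def aff_mob)
  have three: "(\<forall>i<3. P i) \<longleftrightarrow> P 0 \<and> P 1 \<and> P 2" for P :: "nat \<Rightarrow> bool"
    by (simp add: numeral_eq_Suc All_less_Suc) blast
  have four: "(\<forall>i<4. P i) \<longleftrightarrow> P 0 \<and> P 1 \<and> P 2 \<and> P 3" for P :: "nat \<Rightarrow> bool"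
    by (simp add: numeral_eq_Suc All_less_Suc) blast
  have V: "v \<in> V \<longleftrightarrow> v \<in> topspace (Euclidean_space 3) \<and> \<bar>v 0\<bar> < e \<and> \<bar>v 1\<bar> < e \<and> \<bar>v 2 - 1\<bar> < e \<and> \<bar>2 * v 1 - v 2 + 1\<bar> < e" for v
    unfolding V_def mem_Collect_eq four L_def by simp
  have ord: "v 2 - v 1 > 0" if "v \<in> V" for v
    using that e unfolding V by linarith
  have oV: "openin (Euclidean_space 3) V"
    unfolding V_def
  proof (rule openin_Euclidean_box)
    have "\<forall>i<4. continuous_map (Euclidean_space 3) euclideanreal (L i)"
      unfolding four L_def
      by (simp, intro conjI continuous_map_diff continuous_map_add continuous_map_real_mult continuous_map_Euclidean_coord
          continuous_map_const[THEN iffD2]; simp)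
    moreover have "L i = L (i mod 4)" for i by (simp add: L_def fun_eq_iff)
    ultimately show "continuous_map (Euclidean_space 3) euclideanreal (L i)" for i
      by (metis mod_less_divisor zero_less_numeral)
  qed
  have parA: "par v \<in> Aut" if "v \<in> V" for v
    unfolding par by (rule translation_Aut[OF ord[OF that]])
  show ?thesis
  proof (rule has_dimensionI[OF openin_near_id[of e] oV, where par = par and rd = rd])
    show "(\<lambda>i. if i = 2 then 1 else 0) \<in> V"
      unfolding V using e by (simp add: topspace_Euclidean_space)
    show "continuous_map (subtopology (Euclidean_space 3) V) (aut_top (M_circles f1 f2 f3 f4)) par"
      unfolding par_def
    proof (rule chart_continuous)
      show "map_prod (mob 1 (v 0) 0 1) (mob (v 2 - v 1) (v 1) 0 1) \<in> Aut" if "v \<in> V" for v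
        using parA[OF that] by (simp add: par_def)
    next
      fix v :: "nat \<Rightarrow> real" assume "v \<in> V"
      from ord[OF this] show "1 * 1 - v 0 * 0 \<noteq> (0::real)" "(v 2 - v 1) * 1 - v 1 * 0 \<noteq> 0" by simp_all
    next
      fix h :: "(nat \<Rightarrow> real) \<Rightarrow> real"
      assume "h \<in> {\<lambda>v. 1, \<lambda>v. v 0, \<lambda>v. 0, \<lambda>v. 1, \<lambda>v. v 2 - v 1, \<lambda>v. v 1, \<lambda>v. 0, \<lambda>v. 1}"
      then show "continuous_map (Euclidean_space 3) euclideanreal h"
        by (elim insertE emptyE; simp only:;
            intro continuous_map_diff continuous_map_Euclidean_coord continuous_map_const[THEN iffD2]; simp)
    qed
    show "par v \<in> near_id e" if v: "v \<in> V" for v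
      using parA[OF v] v unfolding par by (intro near_id_pairI) (auto simp: V)
    show "continuous_map (subtopology (aut_top (M_circles f1 f2 f3 f4)) (near_id e)) euclideanreal (\<lambda>g. rd g i)" if "i < 3" for i
    proof -
      have "\<forall>i<3. continuous_map (subtopology (aut_top (M_circles f1 f2 f3 f4)) (near_id e)) euclideanreal (\<lambda>g. rd g i)"
        unfolding three rd_def using near_id_coord[OF e(2)] by simp
      then show ?thesis using that by blast
    qed
    show "rd (par v) i = v i" if "v \<in> V" "i < 3" for v i
    proof -
      have "\<forall>i<3. rd (par v) i = v i" unfolding three rd_def par by simp
      then show ?thesis using that(2) by simp
    qed
    fix g assume gU: "g \<in> near_id e"
    let ?v = "\<lambda>i. if i < 3 then rd g i else 0"
    obtain p q r s where g: "g = map_prod (aff p q) (aff r s)" and pA: "p > 0" "map_prod (aff p 0) id \<in> Aut"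
      and n: "\<bar>q\<bar> < e" "\<bar>p + q - 1\<bar> < e" "\<bar>s\<bar> < e" "\<bar>r + s - 1\<bar> < e" "\<bar>- r + s + 1\<bar> < e"
      by (rule near_id_affE[OF assms(1) e(2) gU])
    have "\<bar>p - 1\<bar> < d" using n e(3) by linarith
    then have p1: "p = 1" using d(2) pA by blast
    have v: "?v 0 = q" "?v 1 = s" "?v 2 = r + s"
      unfolding rd_def g by simp_all
    have "?v \<in> V" unfolding V v using n by (simp add: topspace_Euclidean_space algebra_simps)
    moreover have "par ?v = g" unfolding par v unfolding g p1 by simp
    ultimately show "?v \<in> V \<and> par ?v = g" ..
  qed
qed

end

theorem theorem5p8:
  fixes f1 f2 f3 f4 :: "real \<Rightarrow> real"
  assumes "strongly_hyperbolic f1" "strongly_hyperbolic f2"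
      and "strongly_hyperbolic f3" "strongly_hyperbolic f4"
      and "f1 1 = 1" "f3 1 = 1"
  defines "G \<equiv> aut_top (M_circles f1 f2 f3 f4)"
  defines "condI \<equiv> (\<forall>x>0. f1 x = 1 / x \<and> f2 x = 1 / x \<and> f3 x = 1 / x \<and> f4 x = 1 / x)"
  defines "condII \<equiv> (\<exists>r1 s1 r2 s2 :: real. r1 > 0 \<and> s1 > 0 \<and> r2 > 0 \<and> s2 > 0 \<and>
              (r1, s1, r2, s2) \<noteq> (1, 1, 1, 1) \<and>
              (\<forall>x>0. f1 x = x powr (- r1) \<and> f2 x = x powr (- r1) / s1 \<and>
                     f3 x = x powr (- r2) \<and> f4 x = x powr (- r2) / s2))"
  shows "(has_dimension G 6 \<longleftrightarrow> condI)
       \<and> (has_dimension G 4 \<longleftrightarrow> condII)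
       \<and> (has_dimension G 3 \<longleftrightarrow> \<not> condI \<and> \<not> condII)"
proof -
  interpret hyperbola_plane f1 f2 f3 f4 using assms(1-6) by unfold_locales
  define powers where "powers \<longleftrightarrow> (\<exists>r s. r > 0 \<and> s > 0 \<and> is_power r s f1 f2) \<and> (\<exists>r s. r > 0 \<and> s > 0 \<and> is_power r s f3 f4)"
  have I: "condI \<longleftrightarrow> classical"
    unfolding condI_def classical_def is_power_def by (auto simp: powr_minus_divide)
  have II: "condII \<longleftrightarrow> \<not> classical \<and> powers"
  proof
    assume condII
    then obtain r1 s1 r2 s2 where rs: "r1 > 0" "s1 > 0" "r2 > 0" "s2 > 0" "(r1, s1, r2, s2) \<noteq> (1, 1, 1, 1)"
      "\<And>x. x > 0 \<Longrightarrow> f1 x = x powr - r1 \<and> f2 x = x powr - r1 / s1 \<and> f3 x = x powr - r2 \<and> f4 x = x powr - r2 / s2"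
      unfolding condII_def by blast
    have "is_power r1 (1 / s1) f1 f2" "is_power r2 (1 / s2) f3 f4" using rs(6) by (simp_all add: is_power_def)
    then have "powers" unfolding powers_def using rs(1-4) by (meson zero_less_divide_1_iff)
    moreover have "\<not> classical"
    proof
      assume classical
      then have "f1 2 = 2 powr - 1" "f2 1 = 1" "f3 2 = 2 powr - 1" "f4 1 = 1" by (simp_all add: classical_def is_power_def)
      then have "(2::real) powr - r1 = 2 powr - 1" "(2::real) powr - r2 = 2 powr - 1" "1 / s1 = 1" "1 / s2 = 1"
        using rs(6)[of 1] rs(6)[of 2] by simp_all
      then have "r1 = 1" "r2 = 1" "s1 = 1" "s2 = 1" using powr_inj[of 2 "- r1" "- 1"] powr_inj[of 2 "- r2" "- 1"] by simp_all
      then show False using rs(5) by simp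
    qed
    ultimately show "\<not> classical \<and> powers" by simp
  next
    assume *: "\<not> classical \<and> powers"
    then obtain r s r' s' where rs: "r > 0" "s > 0" "is_power r s f1 f2" "r' > 0" "s' > 0" "is_power r' s' f3 f4"
      unfolding powers_def by blast
    have "(r, 1 / s, r', 1 / s') \<noteq> (1, 1, 1, 1)"
    proof
      assume "(r, 1 / s, r', 1 / s') = (1, 1, 1, 1)"
      then have "r = 1" "s = 1" "r' = 1" "s' = 1" using rs(2,5) by simp_all
      then show False using * rs unfolding classical_def by simp
    qed
    moreover have "\<forall>x>0. f1 x = x powr - r \<and> f2 x = x powr - r / (1 / s) \<and> f3 x = x powr - r' \<and> f4 x = x powr - r' / (1 / s')"
      using rs(3,6) by (simp add: is_power_def mult.commute)
    ultimately show condII unfolding condII_def using rs(1,2,4,5) by (meson zero_less_divide_1_iff)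
  qed
  have d6: "has_dimension G 6" if classical unfolding G_def by (rule has_dimension_6[OF that])
  have d4: "has_dimension G 4" if "\<not> classical" "powers"
    unfolding G_def using that has_dimension_4 unfolding powers_def by blast
  have d3: "has_dimension G 3" if "\<not> classical" "\<not> powers"
    unfolding G_def using that(2) unfolding powers_def by (rule has_dimension_3[OF that(1)])
  have u: "m = n" if "has_dimension G m" "has_dimension G n" for m n
    using has_dimension_unique_Aut that unfolding G_def by blast
  consider "classical" | "\<not> classical" "powers" | "\<not> classical" "\<not> powers" by blast
  then show ?thesis
  proof cases
    case 1
    then show ?thesis using u[OF d6[OF 1], of 4] u[OF d6[OF 1], of 3] d6[OF 1] by (auto simp: I II)
  next
    case 2
    then show ?thesis using u[OF d4[OF 2], of 6] u[OF d4[OF 2], of 3] d4[OF 2] by (auto simp: I II)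
  next
    case 3
    then show ?thesis using u[OF d3[OF 3], of 6] u[OF d3[OF 3], of 4] d3[OF 3] by (auto simp: I II)
  qed
qed

end
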